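(* Let $m\ge 1$, $l\ge 1$, let $M^{2m+2l}(c)$ be a Kaehler manifold of complex dimension $m+l$ and constant holomorphic sectional curvature $c$, and let $F^{2m}$ be a Kaehler submanifold of complex dimension $m$ in $M^{2m+2l}(c)$. If the second fundamental form $b$ of $F^{2m}$ is recurrent (that is, $b\neq 0$ and there exists a 1-form $\mu$ on $F^{2m}$ with $\overline\nabla b=\mu\otimes b$), then $F^{2m}$ is locally symmetric, i.e. $\nabla R\equiv 0$, where $\nabla$ and $R$ are the Levi-Civita connection and the Riemannian curvature tensor of the induced metric on $F^{2m}$.
   Context: $M^{2m+2l}$ carries an almost complex structure $J$ and a Riemannian metric $\widetilde g$ with $\widetilde g(JX,JY)=\widetilde g(X,Y)$ and $\widetilde\nabla J=0$, where $\widetilde\nabla$ is the Levi-Civita connection of $\widetilde g$ (Kaehler manifold). Constant holomorphic sectional curvature $c$ means that the curvature tensor satisfies $$\widetilde R(X,Y)Z=\tfrac{c}{4}\big(\widetilde g(Y,Z)X-\widetilde g(X,Z)Y+\widetilde g(JY,Z)JX-\widetilde g(JX,Z)JY+2\widetilde g(X,JY)JZ\big).$$ A submanifold $F^{2m}$ is a Kaehler submanifold if $JX\in TF^{2m}$ for every $X\in TF^{2m}$; it carries the induced metric $g$ with Levi-Civita connection $\nabla$. The second fundamental form $b$ is the normal part of $\widetilde\nabla_XY$, i.e. $\widetilde\nabla_XY=\nabla_XY+b(X,Y)$ for $X,Y$ tangent to $F^{2m}$, and the normal connection $D$ is given by letting $D_X\xi$ be the normal part of $\widetilde\nabla_X\xi$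 for $\xi$ normal to $F^{2m}$. $\overline\nabla=\nabla\oplus D$ is the van der Waerden–Bortolotti connection: $$(\overline\nabla_Xb)(Y,Z)=D_X(b(Y,Z))-b(\nabla_XY,Z)-b(Y,\nabla_XZ).$$ The condition $\overline\nabla b=\mu\otimes b$ means $(\overline\nabla_Xb)(Y,Z)=\mu(X)\,b(Y,Z)$ for all tangent $X,Y,Z$. Here $b\ne0$ means not identically zero. *)

theory Defs
  imports "HOL-Analysis.Analysis"
begin

section \<open>Smooth maps between normed spaces\<close>

primrec Ck_on :: "nat \<Rightarrow> 'a::real_normed_vector set \<Rightarrow> ('a \<Rightarrow> 'b::real_normed_vector) \<Rightarrow> bool" where
  "Ck_on 0 S f \<longleftrightarrow> continuous_on S f"
| "Ck_on (Suc k) S f \<longleftrightarrow>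
     (\<forall>x\<in>S. f differentiable at x) \<and> (\<forall>v. Ck_on k S (\<lambda>x. frechet_derivative f (at x) v))"

text \<open>Used for open \<open>S\<close> only; the values of \<open>f\<close> outside \<open>S\<close> are irrelevant.\<close>

definition smooth_on :: "'a::real_normed_vector set \<Rightarrow> ('a \<Rightarrow> 'b::real_normed_vector) \<Rightarrow> bool" where
  "smooth_on S f \<longleftrightarrow> (\<forall>k. Ck_on k S f)"

section \<open>Smooth manifolds and tangent vectors\<close>

text \<open>
  The points of a manifold form a type \<open>'p\<close>, which is Hausdorff and second countable in all uses
  below; the smooth structure is given by an atlas of charts with values in a Euclidean space
  \<open>'e\<close>, so that the dimension is \<open>DIM('e)\<close>. The map \<open>param c\<close> is the inverse of \<open>coord c\<close>.
\<close>

datatype ('p, 'e) chart = Chart (cdom: "'p set") (coord: "'p \<Rightarrow> 'e") (param: "'e \<Rightarrow> 'p")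

definition smooth_atlas :: "('p::topological_space, 'e::euclidean_space) chart set \<Rightarrow> bool" where
  "smooth_atlas A \<longleftrightarrow>
     (\<Union>c\<in>A. cdom c) = UNIV \<and>
     (\<forall>c\<in>A. open (cdom c) \<and> open (coord c ` cdom c) \<and>
        homeomorphism (cdom c) (coord c ` cdom c) (coord c) (param c)) \<and>
     (\<forall>c\<in>A. \<forall>d\<in>A. smooth_on (coord c ` (cdom c \<inter> cdom d)) (coord d \<circ> param c))"

text \<open>
  The tangent space at \<open>p\<close> is the space of pairs (chart around \<open>p\<close>, vector of \<open>'e\<close>) modulo
  changes of charts. Each class has exactly one representative belonging to the chart
  \<open>chart_at A p\<close>, which is chosen once and for all for each \<open>p\<close>. Accordingly an element of
  \<open>T\<^sub>pM\<close> is written as an element of \<open>'e\<close>, namely the vector of its components in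
  \<open>chart_at A p\<close>, and a vector field is a map \<open>'p \<Rightarrow> 'e\<close>. As \<open>chart_at A p\<close> jumps with \<open>p\<close>,
  such a map must never be differentiated directly, but only after passing to the components
  \<open>components A c p v\<close> in a fixed chart \<open>c\<close>.
\<close>

definition chart_at :: "('p, 'e) chart set \<Rightarrow> 'p \<Rightarrow> ('p, 'e) chart" where
  "chart_at A p = (SOME c. c \<in> A \<and> p \<in> cdom c)"

text \<open>Conversion of components with respect to \<open>c\<close> into components with respect to \<open>d\<close>.\<close>

definition tan_change ::
    "('p, 'e::euclidean_space) chart \<Rightarrow> ('p, 'e) chart \<Rightarrow> 'p \<Rightarrow> 'e \<Rightarrow> 'e" where
  "tan_change c d p v = frechet_derivative (coord d \<circ> param c) (at (coord c p)) v"

definition components ::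
    "('p, 'e::euclidean_space) chart set \<Rightarrow> ('p, 'e) chart \<Rightarrow> 'p \<Rightarrow> 'e \<Rightarrow> 'e" where
  "components A c p v = tan_change (chart_at A p) c p v"

text \<open>The vector field on \<open>cdom c\<close> whose components in \<open>c\<close> are constantly \<open>u\<close>; for \<open>u\<close> in \<open>Basis\<close>
  these are the coordinate fields \<open>\<partial>/\<partial>x\<^sup>i\<close>.\<close>

definition coord_field ::
    "('p, 'e::euclidean_space) chart set \<Rightarrow> ('p, 'e) chart \<Rightarrow> 'e \<Rightarrow> 'p \<Rightarrow> 'e" where
  "coord_field A c u = (\<lambda>p. tan_change c (chart_at A p) p u)"

definition smooth_fun ::
    "('p, 'e::euclidean_space) chart set \<Rightarrow> 'p set \<Rightarrow> ('p \<Rightarrow> real) \<Rightarrow> bool" where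
  "smooth_fun A U f \<longleftrightarrow> (\<forall>c\<in>A. smooth_on (coord c ` (U \<inter> cdom c)) (f \<circ> param c))"

definition smooth_field ::
    "('p, 'e::euclidean_space) chart set \<Rightarrow> 'p set \<Rightarrow> ('p \<Rightarrow> 'e) \<Rightarrow> bool" where
  "smooth_field A U X \<longleftrightarrow>
     (\<forall>c\<in>A. smooth_on (coord c ` (U \<inter> cdom c)) (\<lambda>x. components A c (param c x) (X (param c x))))"

text \<open>The derivative \<open>v(f)\<close> of a function \<open>f\<close> in the direction \<open>v \<in> T\<^sub>pM\<close>.\<close>

definition dir_deriv ::
    "('p, 'e::euclidean_space) chart set \<Rightarrow> 'p \<Rightarrow> 'e \<Rightarrow> ('p \<Rightarrow> real) \<Rightarrow> real" where
  "dir_deriv A p v f =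
     frechet_derivative (f \<circ> param (chart_at A p)) (at (coord (chart_at A p) p)) v"

definition lie_bracket ::
    "('p, 'e::euclidean_space) chart set \<Rightarrow> ('p \<Rightarrow> 'e) \<Rightarrow> ('p \<Rightarrow> 'e) \<Rightarrow> 'p \<Rightarrow> 'e" where
  "lie_bracket A X Y = (\<lambda>p.
     let c = chart_at A p;
         X' = (\<lambda>x. components A c (param c x) (X (param c x)));
         Y' = (\<lambda>x. components A c (param c x) (Y (param c x)))
     in frechet_derivative Y' (at (coord c p)) (X p) - frechet_derivative X' (at (coord c p)) (Y p))"

section \<open>Metrics, connections, curvature\<close>

definition riemannian_metric ::
    "('p::topological_space, 'e::euclidean_space) chart set \<Rightarrow> ('p \<Rightarrow> 'e \<Rightarrow> 'e \<Rightarrow> real) \<Rightarrow> bool" where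
  "riemannian_metric A g \<longleftrightarrow>
     (\<forall>p. bilinear (g p) \<and> (\<forall>v w. g p v w = g p w v) \<and> (\<forall>v. v \<noteq> 0 \<longrightarrow> g p v v > 0)) \<and>
     (\<forall>U X Y. open U \<and> smooth_field A U X \<and> smooth_field A U Y \<longrightarrow>
        smooth_fun A U (\<lambda>p. g p (X p) (Y p)))"

text \<open>
  A connection is given by \<open>nab p v Y\<close>, the covariant derivative at \<open>p\<close> in the direction
  \<open>v \<in> T\<^sub>pM\<close> of a vector field \<open>Y\<close> that is smooth on some open neighbourhood of \<open>p\<close>. As \<open>f\<close> and
  \<open>Y\<close> in the Leibniz rule need to be smooth only near \<open>p\<close>, the rule implies that \<open>nab p v Y\<close>
  depends on the germ of \<open>Y\<close> at \<open>p\<close> only (take for \<open>f\<close> the indicator function of a neighbourhood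
  of \<open>p\<close>), so these are the usual affine connections. The operator on vector fields is
  \<open>cov nab X Y\<close>.
\<close>

definition cov :: "('p \<Rightarrow> 'e \<Rightarrow> ('p \<Rightarrow> 'e) \<Rightarrow> 'e) \<Rightarrow> ('p \<Rightarrow> 'e) \<Rightarrow> ('p \<Rightarrow> 'e) \<Rightarrow> ('p \<Rightarrow> 'e)" where
  "cov nab X Y = (\<lambda>p. nab p (X p) Y)"

definition affine_connection ::
    "('p::topological_space, 'e::euclidean_space) chart set \<Rightarrow>
     ('p \<Rightarrow> 'e \<Rightarrow> ('p \<Rightarrow> 'e) \<Rightarrow> 'e) \<Rightarrow> bool" where
  "affine_connection A nab \<longleftrightarrow>
     (\<forall>U Y. open U \<and> smooth_field A U Y \<longrightarrow> (\<forall>p\<in>U. linear (\<lambda>v. nab p v Y))) \<and>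
     (\<forall>U Y Z. open U \<and> smooth_field A U Y \<and> smooth_field A U Z \<longrightarrow>
        (\<forall>p\<in>U. \<forall>v. nab p v (\<lambda>q. Y q + Z q) = nab p v Y + nab p v Z)) \<and>
     (\<forall>U f Y. open U \<and> smooth_fun A U f \<and> smooth_field A U Y \<longrightarrow>
        (\<forall>p\<in>U. \<forall>v. nab p v (\<lambda>q. f q *\<^sub>R Y q) = dir_deriv A p v f *\<^sub>R Y p + f p *\<^sub>R nab p v Y)) \<and>
     (\<forall>U X Y. open U \<and> smooth_field A U X \<and> smooth_field A U Y \<longrightarrow>
        smooth_field A U (cov nab X Y))"

definition levi_civita ::
    "('p::topological_space, 'e::euclidean_space) chart set \<Rightarrow> ('p \<Rightarrow> 'e \<Rightarrow> 'e \<Rightarrow> real) \<Rightarrow>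
     ('p \<Rightarrow> 'e \<Rightarrow> ('p \<Rightarrow> 'e) \<Rightarrow> 'e) \<Rightarrow> bool" where
  "levi_civita A g nab \<longleftrightarrow>
     affine_connection A nab \<and>
     (\<forall>U X Y. open U \<and> smooth_field A U X \<and> smooth_field A U Y \<longrightarrow>
        (\<forall>p\<in>U. cov nab X Y p - cov nab Y X p = lie_bracket A X Y p)) \<and>
     (\<forall>U Y Z. open U \<and> smooth_field A U Y \<and> smooth_field A U Z \<longrightarrow>
        (\<forall>p\<in>U. \<forall>v. dir_deriv A p v (\<lambda>q. g q (Y q) (Z q)) =
           g p (nab p v Y) (Z p) + g p (Y p) (nab p v Z)))"

definition curvature ::
    "('p, 'e::euclidean_space) chart set \<Rightarrow> ('p \<Rightarrow> 'e \<Rightarrow> ('p \<Rightarrow> 'e) \<Rightarrow> 'e) \<Rightarrow>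
     ('p \<Rightarrow> 'e) \<Rightarrow> ('p \<Rightarrow> 'e) \<Rightarrow> ('p \<Rightarrow> 'e) \<Rightarrow> ('p \<Rightarrow> 'e)" where
  "curvature A nab X Y Z = (\<lambda>p.
     cov nab X (cov nab Y Z) p - cov nab Y (cov nab X Z) p - cov nab (lie_bracket A X Y) Z p)"

text \<open>\<open>(\<nabla>\<^sub>V R)(X,Y)Z\<close>\<close>

definition cov_curvature ::
    "('p, 'e::euclidean_space) chart set \<Rightarrow> ('p \<Rightarrow> 'e \<Rightarrow> ('p \<Rightarrow> 'e) \<Rightarrow> 'e) \<Rightarrow>
     ('p \<Rightarrow> 'e) \<Rightarrow> ('p \<Rightarrow> 'e) \<Rightarrow> ('p \<Rightarrow> 'e) \<Rightarrow> ('p \<Rightarrow> 'e) \<Rightarrow> ('p \<Rightarrow> 'e)" where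
  "cov_curvature A nab V X Y Z = (\<lambda>p.
     cov nab V (curvature A nab X Y Z) p - curvature A nab (cov nab V X) Y Z p
     - curvature A nab X (cov nab V Y) Z p - curvature A nab X Y (cov nab V Z) p)"

definition locally_symmetric ::
    "('p::topological_space, 'e::euclidean_space) chart set \<Rightarrow>
     ('p \<Rightarrow> 'e \<Rightarrow> ('p \<Rightarrow> 'e) \<Rightarrow> 'e) \<Rightarrow> bool" where
  "locally_symmetric A nab \<longleftrightarrow>
     (\<forall>U V X Y Z. open U \<and> smooth_field A U V \<and> smooth_field A U X \<and>
        smooth_field A U Y \<and> smooth_field A U Z \<longrightarrow>
        (\<forall>p\<in>U. cov_curvature A nab V X Y Z p = 0))"

section \<open>Kaehler manifolds\<close>

definition almost_complex_structure ::
    "('p::topological_space, 'e::euclidean_space) chart set \<Rightarrow> ('p \<Rightarrow> 'e \<Rightarrow> 'e) \<Rightarrow> bool" where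
  "almost_complex_structure A J \<longleftrightarrow>
     (\<forall>p. linear (J p) \<and> (\<forall>v. J p (J p v) = - v)) \<and>
     (\<forall>U X. open U \<and> smooth_field A U X \<longrightarrow> smooth_field A U (\<lambda>p. J p (X p)))"

text \<open>Here \<open>nab\<close> is the Levi-Civita connection of \<open>g\<close>, and the last condition is \<open>\<nabla>J = 0\<close>.\<close>

definition kaehler_manifold ::
    "('p::topological_space, 'e::euclidean_space) chart set \<Rightarrow> ('p \<Rightarrow> 'e \<Rightarrow> 'e \<Rightarrow> real) \<Rightarrow>
     ('p \<Rightarrow> 'e \<Rightarrow> 'e) \<Rightarrow> ('p \<Rightarrow> 'e \<Rightarrow> ('p \<Rightarrow> 'e) \<Rightarrow> 'e) \<Rightarrow> bool" where
  "kaehler_manifold A g J nab \<longleftrightarrow>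
     smooth_atlas A \<and> riemannian_metric A g \<and> almost_complex_structure A J \<and>
     levi_civita A g nab \<and>
     (\<forall>p v w. g p (J p v) (J p w) = g p v w) \<and>
     (\<forall>U Y. open U \<and> smooth_field A U Y \<longrightarrow>
        (\<forall>p\<in>U. \<forall>v. nab p v (\<lambda>q. J q (Y q)) - J p (nab p v Y) = 0))"

definition constant_holomorphic_curvature ::
    "('p::topological_space, 'e::euclidean_space) chart set \<Rightarrow> ('p \<Rightarrow> 'e \<Rightarrow> 'e \<Rightarrow> real) \<Rightarrow>
     ('p \<Rightarrow> 'e \<Rightarrow> 'e) \<Rightarrow> ('p \<Rightarrow> 'e \<Rightarrow> ('p \<Rightarrow> 'e) \<Rightarrow> 'e) \<Rightarrow> real \<Rightarrow> bool" where
  "constant_holomorphic_curvature A g J nab c \<longleftrightarrow>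
     (\<forall>U X Y Z. open U \<and> smooth_field A U X \<and> smooth_field A U Y \<and> smooth_field A U Z \<longrightarrow>
        (\<forall>p\<in>U. curvature A nab X Y Z p =
           (c / 4) *\<^sub>R (g p (Y p) (Z p) *\<^sub>R X p - g p (X p) (Z p) *\<^sub>R Y p
             + g p (J p (Y p)) (Z p) *\<^sub>R J p (X p) - g p (J p (X p)) (Z p) *\<^sub>R J p (Y p)
             + (2 * g p (X p) (J p (Y p))) *\<^sub>R J p (Z p))))"

section \<open>Immersed submanifolds\<close>

text \<open>
  A submanifold is given by a manifold \<open>F\<close> with atlas \<open>B\<close>, a manifold \<open>M\<close> with atlas \<open>A\<close>, and an
  immersion \<open>\<iota>\<close> from \<open>F\<close> to \<open>M\<close>; embedded submanifolds are a special case.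
\<close>

definition smooth_map ::
    "('q::topological_space, 'f::euclidean_space) chart set \<Rightarrow>
     ('p::topological_space, 'e::euclidean_space) chart set \<Rightarrow> ('q \<Rightarrow> 'p) \<Rightarrow> bool" where
  "smooth_map B A \<iota> \<longleftrightarrow> continuous_on UNIV \<iota> \<and>
     (\<forall>c\<in>B. \<forall>d\<in>A. smooth_on (coord c ` (cdom c \<inter> \<iota> -` cdom d)) (coord d \<circ> \<iota> \<circ> param c))"

definition differential ::
    "('q, 'f::euclidean_space) chart set \<Rightarrow> ('p, 'e::euclidean_space) chart set \<Rightarrow>
     ('q \<Rightarrow> 'p) \<Rightarrow> 'q \<Rightarrow> 'f \<Rightarrow> 'e" where
  "differential B A \<iota> p v =
     frechet_derivative (coord (chart_at A (\<iota> p)) \<circ> \<iota> \<circ> param (chart_at B p))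
       (at (coord (chart_at B p) p)) v"

definition immersion ::
    "('q::topological_space, 'f::euclidean_space) chart set \<Rightarrow>
     ('p::topological_space, 'e::euclidean_space) chart set \<Rightarrow> ('q \<Rightarrow> 'p) \<Rightarrow> bool" where
  "immersion B A \<iota> \<longleftrightarrow> smooth_map B A \<iota> \<and> (\<forall>p. inj (differential B A \<iota> p))"

definition kaehler_submanifold ::
    "('q::topological_space, 'f::euclidean_space) chart set \<Rightarrow>
     ('p::topological_space, 'e::euclidean_space) chart set \<Rightarrow> ('p \<Rightarrow> 'e \<Rightarrow> 'e) \<Rightarrow>
     ('q \<Rightarrow> 'p) \<Rightarrow> bool" where
  "kaehler_submanifold B A J \<iota> \<longleftrightarrow>
     smooth_atlas B \<and> immersion B A \<iota> \<and>
     (\<forall>p. \<forall>w \<in> range (differential B A \<iota> p). J (\<iota> p) w \<in> range (differential B A \<iota> p))"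

definition induced_metric ::
    "('q, 'f::euclidean_space) chart set \<Rightarrow> ('p, 'e::euclidean_space) chart set \<Rightarrow>
     ('p \<Rightarrow> 'e \<Rightarrow> 'e \<Rightarrow> real) \<Rightarrow> ('q \<Rightarrow> 'p) \<Rightarrow> 'q \<Rightarrow> 'f \<Rightarrow> 'f \<Rightarrow> real" where
  "induced_metric B A g \<iota> p v w = g (\<iota> p) (differential B A \<iota> p v) (differential B A \<iota> p w)"

definition normal_space ::
    "('q, 'f::euclidean_space) chart set \<Rightarrow> ('p, 'e::euclidean_space) chart set \<Rightarrow>
     ('p \<Rightarrow> 'e \<Rightarrow> 'e \<Rightarrow> real) \<Rightarrow> ('q \<Rightarrow> 'p) \<Rightarrow> 'q \<Rightarrow> 'e set" where
  "normal_space B A g \<iota> p = {\<xi>. \<forall>v. g (\<iota> p) \<xi> (differential B A \<iota> p v) = 0}"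

definition normal_part ::
    "('q, 'f::euclidean_space) chart set \<Rightarrow> ('p, 'e::euclidean_space) chart set \<Rightarrow>
     ('p \<Rightarrow> 'e \<Rightarrow> 'e \<Rightarrow> real) \<Rightarrow> ('q \<Rightarrow> 'p) \<Rightarrow> 'q \<Rightarrow> 'e \<Rightarrow> 'e" where
  "normal_part B A g \<iota> p w =
     (THE \<xi>. \<xi> \<in> normal_space B A g \<iota> p \<and> w - \<xi> \<in> range (differential B A \<iota> p))"

text \<open>
  The covariant derivative, in the direction \<open>v \<in> T\<^sub>pF\<close>, of a vector field \<open>W\<close> along \<open>\<iota>\<close> (that is,
  \<open>W q \<in> T\<^bsub>\<iota> q\<^esub>M\<close>), with respect to the connection \<open>nab\<close> of \<open>M\<close>. Writing
  \<open>W = \<Sum>\<^sub>i W\<^sup>i (\<partial>/\<partial>x\<^sup>i \<circ> \<iota>)\<close> in the chart of \<open>M\<close> chosen at \<open>\<iota> p\<close>, it is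
  \<open>\<Sum>\<^sub>i (v(W\<^sup>i) \<partial>/\<partial>x\<^sup>i + W\<^sup>i(p) \<nabla>\<^bsub>d\<iota>(v)\<^esub> \<partial>/\<partial>x\<^sup>i)\<close>.
  If \<open>W\<close> is near \<open>p\<close> the restriction of a vector field of \<open>M\<close>, this is the covariant
  derivative of the latter in the direction \<open>d\<iota>(v)\<close>.
\<close>

definition cov_along ::
    "('q, 'f::euclidean_space) chart set \<Rightarrow> ('p, 'e::euclidean_space) chart set \<Rightarrow>
     ('p \<Rightarrow> 'e \<Rightarrow> ('p \<Rightarrow> 'e) \<Rightarrow> 'e) \<Rightarrow> ('q \<Rightarrow> 'p) \<Rightarrow> 'q \<Rightarrow> 'f \<Rightarrow> ('q \<Rightarrow> 'e) \<Rightarrow> 'e" where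
  "cov_along B A nab \<iota> p v W =
     (let c = chart_at B p; d = chart_at A (\<iota> p) in
        frechet_derivative (\<lambda>x. components A d (\<iota> (param c x)) (W (param c x))) (at (coord c p)) v
        + (\<Sum>i\<in>Basis. (W p \<bullet> i) *\<^sub>R nab (\<iota> p) (differential B A \<iota> p v) (coord_field A d i)))"

text \<open>\<open>b(X,Y)\<close>, the normal part of the derivative of \<open>Y\<close> (regarded as a field along \<open>\<iota>\<close>) along \<open>X\<close>\<close>

definition second_fundamental_form ::
    "('q, 'f::euclidean_space) chart set \<Rightarrow> ('p, 'e::euclidean_space) chart set \<Rightarrow>
     ('p \<Rightarrow> 'e \<Rightarrow> 'e \<Rightarrow> real) \<Rightarrow> ('p \<Rightarrow> 'e \<Rightarrow> ('p \<Rightarrow> 'e) \<Rightarrow> 'e) \<Rightarrow> ('q \<Rightarrow> 'p) \<Rightarrow>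
     ('q \<Rightarrow> 'f) \<Rightarrow> ('q \<Rightarrow> 'f) \<Rightarrow> ('q \<Rightarrow> 'e)" where
  "second_fundamental_form B A g nab \<iota> X Y = (\<lambda>p.
     normal_part B A g \<iota> p (cov_along B A nab \<iota> p (X p) (\<lambda>q. differential B A \<iota> q (Y q))))"

definition normal_connection ::
    "('q, 'f::euclidean_space) chart set \<Rightarrow> ('p, 'e::euclidean_space) chart set \<Rightarrow>
     ('p \<Rightarrow> 'e \<Rightarrow> 'e \<Rightarrow> real) \<Rightarrow> ('p \<Rightarrow> 'e \<Rightarrow> ('p \<Rightarrow> 'e) \<Rightarrow> 'e) \<Rightarrow> ('q \<Rightarrow> 'p) \<Rightarrow>
     ('q \<Rightarrow> 'f) \<Rightarrow> ('q \<Rightarrow> 'e) \<Rightarrow> ('q \<Rightarrow> 'e)" where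
  "normal_connection B A g nab \<iota> X \<xi> = (\<lambda>p.
     normal_part B A g \<iota> p (cov_along B A nab \<iota> p (X p) \<xi>))"

text \<open>The van der Waerden-Bortolotti derivative \<open>(\<nabla>\<^sub>X b)(Y,Z)\<close>; \<open>nabF\<close> is a connection of \<open>F\<close>.\<close>

definition vdWB_derivative ::
    "('q, 'f::euclidean_space) chart set \<Rightarrow> ('p, 'e::euclidean_space) chart set \<Rightarrow>
     ('p \<Rightarrow> 'e \<Rightarrow> 'e \<Rightarrow> real) \<Rightarrow> ('p \<Rightarrow> 'e \<Rightarrow> ('p \<Rightarrow> 'e) \<Rightarrow> 'e) \<Rightarrow>
     ('q \<Rightarrow> 'f \<Rightarrow> ('q \<Rightarrow> 'f) \<Rightarrow> 'f) \<Rightarrow> ('q \<Rightarrow> 'p) \<Rightarrow>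
     ('q \<Rightarrow> 'f) \<Rightarrow> ('q \<Rightarrow> 'f) \<Rightarrow> ('q \<Rightarrow> 'f) \<Rightarrow> ('q \<Rightarrow> 'e)" where
  "vdWB_derivative B A g nab nabF \<iota> X Y Z =
     (let b = second_fundamental_form B A g nab \<iota> in
      (\<lambda>p. normal_connection B A g nab \<iota> X (b Y Z) p - b (cov nabF X Y) Z p - b Y (cov nabF X Z) p))"

definition one_form ::
    "('q::topological_space, 'f::euclidean_space) chart set \<Rightarrow> ('q \<Rightarrow> 'f \<Rightarrow> real) \<Rightarrow> bool" where
  "one_form B \<mu> \<longleftrightarrow> (\<forall>p. linear (\<mu> p)) \<and>
     (\<forall>U X. open U \<and> smooth_field B U X \<longrightarrow> smooth_fun B U (\<lambda>p. \<mu> p (X p)))"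

definition recurrent_second_fundamental_form ::
    "('q::topological_space, 'f::euclidean_space) chart set \<Rightarrow>
     ('p::topological_space, 'e::euclidean_space) chart set \<Rightarrow>
     ('p \<Rightarrow> 'e \<Rightarrow> 'e \<Rightarrow> real) \<Rightarrow> ('p \<Rightarrow> 'e \<Rightarrow> ('p \<Rightarrow> 'e) \<Rightarrow> 'e) \<Rightarrow>
     ('q \<Rightarrow> 'f \<Rightarrow> ('q \<Rightarrow> 'f) \<Rightarrow> 'f) \<Rightarrow> ('q \<Rightarrow> 'p) \<Rightarrow> bool" where
  "recurrent_second_fundamental_form B A g nab nabF \<iota> \<longleftrightarrow>
     (\<exists>U X Y. open U \<and> smooth_field B U X \<and> smooth_field B U Y \<and>
        (\<exists>p\<in>U. second_fundamental_form B A g nab \<iota> X Y p \<noteq> 0)) \<and>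
     (\<exists>\<mu>. one_form B \<mu> \<and>
        (\<forall>U X Y Z. open U \<and> smooth_field B U X \<and> smooth_field B U Y \<and> smooth_field B U Z \<longrightarrow>
           (\<forall>p\<in>U. vdWB_derivative B A g nab nabF \<iota> X Y Z p =
              \<mu> p (X p) *\<^sub>R second_fundamental_form B A g nab \<iota> Y Z p)))"

end

theory Submission
  imports Defs
begin

text \<open>
  By the Codazzi equation, whose curvature term is tangent to the submanifold, \<open>\<nabla>b = \<mu> \<otimes> b\<close> is symmetric
  in all its arguments, so \<open>\<mu>(X) b(Y,Z) = \<mu>(Y) b(X,Z)\<close>. With \<open>b(JX,Z) = J b(X,Z)\<close> this gives
  \<open>\<mu>(JX) b(Y,Z) = \<mu>(Y) J b(X,Z) = \<mu>(X) J b(Y,Z)\<close>. As \<open>b(Y,Z)\<close> and \<open>J b(Y,Z)\<close> are orthogonal and of the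
  same length, \<open>\<mu>\<close> vanishes wherever \<open>b\<close> does not. Hence \<open>b\<close> is parallel, and by the Gauss equation
  \<open>R\<close> is a polynomial in the parallel tensors \<open>g\<close>, \<open>J\<close> and \<open>b\<close>.
\<close>

section \<open>Calculus of smooth maps\<close>

text \<open>The ambient connection differentiates only fields on open sets of the ambient manifold,
  whereas \<open>b(Y,Z)\<close> is a field along the immersion, whose image may cross itself. Most
  of the work therefore goes into a pulled-back connection. Its compatibility with torsion, metric,
  \<open>J\<close> and curvature is reduced to restrictions of ambient fields, from which all fields
  along \<open>\<iota>\<close> are generated locally over the smooth functions.

  The second obstacle is the normal projection, whose smoothness would have to be known before
  \<open>b\<close> could be differentiated. Instead, \<open>b\<close> is kept as the difference of
  the two covariant derivatives, which is smooth by construction, and equations between normal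
  vectors are tested by the metric against normal vectors, which absorbs the projection. "Parallel"
  accordingly means that the unprojected derivative of \<open>b\<close> has no normal component. Its
  tangential part is orthogonal to all values of \<open>b\<close> and so does not disturb the
  Leibniz rule for the curvature.

  What has to vanish is the product \<mu> \<otimes> b. It does so at every point, so the zero set of
  \<open>b\<close> never has to be studied.\<close>

lemma Ck_on_cong:
  assumes "open S" "\<And>x. x \<in> S \<Longrightarrow> f x = g x" "Ck_on k S f"
  shows "Ck_on k S g"
  using assms(2,3)
proof (induction k arbitrary: f g)
  case 0
  then show ?case by (metis Ck_on.simps(1) continuous_on_cong)
next
  case (Suc k)
  have d: "(g has_derivative frechet_derivative f (at x)) (at x)" if "x \<in> S" for x
  proof (rule has_derivative_transform_within_open[OF _ assms(1) that])
    show "(f has_derivative frechet_derivative f (at x)) (at x)"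
      using Suc.prems(2) that by (simp add: frechet_derivative_works[symmetric])
  qed (rule Suc.prems(1))
  have e: "frechet_derivative f (at x) = frechet_derivative g (at x)" if "x \<in> S" for x
    by (rule frechet_derivative_at[OF d[OF that]])
  have "Ck_on k S (\<lambda>x. frechet_derivative g (at x) v)" for v
    by (rule Suc.IH[of "\<lambda>x. frechet_derivative f (at x) v"]) (use Suc.prems(2) e in simp_all)
  then show ?case using d unfolding Ck_on.simps differentiable_def by blast
qed

lemma Ck_on_subset: "Ck_on k S f \<Longrightarrow> T \<subseteq> S \<Longrightarrow> Ck_on k T f"
proof (induction k arbitrary: f)
  case 0
  then show ?case using continuous_on_subset by simp
next
  case (Suc k)
  have "Ck_on k T (\<lambda>x. frechet_derivative f (at x) v)" for v
    by (rule Suc.IH) (use Suc.prems in simp_all)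
  then show ?case using Suc.prems unfolding Ck_on.simps by blast
qed

lemma Ck_on_local:
  assumes "\<And>x. x \<in> S \<Longrightarrow> \<exists>N. open N \<and> x \<in> N \<and> Ck_on k N f"
  shows "Ck_on k S f"
  using assms
proof (induction k arbitrary: f)
  case 0
  then show ?case
    unfolding Ck_on.simps by (meson continuous_at_imp_continuous_on continuous_on_eq_continuous_at)
next
  case (Suc k)
  show ?case
    unfolding Ck_on.simps
  proof (intro conjI ballI allI)
    fix x assume "x \<in> S"
    then show "f differentiable at x" using Suc.prems by force
  next
    fix v show "Ck_on k S (\<lambda>x. frechet_derivative f (at x) v)"
    proof (rule Suc.IH)
      fix x assume "x \<in> S"
      from Suc.prems[OF this] show "\<exists>N. open N \<and> x \<in> N \<and> Ck_on k N (\<lambda>x. frechet_derivative f (at x) v)"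
        by auto
    qed
  qed
qed

lemma Ck_on_SucD: "Ck_on (Suc k) S f \<Longrightarrow> Ck_on k S f"
proof (induction k arbitrary: f)
  case 0
  then show ?case
    by (simp add: continuous_at_imp_continuous_on differentiable_imp_continuous_within)
next
  case (Suc k)
  then show ?case by (metis Ck_on.simps(2))
qed

lemma Ck_on_const: "Ck_on k S (\<lambda>x. a)"
  by (induction k arbitrary: a) auto

text \<open>\<open>Ck_on\<close> is defined through the choice term
  \<open>frechet_derivative\<close>; on an open set any explicitly computed derivative may replace
  it. The rules for linear maps, sums, products and compositions feed their differentiation rule
  into this form.\<close>

lemma Ck_on_SucI:
  assumes "open S" "\<And>x. x \<in> S \<Longrightarrow> (f has_derivative f' x) (at x)"
    and "\<And>v. Ck_on k S (\<lambda>x. f' x v)"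
  shows "Ck_on (Suc k) S f"
proof -
  have "Ck_on k S (\<lambda>x. frechet_derivative f (at x) v)" for v
    by (rule Ck_on_cong[OF assms(1) _ assms(3)[of v]]) (metis frechet_derivative_at[OF assms(2)])
  then show ?thesis using assms(2) by (auto simp: differentiable_def)
qed

lemma Ck_on_Suc_has_derivative:
  "Ck_on (Suc k) S f \<Longrightarrow> x \<in> S \<Longrightarrow> (f has_derivative frechet_derivative f (at x)) (at x)"
  by (simp add: frechet_derivative_works[symmetric])

lemma Ck_on_linear:
  assumes "bounded_linear h" "open S" "Ck_on k S f" shows "Ck_on k S (\<lambda>x. h (f x))"
  using assms(3)
proof (induction k arbitrary: f)
  case 0
  then show ?case using assms(1) by (simp add: bounded_linear.continuous_on)
next
  case (Suc k)
  show ?case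
    by (rule Ck_on_SucI[OF assms(2) bounded_linear.has_derivative[OF assms(1)
          Ck_on_Suc_has_derivative[OF Suc.prems]]])
      (use Suc in auto)
qed

lemma Ck_on_add:
  assumes "open S" "Ck_on k S f" "Ck_on k S g" shows "Ck_on k S (\<lambda>x. f x + g x)"
  using assms(2,3)
proof (induction k arbitrary: f g)
  case 0
  then show ?case by (auto intro: continuous_on_add)
next
  case (Suc k)
  show ?case
    by (rule Ck_on_SucI[OF assms(1) has_derivative_add[OF
          Ck_on_Suc_has_derivative[OF Suc.prems(1)] Ck_on_Suc_has_derivative[OF Suc.prems(2)]]])
      (use Suc in auto)
qed

lemma Ck_on_sum:
  assumes "open S" "\<And>i. i \<in> I \<Longrightarrow> Ck_on k S (f i)" shows "Ck_on k S (\<lambda>x. \<Sum>i\<in>I. f i x)"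
  using assms(2) by (induction I rule: infinite_finite_induct) (auto intro: Ck_on_const Ck_on_add assms(1))

text \<open>The derivative is a sum of two such products, each pairing one factor with a derivative
  of the other. The undifferentiated factor has to be downgraded by one order before the induction
  hypothesis applies.\<close>

lemma Ck_on_bilinear:
  assumes h: "bounded_bilinear h" and S: "open S" and "Ck_on k S f" "Ck_on k S g"
  shows "Ck_on k S (\<lambda>x. h (f x) (g x))"
  using assms(3,4)
proof (induction k arbitrary: f g)
  case 0
  then show ?case using bounded_bilinear.continuous_on[OF h] by auto
next
  case (Suc k)
  show ?case
    by (rule Ck_on_SucI[OF S bounded_bilinear.FDERIV[OF h
          Ck_on_Suc_has_derivative[OF Suc.prems(1)] Ck_on_Suc_has_derivative[OF Suc.prems(2)]]])
      (use Suc Ck_on_SucD[OF Suc.prems(1)] Ck_on_SucD[OF Suc.prems(2)] in \<open>auto intro!: Ck_on_add S\<close>)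
qed

lemma linear_expansion_Basis:
  fixes h :: "'a::euclidean_space \<Rightarrow> 'b::real_vector"
  assumes "linear h" shows "h w = (\<Sum>i\<in>Basis. (w \<bullet> i) *\<^sub>R h i)"
proof -
  have "h w = h (\<Sum>i\<in>Basis. (w \<bullet> i) *\<^sub>R i)" by (simp only: euclidean_representation)
  also have "\<dots> = (\<Sum>i\<in>Basis. (w \<bullet> i) *\<^sub>R h i)"
    by (simp only: linear_sum[OF assms] linear_scale[OF assms])
  finally show ?thesis .
qed

text \<open>\<open>Ck_on\<close> controls derivatives in a fixed direction only, while the chain
  rule evaluates the derivative of \<open>f\<close> in the moving direction given by the derivative
  of \<open>g\<close>. Expanding this direction in \<open>Basis\<close> leaves products of scalar
  functions with derivatives in fixed directions.\<close>

lemma Ck_on_compose: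
  fixes g :: "'a::euclidean_space \<Rightarrow> 'b::euclidean_space"
  assumes S: "open S" and "Ck_on k S g" "Ck_on k T f" "g ` S \<subseteq> T"
  shows "Ck_on k S (\<lambda>x. f (g x))"
  using assms(2-4)
proof (induction k arbitrary: f)
  case 0
  then show ?case by (auto intro: continuous_on_compose2)
next
  case (Suc k)
  let ?f = "\<lambda>y. frechet_derivative f (at y)" and ?g = "\<lambda>x. frechet_derivative g (at x)"
  have d: "((\<lambda>x. f (g x)) has_derivative (\<lambda>v. \<Sum>i\<in>Basis. (?g x v \<bullet> i) *\<^sub>R ?f (g x) i)) (at x)"
    if "x \<in> S" for x
  proof -
    have f: "(f has_derivative ?f (g x)) (at (g x))"
      by (rule Ck_on_Suc_has_derivative[OF Suc.prems(2)]) (use Suc.prems(3) that in blast)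
    have "((\<lambda>x. f (g x)) has_derivative (\<lambda>v. ?f (g x) (?g x v))) (at x)"
      by (rule has_derivative_compose[where g = f, OF Ck_on_Suc_has_derivative[OF Suc.prems(1) that] f])
    also have "(\<lambda>v. ?f (g x) (?g x v)) = (\<lambda>v. \<Sum>i\<in>Basis. (?g x v \<bullet> i) *\<^sub>R ?f (g x) i)"
      by (rule ext, rule linear_expansion_Basis[OF has_derivative_linear[OF f]])
    finally show ?thesis .
  qed
  show ?case
  proof (rule Ck_on_SucI[OF S d], assumption)
    fix v
    show "Ck_on k S (\<lambda>x. \<Sum>i\<in>Basis. (?g x v \<bullet> i) *\<^sub>R ?f (g x) i)"
    proof (intro Ck_on_sum[OF S] Ck_on_bilinear[OF bounded_bilinear_scaleR S])
      fix i :: 'b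
      show "Ck_on k S (\<lambda>x. ?g x v \<bullet> i)"
        by (rule Ck_on_linear[OF bounded_linear_inner_left S]) (use Suc.prems(1) in simp)
      show "Ck_on k S (\<lambda>x. ?f (g x) i)"
        by (rule Suc.IH[OF Ck_on_SucD[OF Suc.prems(1)] _ Suc.prems(3)]) (use Suc.prems(2) in simp)
    qed
  qed
qed

section \<open>Closure properties of infinitely differentiable maps\<close>

lemma smooth_on_cong:
  "open S \<Longrightarrow> (\<And>x. x \<in> S \<Longrightarrow> f x = g x) \<Longrightarrow> smooth_on S f \<Longrightarrow> smooth_on S g"
  unfolding smooth_on_def using Ck_on_cong by blast

lemma smooth_on_subset: "smooth_on S f \<Longrightarrow> T \<subseteq> S \<Longrightarrow> smooth_on T f"
  unfolding smooth_on_def using Ck_on_subset by blast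

lemma smooth_on_local:
  assumes "\<And>x. x \<in> S \<Longrightarrow> \<exists>N. open N \<and> x \<in> N \<and> smooth_on N f"
  shows "smooth_on S f"
  unfolding smooth_on_def
  by (intro allI Ck_on_local) (use assms in \<open>auto simp: smooth_on_def\<close>)

lemma smooth_on_const: "smooth_on S (\<lambda>x. a)"
  by (simp add: smooth_on_def Ck_on_const)

lemma smooth_on_linear:
  "bounded_linear h \<Longrightarrow> open S \<Longrightarrow> smooth_on S f \<Longrightarrow> smooth_on S (\<lambda>x. h (f x))"
  by (simp add: smooth_on_def Ck_on_linear)

lemma smooth_on_add:
  "open S \<Longrightarrow> smooth_on S f \<Longrightarrow> smooth_on S g \<Longrightarrow> smooth_on S (\<lambda>x. f x + g x)"
  by (simp add: smooth_on_def Ck_on_add)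

lemma smooth_on_sum:
  "open S \<Longrightarrow> (\<And>i. i \<in> I \<Longrightarrow> smooth_on S (f i)) \<Longrightarrow> smooth_on S (\<lambda>x. \<Sum>i\<in>I. f i x)"
  by (simp add: smooth_on_def Ck_on_sum)

lemma smooth_on_bilinear:
  "bounded_bilinear h \<Longrightarrow> open S \<Longrightarrow> smooth_on S f \<Longrightarrow> smooth_on S g \<Longrightarrow> smooth_on S (\<lambda>x. h (f x) (g x))"
  by (simp add: smooth_on_def Ck_on_bilinear)

lemma smooth_on_compose:
  fixes g :: "'a::euclidean_space \<Rightarrow> 'b::euclidean_space"
  shows "open S \<Longrightarrow> smooth_on S g \<Longrightarrow> smooth_on T f \<Longrightarrow> g ` S \<subseteq> T \<Longrightarrow> smooth_on S (\<lambda>x. f (g x))"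
  unfolding smooth_on_def using Ck_on_compose[of S _ g T f] by simp

lemma smooth_on_frechet:
  "smooth_on S f \<Longrightarrow> smooth_on S (\<lambda>x. frechet_derivative f (at x) v)"
  unfolding smooth_on_def
proof
  fix k assume "\<forall>k. Ck_on k S f"
  from this[rule_format, of "Suc k"] show "Ck_on k S (\<lambda>x. frechet_derivative f (at x) v)" by simp
qed

lemma smooth_on_has_derivative:
  "smooth_on S f \<Longrightarrow> x \<in> S \<Longrightarrow> (f has_derivative frechet_derivative f (at x)) (at x)"
  by (rule Ck_on_Suc_has_derivative[of 0]) (auto simp: smooth_on_def simp del: Ck_on.simps)

lemma smooth_on_frechet_apply:
  fixes f :: "'a::euclidean_space \<Rightarrow> 'b::real_normed_vector"
  assumes S: "open S" and "smooth_on S f" "smooth_on S u"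
  shows "smooth_on S (\<lambda>x. frechet_derivative f (at x) (u x))"
proof (rule smooth_on_cong[OF S])
  show "(\<Sum>i\<in>Basis. (u x \<bullet> i) *\<^sub>R frechet_derivative f (at x) i) = frechet_derivative f (at x) (u x)"
    if "x \<in> S" for x
    by (rule linear_expansion_Basis[symmetric, OF has_derivative_linear[OF smooth_on_has_derivative[OF assms(2) that]]])
  show "smooth_on S (\<lambda>x. \<Sum>i\<in>Basis. (u x \<bullet> i) *\<^sub>R frechet_derivative f (at x) i)"
    using assms
    by (intro smooth_on_sum smooth_on_bilinear[OF bounded_bilinear_scaleR]
        smooth_on_linear[OF bounded_linear_inner_left] smooth_on_frechet)
qed

text \<open>The mean value theorem, applied once in each direction to the second difference quotient.\<close>

lemma frechet_derivative_symmetric_aux: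
  fixes f :: "'a::euclidean_space \<Rightarrow> real"
  assumes S: "open S" "x \<in> S" and f: "smooth_on S f"
    and e: "ball x \<delta> \<subseteq> S" and t: "t > 0" "t * (norm u + norm w) < \<delta>"
  shows "\<exists>y \<in> ball x \<delta>. f (x + t *\<^sub>R u + t *\<^sub>R w) - f (x + t *\<^sub>R u) - f (x + t *\<^sub>R w) + f x =
     t * t * frechet_derivative (\<lambda>z. frechet_derivative f (at z) u) (at y) w"
proof -
  let ?g = "\<lambda>z. frechet_derivative f (at z) u"
  have b: "x + s *\<^sub>R u + r *\<^sub>R w \<in> ball x \<delta>" if "0 \<le> s" "s \<le> t" "0 \<le> r" "r \<le> t" for s r
  proof -
    have "norm (s *\<^sub>R u + r *\<^sub>R w) \<le> s * norm u + r * norm w"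
      using norm_triangle_ineq[of "s *\<^sub>R u" "r *\<^sub>R w"] that by simp
    also have "\<dots> \<le> t * norm u + t * norm w" using that by (intro add_mono mult_right_mono) auto
    also have "\<dots> < \<delta>" using t by (simp add: distrib_left)
    finally have n: "norm (s *\<^sub>R u + r *\<^sub>R w) < \<delta>" .
    have "dist x (x + v) = norm v" for v by (simp add: dist_norm)
    from this[of "s *\<^sub>R u + r *\<^sub>R w"]
    have "dist x (x + s *\<^sub>R u + r *\<^sub>R w) = norm (s *\<^sub>R u + r *\<^sub>R w)" by (simp add: add.assoc)
    with n show ?thesis by simp
  qed
  have 1: "((\<lambda>s. h (a + s *\<^sub>R v)) has_real_derivative frechet_derivative h (at (a + s *\<^sub>R v)) v) (at s)"
    if "smooth_on S h" "a + s *\<^sub>R v \<in> S" for h :: "'a \<Rightarrow> real" and a v s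
  proof -
    have h: "(h has_derivative frechet_derivative h (at (a + s *\<^sub>R v))) (at (a + s *\<^sub>R v))"
      by (rule smooth_on_has_derivative[OF that])
    have "((\<lambda>s. h (a + s *\<^sub>R v)) has_derivative (\<lambda>r. frechet_derivative h (at (a + s *\<^sub>R v)) (r *\<^sub>R v))) (at s)"
      by (rule has_derivative_compose[where g = h and f = "\<lambda>s. a + s *\<^sub>R v" and x = s, OF _ h]) (auto intro!: derivative_eq_intros)
    then show ?thesis
      unfolding has_field_derivative_def
      by (rule has_derivative_eq_rhs) (simp add: linear_scale[OF has_derivative_linear[OF h]] fun_eq_iff)
  qed
  define \<phi> where "\<phi> s = f (x + t *\<^sub>R w + s *\<^sub>R u) - f (x + s *\<^sub>R u)" for s
  have "DERIV \<phi> s :> ?g (x + t *\<^sub>R w + s *\<^sub>R u) - ?g (x + s *\<^sub>R u)" if "0 \<le> s" "s \<le> t" for s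
    unfolding \<phi>_def
    by (intro DERIV_diff 1 f) (use b[of s t] b[of s 0] that e t in \<open>auto simp: algebra_simps\<close>)
  from MVT2[OF t(1) this] obtain s where s: "0 < s" "s < t"
    and 2: "\<phi> t - \<phi> 0 = t * (?g (x + t *\<^sub>R w + s *\<^sub>R u) - ?g (x + s *\<^sub>R u))" by auto
  define \<psi> where "\<psi> r = ?g (x + s *\<^sub>R u + r *\<^sub>R w)" for r
  have "DERIV \<psi> r :> frechet_derivative ?g (at (x + s *\<^sub>R u + r *\<^sub>R w)) w" if "0 \<le> r" "r \<le> t" for r
    unfolding \<psi>_def
    by (intro 1 smooth_on_frechet f) (use b[of s r] that e s in auto)
  from MVT2[OF t(1) this] obtain r where r: "0 < r" "r < t"
    and 3: "\<psi> t - \<psi> 0 = t * frechet_derivative ?g (at (x + s *\<^sub>R u + r *\<^sub>R w)) w" by auto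
  have "f (x + t *\<^sub>R u + t *\<^sub>R w) - f (x + t *\<^sub>R u) - f (x + t *\<^sub>R w) + f x = \<phi> t - \<phi> 0"
    by (simp add: \<phi>_def algebra_simps)
  also have "\<dots> = t * (\<psi> t - \<psi> 0)" using 2 by (simp add: \<psi>_def algebra_simps)
  finally show ?thesis using 3 b[of s r] s r by (auto simp: mult.assoc)
qed

text \<open>Schwarz's theorem. The second difference is symmetric in \<open>u\<close> and
  \<open>w\<close>, so in every ball around \<open>x\<close> some value of one mixed derivative
  equals some value of the other; continuity carries the equality to \<open>x\<close>.\<close>

lemma frechet_derivative_symmetric:
  fixes f :: "'a::euclidean_space \<Rightarrow> real"
  assumes S: "open S" "x \<in> S" and f: "smooth_on S f"
  shows "frechet_derivative (\<lambda>z. frechet_derivative f (at z) u) (at x) w =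
    frechet_derivative (\<lambda>z. frechet_derivative f (at z) w) (at x) u"
proof -
  define A where "A u w y = frechet_derivative (\<lambda>z. frechet_derivative f (at z) u) (at y) w" for u w y
  have cont: "continuous_on S (A u w)" for u w
    using smooth_on_frechet[OF smooth_on_frechet[OF f, of u], of w]
    unfolding A_def smooth_on_def by (auto dest: spec[of _ 0])
  have "dist (A u w x) (A w u x) < \<epsilon>" if "\<epsilon> > 0" for \<epsilon>
  proof -
    have c: "isCont (A u w) x" "isCont (A w u) x"
      using cont[THEN continuous_on_eq_continuous_at[OF S(1), THEN iffD1]] S(2) by auto
    have e: "\<epsilon>/2 > 0" using that by simp
    obtain d1 where d1: "d1 > 0" "\<And>y. dist y x < d1 \<Longrightarrow> dist (A u w y) (A u w x) < \<epsilon>/2"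
      using c(1)[unfolded continuous_at_eps_delta, rule_format, OF e] by auto
    obtain d2 where d2: "d2 > 0" "\<And>y. dist y x < d2 \<Longrightarrow> dist (A w u y) (A w u x) < \<epsilon>/2"
      using c(2)[unfolded continuous_at_eps_delta, rule_format, OF e] by auto
    obtain d3 where d3: "d3 > 0" "ball x d3 \<subseteq> S" using S open_contains_ball by blast
    define \<delta> where "\<delta> = min d1 (min d2 d3)"
    have \<delta>: "\<delta> > 0" "ball x \<delta> \<subseteq> S" using d1(1) d2(1) d3 by (auto simp: \<delta>_def)
    \<comment> \<open>The summand 1 keeps the denominator positive when \<open>u\<close> and
      \<open>w\<close> both vanish; the factor 2 gives a strict inequality.\<close>
    define t where "t = \<delta> / (2 * (norm u + norm w + 1))"
    have pos: "norm u + norm w + 1 > 0" by (simp add: add_nonneg_pos)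
    have t: "t > 0" using \<delta>(1) pos by (simp add: t_def)
    have "t * (norm u + norm w) < t * (2 * (norm u + norm w + 1))"
      using t pos by (intro mult_strict_left_mono) auto
    also have "\<dots> = \<delta>" using pos by (simp add: t_def)
    finally have t: "t > 0" "t * (norm u + norm w) < \<delta>" using t by auto
    have t': "t * (norm w + norm u) < \<delta>" using t(2) by (simp add: add.commute)
    obtain y1 where y1: "y1 \<in> ball x \<delta>"
      "f (x + t *\<^sub>R u + t *\<^sub>R w) - f (x + t *\<^sub>R u) - f (x + t *\<^sub>R w) + f x = t * t * A u w y1"
      using frechet_derivative_symmetric_aux[OF S f \<delta>(2) t] unfolding A_def by blast
    obtain y2 where y2: "y2 \<in> ball x \<delta>"
      "f (x + t *\<^sub>R w + t *\<^sub>R u) - f (x + t *\<^sub>R w) - f (x + t *\<^sub>R u) + f x = t * t * A w u y2"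
      using frechet_derivative_symmetric_aux[OF S f \<delta>(2) t(1) t'] unfolding A_def by blast
    have "x + t *\<^sub>R w + t *\<^sub>R u = x + t *\<^sub>R u + t *\<^sub>R w" by simp
    then have "f (x + t *\<^sub>R w + t *\<^sub>R u) = f (x + t *\<^sub>R u + t *\<^sub>R w)" by (rule arg_cong)
    with y1(2) y2(2) have "t * t * A u w y1 = t * t * A w u y2" by linarith
    then have "A u w y1 = A w u y2" using t by simp
    moreover have "dist (A u w y1) (A u w x) < \<epsilon>/2" "dist (A w u y2) (A w u x) < \<epsilon>/2"
      using d1(2)[of y1] d2(2)[of y2] y1(1) y2(1) by (auto simp: \<delta>_def dist_commute)
    ultimately show ?thesis
      using dist_triangle_half_r[of "A u w y1" "A u w x" \<epsilon> "A w u x"] by (simp add: dist_commute)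
  qed
  then show ?thesis unfolding A_def by (metis less_irrefl zero_less_dist_iff)
qed

section \<open>Functions and vector fields on a manifold\<close>

text \<open>Product rule for a derivative taken along a moving direction. The first term will
  produce the Lie bracket; the second is a pure second derivative of \<open>F\<close> and cancels in
  commutators.\<close>

lemma frechet_derivative_frechet_apply:
  fixes F :: "'a::euclidean_space \<Rightarrow> real"
  assumes S: "open S" "x \<in> S" and F: "smooth_on S F" and u: "smooth_on S u"
  shows "frechet_derivative (\<lambda>z. frechet_derivative F (at z) (u z)) (at x) w =
    frechet_derivative F (at x) (frechet_derivative u (at x) w)
    + frechet_derivative (\<lambda>z. frechet_derivative F (at z) (u x)) (at x) w"
proof -
  let ?F = "\<lambda>z. frechet_derivative F (at z)"
  note lin = has_derivative_linear[OF smooth_on_has_derivative[OF F]]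
  have G: "((\<lambda>z. ?F z i) has_derivative frechet_derivative (\<lambda>z. ?F z i) (at x)) (at x)" for i
    by (rule smooth_on_has_derivative[OF smooth_on_frechet[OF F] S(2)])
  have 1: "((\<lambda>z. ?F z (u x)) has_derivative
      (\<lambda>w. \<Sum>i\<in>Basis. (u x \<bullet> i) * frechet_derivative (\<lambda>z. ?F z i) (at x) w)) (at x)"
  proof (rule has_derivative_transform_within_open[OF _ S])
    show "((\<lambda>z. \<Sum>i\<in>Basis. (u x \<bullet> i) * ?F z i) has_derivative
      (\<lambda>w. \<Sum>i\<in>Basis. (u x \<bullet> i) * frechet_derivative (\<lambda>z. ?F z i) (at x) w)) (at x)"
      by (intro has_derivative_sum has_derivative_mult_right G)
    show "(\<Sum>i\<in>Basis. (u x \<bullet> i) * ?F z i) = ?F z (u x)" if "z \<in> S" for z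
      using linear_expansion_Basis[OF lin[OF that], of "u x"] by (simp only: real_scaleR_def)
  qed
  have 2: "((\<lambda>z. ?F z (u z)) has_derivative
      (\<lambda>w. \<Sum>i\<in>Basis. (u x \<bullet> i) * frechet_derivative (\<lambda>z. ?F z i) (at x) w
        + (frechet_derivative u (at x) w \<bullet> i) * ?F x i)) (at x)"
  proof (rule has_derivative_transform_within_open[OF _ S])
    show "((\<lambda>z. \<Sum>i\<in>Basis. (u z \<bullet> i) * ?F z i) has_derivative
      (\<lambda>w. \<Sum>i\<in>Basis. (u x \<bullet> i) * frechet_derivative (\<lambda>z. ?F z i) (at x) w
        + (frechet_derivative u (at x) w \<bullet> i) * ?F x i)) (at x)"
      by (intro has_derivative_sum has_derivative_mult G
          bounded_linear.has_derivative[OF bounded_linear_inner_left] smooth_on_has_derivative[OF u S(2)])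
    show "(\<Sum>i\<in>Basis. (u z \<bullet> i) * ?F z i) = ?F z (u z)" if "z \<in> S" for z
      using linear_expansion_Basis[OF lin[OF that], of "u z"] by (simp only: real_scaleR_def)
  qed
  have 3: "?F x v = (\<Sum>i\<in>Basis. (v \<bullet> i) * ?F x i)" for v
    using linear_expansion_Basis[OF lin[OF S(2)], of v] by (simp only: real_scaleR_def)
  show ?thesis
    unfolding frechet_derivative_at[OF 1, symmetric] frechet_derivative_at[OF 2, symmetric]
      3[of "frechet_derivative u (at x) w"] sum.distrib by simp
qed

section \<open>Charts and changes of tangent components\<close>

locale smooth_manifold =
  fixes A :: "('p::topological_space, 'e::euclidean_space) chart set"
  assumes atlas: "smooth_atlas A"
begin

lemma chart_at: "chart_at A p \<in> A" "p \<in> cdom (chart_at A p)"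
proof -
  have "\<exists>c. c \<in> A \<and> p \<in> cdom c" using atlas unfolding smooth_atlas_def by blast
  then have "chart_at A p \<in> A \<and> p \<in> cdom (chart_at A p)"
    unfolding chart_at_def by (rule someI_ex)
  then show "chart_at A p \<in> A" "p \<in> cdom (chart_at A p)" by auto
qed

lemma chart_homeomorphism: "c \<in> A \<Longrightarrow> homeomorphism (cdom c) (coord c ` cdom c) (coord c) (param c)"
  using atlas unfolding smooth_atlas_def by blast

lemma open_cdom: "c \<in> A \<Longrightarrow> open (cdom c)"
  using atlas unfolding smooth_atlas_def by blast

lemma param_coord: "c \<in> A \<Longrightarrow> p \<in> cdom c \<Longrightarrow> param c (coord c p) = p"
  using chart_homeomorphism by (simp add: homeomorphism_def)

lemma open_coord_image:
  assumes c: "c \<in> A" and U: "open U" shows "open (coord c ` (U \<inter> cdom c))"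
proof -
  have o: "open (coord c ` cdom c)" using atlas c unfolding smooth_atlas_def by blast
  have "openin (top_of_set (coord c ` cdom c)) (coord c ` (U \<inter> cdom c))"
    by (rule homeomorphism_imp_open_map[OF chart_homeomorphism[OF c]])
      (use U in \<open>auto simp: openin_open\<close>)
  then show ?thesis using o openin_open_trans by blast
qed

lemma transition_smooth:
  "c \<in> A \<Longrightarrow> d \<in> A \<Longrightarrow> smooth_on (coord c ` (cdom c \<inter> cdom d)) (\<lambda>x. coord d (param c x))"
  using atlas unfolding smooth_atlas_def o_def by blast

lemma tan_change_has_derivative:
  assumes "c \<in> A" "d \<in> A" "p \<in> cdom c" "p \<in> cdom d"
  shows "((\<lambda>x. coord d (param c x)) has_derivative tan_change c d p) (at (coord c p))"
  unfolding tan_change_def[abs_def] o_def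
  by (rule smooth_on_has_derivative[OF transition_smooth]) (use assms in auto)

lemma linear_tan_change:
  "c \<in> A \<Longrightarrow> d \<in> A \<Longrightarrow> p \<in> cdom c \<Longrightarrow> p \<in> cdom d \<Longrightarrow> linear (tan_change c d p)"
  by (rule has_derivative_linear[OF tan_change_has_derivative])

text \<open>Compositions of \<open>coord\<close> and \<open>param\<close> cancel only on the overlap
  of the chart domains. This transfers a derivative across such a local identity.\<close>

lemma has_derivative_in_chart:
  assumes c: "c \<in> A" "p \<in> cdom c" and U: "open U" "p \<in> U"
    and f: "(f has_derivative f') (at (coord c p))"
    and eq: "\<And>q. q \<in> U \<Longrightarrow> q \<in> cdom c \<Longrightarrow> f (coord c q) = g (coord c q)"
  shows "(g has_derivative f') (at (coord c p))"
  by (rule has_derivative_transform_within_open[OF f open_coord_image[OF c(1) U(1)]])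
    (use c U eq in auto)

lemma tan_change_trans:
  assumes "c \<in> A" "d \<in> A" "e \<in> A" "p \<in> cdom c" "p \<in> cdom d" "p \<in> cdom e"
  shows "tan_change d e p (tan_change c d p v) = tan_change c e p v"
proof -
  have d: "((\<lambda>x. coord e (param d x)) has_derivative tan_change d e p) (at (coord d (param c (coord c p))))"
    using tan_change_has_derivative assms by (simp add: param_coord)
  have "((\<lambda>x. coord e (param d (coord d (param c x)))) has_derivative
      (\<lambda>v. tan_change d e p (tan_change c d p v))) (at (coord c p))"
    by (rule has_derivative_compose[where g = "\<lambda>x. coord e (param d x)",
          OF tan_change_has_derivative d]) (use assms in auto)
  then have "((\<lambda>x. coord e (param c x)) has_derivative
      (\<lambda>v. tan_change d e p (tan_change c d p v))) (at (coord c p))"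
    by (rule has_derivative_in_chart[OF assms(1,4) open_cdom[OF assms(2)] assms(5)])
      (use assms in \<open>simp add: param_coord\<close>)
  from fun_cong[OF frechet_derivative_at[OF this], of v] show ?thesis
    by (simp add: tan_change_def o_def)
qed

lemma tan_change_self:
  assumes "c \<in> A" "p \<in> cdom c" shows "tan_change c c p v = v"
proof -
  have "((\<lambda>x. coord c (param c x)) has_derivative (\<lambda>v. v)) (at (coord c p))"
    by (rule has_derivative_in_chart[OF assms open_UNIV UNIV_I has_derivative_ident])
      (use assms in \<open>simp add: param_coord\<close>)
  from fun_cong[OF frechet_derivative_at[OF this], of v] show ?thesis
    by (simp add: tan_change_def o_def)
qed

lemma components_chart_at: "components A (chart_at A p) p v = v"
  unfolding components_def by (rule tan_change_self[OF chart_at])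

lemma linear_components: "c \<in> A \<Longrightarrow> p \<in> cdom c \<Longrightarrow> linear (components A c p)"
  unfolding components_def[abs_def] using linear_tan_change chart_at by blast

lemma components_coord_field: "c \<in> A \<Longrightarrow> p \<in> cdom c \<Longrightarrow> components A c p (coord_field A c u p) = u"
  unfolding components_def coord_field_def
  using tan_change_trans[of c "chart_at A p" c p] tan_change_self chart_at by simp

lemma coord_field_components: "c \<in> A \<Longrightarrow> p \<in> cdom c \<Longrightarrow> coord_field A c (components A c p v) p = v"
  unfolding components_def coord_field_def
  using tan_change_trans[of "chart_at A p" c "chart_at A p" p] tan_change_self chart_at by simp

lemma coord_field_chart_at: "coord_field A (chart_at A p) u p = u"
  unfolding coord_field_def by (rule tan_change_self[OF chart_at])

lemma frame_expansion:
  assumes "c \<in> A" "p \<in> cdom c"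
  shows "v = (\<Sum>i\<in>Basis. (components A c p v \<bullet> i) *\<^sub>R coord_field A c i p)"
proof -
  have "linear (\<lambda>u. coord_field A c u p)"
    unfolding coord_field_def using linear_tan_change assms chart_at by blast
  from linear_expansion_Basis[OF this, of "components A c p v"]
  show ?thesis using assms by (simp add: coord_field_components)
qed

section \<open>Smooth functions on a manifold\<close>

lemma smooth_funD:
  "smooth_fun A U f \<Longrightarrow> c \<in> A \<Longrightarrow> smooth_on (coord c ` (U \<inter> cdom c)) (\<lambda>x. f (param c x))"
  unfolding smooth_fun_def o_def by blast

lemma smooth_funI:
  "(\<And>c. c \<in> A \<Longrightarrow> smooth_on (coord c ` (U \<inter> cdom c)) (\<lambda>x. f (param c x))) \<Longrightarrow> smooth_fun A U f"
  unfolding smooth_fun_def o_def by blast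

lemma smooth_fun_local:
  assumes "\<And>p. p \<in> U \<Longrightarrow> \<exists>V. open V \<and> p \<in> V \<and> smooth_fun A V f"
  shows "smooth_fun A U f"
proof (rule smooth_funI, rule smooth_on_local)
  fix c x assume c: "c \<in> A" and "x \<in> coord c ` (U \<inter> cdom c)"
  then obtain p where p: "p \<in> U" "p \<in> cdom c" "x = coord c p" by auto
  from assms[OF p(1)] obtain V where "open V" "p \<in> V" "smooth_fun A V f" by blast
  then show "\<exists>N. open N \<and> x \<in> N \<and> smooth_on N (\<lambda>x. f (param c x))"
    using c p open_coord_image smooth_funD by (intro exI[of _ "coord c ` (V \<inter> cdom c)"]) auto
qed

lemma smooth_fun_cong:
  assumes "open U" "\<And>p. p \<in> U \<Longrightarrow> f p = g p" "smooth_fun A U f"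
  shows "smooth_fun A U g"
proof (rule smooth_funI)
  fix c assume c: "c \<in> A"
  show "smooth_on (coord c ` (U \<inter> cdom c)) (\<lambda>x. g (param c x))"
    by (rule smooth_on_cong[OF open_coord_image[OF c assms(1)] _ smooth_funD[OF assms(3) c]])
      (use assms(2) c in \<open>auto simp: param_coord\<close>)
qed

lemma smooth_fun_subset: "smooth_fun A U f \<Longrightarrow> V \<subseteq> U \<Longrightarrow> smooth_fun A V f"
  by (rule smooth_funI, rule smooth_on_subset, erule smooth_funD) auto

lemma smooth_fun_const: "smooth_fun A U (\<lambda>p. a)"
  by (rule smooth_funI, rule smooth_on_const)

lemma smooth_fun_add:
  "open U \<Longrightarrow> smooth_fun A U f \<Longrightarrow> smooth_fun A U g \<Longrightarrow> smooth_fun A U (\<lambda>p. f p + g p)"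
  by (rule smooth_funI, rule smooth_on_add) (auto simp: open_coord_image smooth_funD)

lemma smooth_fun_mult:
  "open U \<Longrightarrow> smooth_fun A U f \<Longrightarrow> smooth_fun A U g \<Longrightarrow> smooth_fun A U (\<lambda>p. f p * g p)"
  by (rule smooth_funI, rule smooth_on_bilinear[OF bounded_bilinear_mult])
    (auto simp: open_coord_image smooth_funD)

text \<open>\<open>smooth_fun\<close> quantifies over all charts; composing with a smooth transition
  map spreads smoothness from one chart containing \<open>V\<close> to the others.\<close>

lemma smooth_fun_in_chart:
  assumes c: "c \<in> A" and V: "open V" "V \<subseteq> cdom c" and f: "smooth_on (coord c ` V) (\<lambda>x. f (param c x))"
  shows "smooth_fun A V f"
proof (rule smooth_funI)
  fix d assume d: "d \<in> A"
  have "smooth_on (coord d ` (V \<inter> cdom d)) (\<lambda>x. f (param c (coord c (param d x))))"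
  proof (rule smooth_on_compose[OF open_coord_image[OF d V(1)] _ f])
    show "smooth_on (coord d ` (V \<inter> cdom d)) (\<lambda>x. coord c (param d x))"
      by (rule smooth_on_subset[OF transition_smooth[OF d c]]) (use V in auto)
  qed (use d in \<open>auto simp: param_coord\<close>)
  then show "smooth_on (coord d ` (V \<inter> cdom d)) (\<lambda>x. f (param d x))"
    by (rule smooth_on_cong[OF open_coord_image[OF d V(1)], rotated])
      (use V c d in \<open>auto simp: param_coord subset_iff\<close>)
qed

section \<open>Directional derivatives\<close>

lemma smooth_fun_has_derivative:
  assumes "smooth_fun A U f" "p \<in> U" "c \<in> A" "p \<in> cdom c"
  shows "((\<lambda>x. f (param c x)) has_derivative
    frechet_derivative (\<lambda>x. f (param c x)) (at (coord c p))) (at (coord c p))"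
  by (rule smooth_on_has_derivative[OF smooth_funD[OF assms(1,3)]]) (use assms in auto)

lemma dir_deriv_has_derivative:
  assumes "smooth_fun A U f" "p \<in> U"
  shows "((\<lambda>x. f (param (chart_at A p) x)) has_derivative
    (\<lambda>v. dir_deriv A p v f)) (at (coord (chart_at A p) p))"
  using smooth_fun_has_derivative[OF assms chart_at] unfolding dir_deriv_def o_def .

lemma dir_deriv_eqI:
  assumes "((\<lambda>x. f (param (chart_at A p) x)) has_derivative f') (at (coord (chart_at A p) p))"
  shows "dir_deriv A p v f = f' v"
  using fun_cong[OF frechet_derivative_at[OF assms], of v] by (simp add: dir_deriv_def o_def)

text \<open>\<open>dir_deriv\<close> is computed in a chart that jumps with the point. Only after
  rewriting it in one fixed chart can its dependence on the point be differentiated.\<close>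

lemma dir_deriv_in_chart:
  assumes U: "open U" "p \<in> U" and f: "smooth_fun A U f" and c: "c \<in> A" "p \<in> cdom c"
  shows "dir_deriv A p v f = frechet_derivative (\<lambda>x. f (param c x)) (at (coord c p)) (components A c p v)"
proof (rule dir_deriv_eqI)
  let ?c = "chart_at A p"
  have d: "((\<lambda>x. f (param c x)) has_derivative
      frechet_derivative (\<lambda>x. f (param c x)) (at (coord c p))) (at (coord c (param ?c (coord ?c p))))"
    using smooth_fun_has_derivative[OF f U(2) c] by (simp add: param_coord chart_at)
  have "((\<lambda>x. f (param c (coord c (param ?c x)))) has_derivative
      (\<lambda>v. frechet_derivative (\<lambda>x. f (param c x)) (at (coord c p)) (components A c p v)))
      (at (coord ?c p))"
    unfolding components_def
    by (rule has_derivative_compose[where g = "\<lambda>x. f (param c x)",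
          OF tan_change_has_derivative d]) (use c chart_at in auto)
  then show "((\<lambda>x. f (param ?c x)) has_derivative
      (\<lambda>v. frechet_derivative (\<lambda>x. f (param c x)) (at (coord c p)) (components A c p v)))
      (at (coord ?c p))"
    by (rule has_derivative_in_chart[OF chart_at open_cdom[OF c(1)] c(2)])
      (use c in \<open>simp add: param_coord chart_at\<close>)
qed

lemma linear_dir_deriv:
  assumes "smooth_fun A U f" "p \<in> U" shows "linear (\<lambda>v. dir_deriv A p v f)"
  by (rule has_derivative_linear[OF dir_deriv_has_derivative[OF assms]])

lemma dir_deriv_cong:
  assumes "open U" "p \<in> U" "\<And>q. q \<in> U \<Longrightarrow> f q = g q" "smooth_fun A U f"
  shows "dir_deriv A p v f = dir_deriv A p v g"
proof (rule dir_deriv_eqI[symmetric])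
  show "((\<lambda>x. g (param (chart_at A p) x)) has_derivative
    (\<lambda>v. dir_deriv A p v f)) (at (coord (chart_at A p) p))"
    by (rule has_derivative_in_chart[OF chart_at assms(1,2) dir_deriv_has_derivative[OF assms(4,2)]])
      (use assms(3) in \<open>simp add: param_coord chart_at\<close>)
qed

lemma dir_deriv_const: "dir_deriv A p v (\<lambda>q. a) = 0"
  by (rule dir_deriv_eqI[where f' = "\<lambda>v. 0"]) simp

lemma dir_deriv_add:
  assumes "p \<in> U" "smooth_fun A U f" "smooth_fun A U g"
  shows "dir_deriv A p v (\<lambda>q. f q + g q) = dir_deriv A p v f + dir_deriv A p v g"
  by (rule dir_deriv_eqI, rule has_derivative_add) (rule dir_deriv_has_derivative assms)+

lemma dir_deriv_mult:
  assumes "p \<in> U" "smooth_fun A U f" "smooth_fun A U g"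
  shows "dir_deriv A p v (\<lambda>q. f q * g q) = f p * dir_deriv A p v g + dir_deriv A p v f * g p"
proof -
  have "((\<lambda>x. f (param (chart_at A p) x) * g (param (chart_at A p) x)) has_derivative
    (\<lambda>v. f (param (chart_at A p) (coord (chart_at A p) p)) * dir_deriv A p v g
       + dir_deriv A p v f * g (param (chart_at A p) (coord (chart_at A p) p))))
    (at (coord (chart_at A p) p))"
    by (rule has_derivative_mult) (rule dir_deriv_has_derivative assms)+
  from dir_deriv_eqI[OF this] show ?thesis by (simp add: param_coord chart_at)
qed

lemma smooth_fun_coord:
  assumes "c \<in> A" shows "smooth_fun A (cdom c) (\<lambda>p. coord c p \<bullet> i)"
proof (rule smooth_funI)
  fix d assume d: "d \<in> A"
  have "open (coord d ` (cdom c \<inter> cdom d))" using open_coord_image[OF d open_cdom[OF assms]] .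
  moreover have "smooth_on (coord d ` (cdom c \<inter> cdom d)) (\<lambda>x. coord c (param d x))"
    by (rule smooth_on_subset[OF transition_smooth[OF d assms]]) auto
  ultimately show "smooth_on (coord d ` (cdom c \<inter> cdom d)) (\<lambda>x. coord c (param d x) \<bullet> i)"
    by (rule smooth_on_linear[OF bounded_linear_inner_left])
qed

text \<open>A tangent vector is determined by its action on the coordinate functions. This reduces
  statements about the differential of a map to scalar directional derivatives.\<close>

lemma components_eq_dir_deriv:
  assumes "c \<in> A" "p \<in> cdom c"
  shows "components A c p v \<bullet> i = dir_deriv A p v (\<lambda>q. coord c q \<bullet> i)"
  unfolding components_def
  by (rule dir_deriv_eqI[symmetric],
      rule bounded_linear.has_derivative[OF bounded_linear_inner_left tan_change_has_derivative])
    (use assms chart_at in auto)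

section \<open>Smooth vector fields\<close>

lemma smooth_fieldD:
  "smooth_field A U X \<Longrightarrow> c \<in> A \<Longrightarrow>
    smooth_on (coord c ` (U \<inter> cdom c)) (\<lambda>x. components A c (param c x) (X (param c x)))"
  unfolding smooth_field_def by blast

lemma smooth_field_components:
  assumes "open U" "smooth_field A U X" "c \<in> A"
  shows "smooth_fun A (U \<inter> cdom c) (\<lambda>p. components A c p (X p) \<bullet> i)"
  by (rule smooth_fun_in_chart[OF assms(3)])
    (use assms open_cdom smooth_fieldD open_coord_image in
      \<open>auto intro!: smooth_on_linear[OF bounded_linear_inner_left]\<close>)

lemma smooth_fieldI:
  assumes U: "open U"
    and X: "\<And>c i. c \<in> A \<Longrightarrow> i \<in> Basis \<Longrightarrow> smooth_fun A (U \<inter> cdom c) (\<lambda>p. components A c p (X p) \<bullet> i)"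
  shows "smooth_field A U X"
  unfolding smooth_field_def
proof
  fix c assume c: "c \<in> A"
  let ?X = "\<lambda>x. components A c (param c x) (X (param c x))"
  have "smooth_on (coord c ` (U \<inter> cdom c)) (\<lambda>x. \<Sum>i\<in>Basis. (?X x \<bullet> i) *\<^sub>R i)"
    using smooth_funD[OF X[OF c] c] open_coord_image[OF c U]
    by (intro smooth_on_sum smooth_on_linear[OF bounded_linear_scaleR_left]) simp_all
  then show "smooth_on (coord c ` (U \<inter> cdom c)) ?X"
    by (simp only: euclidean_representation)
qed

lemma smooth_dir_deriv:
  assumes U: "open U" and X: "smooth_field A U X" and f: "smooth_fun A U f"
  shows "smooth_fun A U (\<lambda>p. dir_deriv A p (X p) f)"
proof (rule smooth_funI)
  fix c assume c: "c \<in> A"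
  show "smooth_on (coord c ` (U \<inter> cdom c)) (\<lambda>x. dir_deriv A (param c x) (X (param c x)) f)"
  proof (rule smooth_on_cong[OF open_coord_image[OF c U]])
    show "smooth_on (coord c ` (U \<inter> cdom c)) (\<lambda>x. frechet_derivative (\<lambda>x. f (param c x)) (at x)
        (components A c (param c x) (X (param c x))))"
      by (rule smooth_on_frechet_apply[OF open_coord_image[OF c U] smooth_funD[OF f c] smooth_fieldD[OF X c]])
  qed (use dir_deriv_in_chart[OF U _ f c] c in \<open>auto simp: param_coord\<close>)
qed

lemma smooth_field_cong:
  assumes "open U" "\<And>p. p \<in> U \<Longrightarrow> X p = Y p" "smooth_field A U X"
  shows "smooth_field A U Y"
proof (rule smooth_fieldI[OF assms(1)])
  fix c i assume c: "c \<in> A"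
  show "smooth_fun A (U \<inter> cdom c) (\<lambda>p. components A c p (Y p) \<bullet> i)"
    by (rule smooth_fun_cong[OF open_Int[OF assms(1) open_cdom[OF c]] _
          smooth_field_components[OF assms(1,3) c]]) (use assms(2) in auto)
qed

lemma smooth_field_subset: "smooth_field A U X \<Longrightarrow> V \<subseteq> U \<Longrightarrow> smooth_field A V X"
  unfolding smooth_field_def by (auto elim!: ballE smooth_on_subset)

text \<open>In another chart the components are a directional derivative of the transition map,
  evaluated at the \<open>d\<close>-coordinates of the point.\<close>

lemma smooth_coord_field:
  assumes d: "d \<in> A" shows "smooth_field A (cdom d) (coord_field A d u)"
  unfolding smooth_field_def
proof
  fix c assume c: "c \<in> A"
  have o: "open (coord c ` (cdom d \<inter> cdom c))" by (rule open_coord_image[OF c open_cdom[OF d]])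
  have "smooth_on (coord c ` (cdom d \<inter> cdom c))
      (\<lambda>x. frechet_derivative (\<lambda>y. coord c (param d y)) (at (coord d (param c x))) u)"
  proof (rule smooth_on_compose[OF o, where g = "\<lambda>x. coord d (param c x)"
        and f = "\<lambda>z. frechet_derivative (\<lambda>y. coord c (param d y)) (at z) u"])
    show "smooth_on (coord c ` (cdom d \<inter> cdom c)) (\<lambda>x. coord d (param c x))"
      by (rule smooth_on_subset[OF transition_smooth[OF c d]]) auto
    show "smooth_on (coord d ` (cdom d \<inter> cdom c)) (\<lambda>z. frechet_derivative (\<lambda>y. coord c (param d y)) (at z) u)"
      by (rule smooth_on_frechet[OF transition_smooth[OF d c]])
  qed (use c in \<open>auto simp: param_coord\<close>)
  then show "smooth_on (coord c ` (cdom d \<inter> cdom c))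
      (\<lambda>x. components A c (param c x) (coord_field A d u (param c x)))"
  proof (rule smooth_on_cong[OF o, rotated])
    fix x assume "x \<in> coord c ` (cdom d \<inter> cdom c)"
    then obtain p where p: "p \<in> cdom d" "p \<in> cdom c" "x = coord c p" by auto
    have "components A c p (coord_field A d u p) = tan_change d c p u"
      unfolding components_def coord_field_def by (rule tan_change_trans) (use c d p chart_at in auto)
    then show "frechet_derivative (\<lambda>y. coord c (param d y)) (at (coord d (param c x))) u =
        components A c (param c x) (coord_field A d u (param c x))"
      using p c by (simp add: param_coord tan_change_def o_def)
  qed
qed

lemma smooth_field_add:
  assumes "open U" "smooth_field A U X" "smooth_field A U Y"
  shows "smooth_field A U (\<lambda>p. X p + Y p)"
proof (rule smooth_fieldI[OF assms(1)])
  fix c i assume c: "c \<in> A"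
  show "smooth_fun A (U \<inter> cdom c) (\<lambda>p. components A c p (X p + Y p) \<bullet> i)"
    by (rule smooth_fun_cong[OF _ _ smooth_fun_add[OF _ smooth_field_components[OF assms(1,2) c]
            smooth_field_components[OF assms(1,3) c]]])
      (use assms(1) open_cdom c linear_components in \<open>auto simp: linear_add inner_add_left\<close>)
qed

lemma smooth_field_scaleR:
  assumes "open U" "smooth_fun A U f" "smooth_field A U X"
  shows "smooth_field A U (\<lambda>p. f p *\<^sub>R X p)"
proof (rule smooth_fieldI[OF assms(1)])
  fix c i assume c: "c \<in> A"
  show "smooth_fun A (U \<inter> cdom c) (\<lambda>p. components A c p (f p *\<^sub>R X p) \<bullet> i)"
    by (rule smooth_fun_cong[OF _ _ smooth_fun_mult[OF _ smooth_fun_subset[OF assms(2)]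
            smooth_field_components[OF assms(1,3) c]]])
      (use assms(1) open_cdom c linear_components in \<open>auto simp: linear_scale\<close>)
qed

lemma smooth_field_zero: "smooth_field A U (\<lambda>p. 0)"
  unfolding smooth_field_def
proof
  fix c assume c: "c \<in> A"
  show "smooth_on (coord c ` (U \<inter> cdom c)) (\<lambda>x. components A c (param c x) 0)"
  proof (rule smooth_on_subset)
    show "smooth_on (coord c ` (UNIV \<inter> cdom c)) (\<lambda>x. components A c (param c x) 0)"
      by (rule smooth_on_cong[OF open_coord_image[OF c open_UNIV] _ smooth_on_const[of _ 0]])
        (use c linear_components in \<open>auto simp: param_coord linear_0\<close>)
  qed auto
qed

lemma smooth_field_sum:
  "open U \<Longrightarrow> (\<And>i. i \<in> I \<Longrightarrow> smooth_field A U (X i)) \<Longrightarrow> smooth_field A U (\<lambda>p. \<Sum>i\<in>I. X i p)"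
  by (induction I rule: infinite_finite_induct) (auto intro: smooth_field_add smooth_field_zero)

text \<open>Each iterated derivative is a first-order term containing the derivative of the inner
  field plus a second derivative of \<open>f\<close>; the second derivatives cancel by symmetry.
  Later arguments mostly use the bracket in this chart-free form.\<close>

lemma dir_deriv_lie_bracket:
  assumes U: "open U" "p \<in> U" and X: "smooth_field A U X" and Y: "smooth_field A U Y"
    and f: "smooth_fun A U f"
  shows "dir_deriv A p (lie_bracket A X Y p) f =
    dir_deriv A p (X p) (\<lambda>q. dir_deriv A q (Y q) f) - dir_deriv A p (Y p) (\<lambda>q. dir_deriv A q (X q) f)"
proof -
  define c where "c = chart_at A p"
  have c: "c \<in> A" "p \<in> cdom c" unfolding c_def by (rule chart_at)+
  let ?S = "coord c ` (U \<inter> cdom c)"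
  define F where "F x = f (param c x)" for x
  define comp where "comp Z x = components A c (param c x) (Z (param c x))" for Z x
  have S: "open ?S" "coord c p \<in> ?S" using open_coord_image[OF c(1) U(1)] U c by auto
  have F: "smooth_on ?S F" unfolding F_def by (rule smooth_funD[OF f c(1)])
  have sm: "smooth_on ?S (comp X)" "smooth_on ?S (comp Y)"
    unfolding comp_def using smooth_fieldD X Y c by auto
  have at: "comp Z (coord c p) = Z p" for Z
    unfolding comp_def using c components_chart_at by (simp add: param_coord c_def)
  have 1: "dir_deriv A p v (\<lambda>q. dir_deriv A q (Z q) f) =
      frechet_derivative F (at (coord c p)) (frechet_derivative (comp Z) (at (coord c p)) v)
      + frechet_derivative (\<lambda>z. frechet_derivative F (at z) (Z p)) (at (coord c p)) v"
    if Z: "smooth_field A U Z" for Z v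
  proof -
    have Zc: "smooth_on ?S (comp Z)" unfolding comp_def using smooth_fieldD Z c by auto
    have "dir_deriv A p v (\<lambda>q. dir_deriv A q (Z q) f) =
       frechet_derivative (\<lambda>z. frechet_derivative F (at z) (comp Z z)) (at (coord c p)) v"
    proof (rule dir_deriv_eqI, rule has_derivative_in_chart[OF chart_at U])
      show "((\<lambda>z. frechet_derivative F (at z) (comp Z z)) has_derivative
          frechet_derivative (\<lambda>z. frechet_derivative F (at z) (comp Z z)) (at (coord c p)))
          (at (coord (chart_at A p) p))"
        unfolding c_def[symmetric]
        by (rule smooth_on_has_derivative[OF smooth_on_frechet_apply[OF S(1) F Zc] S(2)])
    next
      fix q assume "q \<in> U" "q \<in> cdom (chart_at A p)"
      then show "frechet_derivative F (at (coord (chart_at A p) q)) (comp Z (coord (chart_at A p) q)) =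
         dir_deriv A (param (chart_at A p) (coord (chart_at A p) q))
           (Z (param (chart_at A p) (coord (chart_at A p) q))) f"
        using dir_deriv_in_chart[OF U(1) _ f c(1)] c
        by (simp add: c_def[symmetric] param_coord comp_def F_def[abs_def])
    qed
    then show ?thesis
      using frechet_derivative_frechet_apply[OF S F Zc] at by simp
  qed
  have "dir_deriv A p (lie_bracket A X Y p) f = frechet_derivative F (at (coord c p))
      (frechet_derivative (comp Y) (at (coord c p)) (X p) - frechet_derivative (comp X) (at (coord c p)) (Y p))"
    unfolding lie_bracket_def dir_deriv_def Let_def c_def[symmetric] o_def F_def[symmetric] comp_def[abs_def] ..
  also have "\<dots> = dir_deriv A p (X p) (\<lambda>q. dir_deriv A q (Y q) f) - dir_deriv A p (Y p) (\<lambda>q. dir_deriv A q (X q) f)"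
    unfolding 1[OF X] 1[OF Y]
    using frechet_derivative_symmetric[OF S F, of "X p" "Y p"]
      linear_diff[OF has_derivative_linear[OF smooth_on_has_derivative[OF F S(2)]]] by simp
  finally show ?thesis .
qed

lemma lie_bracket_coord_fields:
  "lie_bracket A (coord_field A (chart_at A p) u) (coord_field A (chart_at A p) v) p = 0"
proof -
  let ?c = "chart_at A p"
  have "((\<lambda>x. components A ?c (param ?c x) (coord_field A ?c w (param ?c x))) has_derivative (\<lambda>v. 0))
      (at (coord ?c p))" for w
    by (rule has_derivative_in_chart[OF chart_at open_UNIV UNIV_I has_derivative_const[of w]])
      (simp add: param_coord chart_at components_coord_field)
  note frechet_derivative_at[OF this, symmetric]
  then show ?thesis unfolding lie_bracket_def Let_def by simp
qed

end

section \<open>Pullback of a connection along a map\<close>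

locale affine_manifold = smooth_manifold A
  for A :: "('p::topological_space, 'e::euclidean_space) chart set" +
  fixes nab :: "'p \<Rightarrow> 'e \<Rightarrow> ('p \<Rightarrow> 'e) \<Rightarrow> 'e"
  assumes affine: "affine_connection A nab"
begin

lemma linear_nab: "open U \<Longrightarrow> smooth_field A U Y \<Longrightarrow> p \<in> U \<Longrightarrow> linear (\<lambda>v. nab p v Y)"
  using affine[unfolded affine_connection_def, THEN conjunct1] by blast

lemma nab_add:
  "open U \<Longrightarrow> smooth_field A U Y \<Longrightarrow> smooth_field A U Z \<Longrightarrow> p \<in> U \<Longrightarrow>
    nab p v (\<lambda>q. Y q + Z q) = nab p v Y + nab p v Z"
  using affine[unfolded affine_connection_def, THEN conjunct2, THEN conjunct1, rule_format, of U Y Z] by simp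

lemma nab_scaleR:
  "open U \<Longrightarrow> smooth_fun A U f \<Longrightarrow> smooth_field A U Y \<Longrightarrow> p \<in> U \<Longrightarrow>
    nab p v (\<lambda>q. f q *\<^sub>R Y q) = dir_deriv A p v f *\<^sub>R Y p + f p *\<^sub>R nab p v Y"
  using affine[unfolded affine_connection_def, THEN conjunct2, THEN conjunct2, THEN conjunct1,
      rule_format, of U f Y] by simp

lemma smooth_cov:
  "open U \<Longrightarrow> smooth_field A U X \<Longrightarrow> smooth_field A U Y \<Longrightarrow> smooth_field A U (cov nab X Y)"
  using affine[unfolded affine_connection_def, THEN conjunct2, THEN conjunct2, THEN conjunct2,
      rule_format, of U X Y] by simp

lemma nab_cong:
  assumes U: "open U" "p \<in> U" and Y: "smooth_field A U Y" and eq: "\<And>q. q \<in> U \<Longrightarrow> Y q = Z q"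
  shows "nab p v Y = nab p v Z"
proof -
  define f :: "'p \<Rightarrow> real" where "f = indicator U"
  have f1: "1 = f q" if "q \<in> U" for q using that by (simp add: f_def)
  have f: "smooth_fun A U f" by (rule smooth_fun_cong[OF U(1) _ smooth_fun_const[of U 1]]) (rule f1)
  have df: "dir_deriv A p v f = 0"
    using dir_deriv_cong[where f = "\<lambda>q. 1" and g = f, OF U f1 smooth_fun_const] by (simp add: dir_deriv_const)
  have Z: "smooth_field A U Z" by (rule smooth_field_cong[OF U(1) eq Y])
  \<comment> \<open>These products agree on the whole manifold, so \<open>nab\<close> has the same
    value on both. Since \<open>f\<close> is constantly 1 near \<open>p\<close>, the Leibniz rule
    then strips the factor.\<close>
  have "(\<lambda>q. f q *\<^sub>R Y q) = (\<lambda>q. f q *\<^sub>R Z q)"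
    by (rule ext) (use eq in \<open>auto simp: f_def indicator_def\<close>)
  then show ?thesis
    using nab_scaleR[OF U(1) f Y U(2), of v] nab_scaleR[OF U(1) f Z U(2), of v] df
    by (simp add: f1[OF U(2), symmetric])
qed

text \<open>The induction starts from a single summand, so the derivative of the zero field does not
  enter; the sums in question run over the nonempty set \<open>Basis\<close>.\<close>

lemma nab_sum:
  assumes U: "open U" "p \<in> U" and I: "finite I" "I \<noteq> {}" and Y: "\<And>i. i \<in> I \<Longrightarrow> smooth_field A U (Y i)"
  shows "nab p v (\<lambda>q. \<Sum>i\<in>I. Y i q) = (\<Sum>i\<in>I. nab p v (Y i))"
  using I Y
proof (induction I rule: finite_ne_induct)
  case (insert i I)
  then show ?case using nab_add[OF U(1) _ smooth_field_sum[OF U(1)] U(2), of "Y i" I Y v] by simp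
qed simp

lemma nab_expansion:
  assumes "d \<in> A" "p \<in> cdom d" "open U" "p \<in> U" "smooth_field A U Y"
  shows "nab p v Y = (\<Sum>j\<in>Basis. (components A d p v \<bullet> j) *\<^sub>R cov nab (coord_field A d j) Y p)"
proof -
  have l: "linear (\<lambda>v. nab p v Y)" by (rule linear_nab) fact+
  have "nab p v Y = nab p (\<Sum>j\<in>Basis. (components A d p v \<bullet> j) *\<^sub>R coord_field A d j p) Y"
    using frame_expansion[OF assms(1,2), of v] by simp
  also have "\<dots> = (\<Sum>j\<in>Basis. (components A d p v \<bullet> j) *\<^sub>R cov nab (coord_field A d j) Y p)"
    unfolding cov_def linear_sum[OF l] linear_scale[OF l] ..
  finally show ?thesis .
qed

end

section \<open>Smooth maps and their differentials\<close>

locale affine_map = M: affine_manifold A nab + F: smooth_manifold B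
  for A :: "('p::topological_space, 'e::euclidean_space) chart set"
    and nab :: "'p \<Rightarrow> 'e \<Rightarrow> ('p \<Rightarrow> 'e) \<Rightarrow> 'e"
    and B :: "('q::topological_space, 'f::euclidean_space) chart set" +
  fixes \<iota> :: "'q \<Rightarrow> 'p"
  assumes smooth_map: "smooth_map B A \<iota>"
begin

abbreviation T where "T \<equiv> differential B A \<iota>"
abbreviation D where "D \<equiv> cov_along B A nab \<iota>"

lemma open_preimage: "open V \<Longrightarrow> open (\<iota> -` V)"
  using smooth_map by (simp add: smooth_map_def continuous_on_open_vimage)

lemma smooth_in_charts:
  assumes "c \<in> B" "d \<in> A"
  shows "smooth_on (coord c ` (cdom c \<inter> \<iota> -` cdom d)) (\<lambda>x. coord d (\<iota> (param c x)))"
  using smooth_map assms unfolding smooth_map_def o_def by blast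

lemma smooth_fun_pullback:
  assumes V: "open V" and f: "smooth_fun A V f"
  shows "smooth_fun B (\<iota> -` V) (\<lambda>q. f (\<iota> q))"
proof (rule F.smooth_fun_local)
  fix p assume p: "p \<in> \<iota> -` V"
  define c where "c = chart_at B p"
  define d where "d = chart_at A (\<iota> p)"
  have c: "c \<in> B" "p \<in> cdom c" and d: "d \<in> A" "\<iota> p \<in> cdom d"
    unfolding c_def d_def by (rule F.chart_at M.chart_at)+
  define N where "N = \<iota> -` V \<inter> \<iota> -` cdom d \<inter> cdom c"
  have N: "open N" "p \<in> N" "N \<subseteq> cdom c"
    using c d p open_preimage[OF V] open_preimage[OF M.open_cdom[OF d(1)]] F.open_cdom[OF c(1)]
    by (auto simp: N_def)
  have o: "open (coord c ` N)" using F.open_coord_image[OF c(1) N(1)] N(3) by (simp add: Int_absorb2)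
  have "smooth_on (coord c ` N) (\<lambda>x. f (param d (coord d (\<iota> (param c x)))))"
  proof (rule smooth_on_compose[OF o, where g = "\<lambda>x. coord d (\<iota> (param c x))" and f = "\<lambda>y. f (param d y)"])
    show "smooth_on (coord c ` N) (\<lambda>x. coord d (\<iota> (param c x)))"
      by (rule smooth_on_subset[OF smooth_in_charts[OF c(1) d(1)]]) (auto simp: N_def)
    show "smooth_on (coord d ` (V \<inter> cdom d)) (\<lambda>y. f (param d y))" by (rule M.smooth_funD[OF f d(1)])
  qed (use c in \<open>auto simp: N_def F.param_coord\<close>)
  then have "smooth_on (coord c ` N) (\<lambda>x. f (\<iota> (param c x)))"
    by (rule smooth_on_cong[OF o, rotated])
      (use c d in \<open>auto simp: N_def F.param_coord M.param_coord\<close>)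
  then have "smooth_fun B N (\<lambda>q. f (\<iota> q))"
    by (rule F.smooth_fun_in_chart[OF c(1) N(1,3)])
  with N show "\<exists>N. open N \<and> p \<in> N \<and> smooth_fun B N (\<lambda>q. f (\<iota> q))" by blast
qed

lemma differential_has_derivative:
  "((\<lambda>x. coord (chart_at A (\<iota> p)) (\<iota> (param (chart_at B p) x))) has_derivative T p)
    (at (coord (chart_at B p) p))"
  unfolding differential_def[abs_def] o_def
  by (rule smooth_on_has_derivative[OF smooth_in_charts]) (use F.chart_at M.chart_at in auto)

lemma linear_differential: "linear (T p)"
  by (rule has_derivative_linear[OF differential_has_derivative])

lemma dir_deriv_pullback:
  assumes V: "open V" "\<iota> p \<in> V" and f: "smooth_fun A V f"
  shows "dir_deriv B p v (\<lambda>q. f (\<iota> q)) = dir_deriv A (\<iota> p) (T p v) f"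
proof (rule F.dir_deriv_eqI)
  let ?c = "chart_at B p" and ?d = "chart_at A (\<iota> p)"
  have d: "((\<lambda>y. f (param ?d y)) has_derivative (\<lambda>v. dir_deriv A (\<iota> p) v f))
      (at (coord ?d (\<iota> (param ?c (coord ?c p)))))"
    using M.dir_deriv_has_derivative[OF f V(2)] by (simp add: F.param_coord F.chart_at)
  have "((\<lambda>x. f (param ?d (coord ?d (\<iota> (param ?c x))))) has_derivative
      (\<lambda>v. dir_deriv A (\<iota> p) (T p v) f)) (at (coord ?c p))"
    by (rule has_derivative_compose[where g = "\<lambda>y. f (param ?d y)", OF differential_has_derivative d])
  then show "((\<lambda>x. f (\<iota> (param ?c x))) has_derivative (\<lambda>v. dir_deriv A (\<iota> p) (T p v) f)) (at (coord ?c p))"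
    by (rule F.has_derivative_in_chart[OF F.chart_at open_preimage[OF M.open_cdom[OF M.chart_at(1)]]
          vimageI2[of \<iota> p, OF M.chart_at(2)]])
      (use M.chart_at in \<open>auto simp: F.param_coord M.param_coord F.chart_at\<close>)
qed

text \<open>Vector fields along \<open>\<iota>\<close>: \<open>W q\<close> consists of components in \<open>chart_at A (\<iota> q)\<close>, hence the passage to a fixed chart.\<close>

definition smooth_along :: "'q set \<Rightarrow> ('q \<Rightarrow> 'e) \<Rightarrow> bool" where
  "smooth_along U W \<longleftrightarrow> (\<forall>d\<in>A. \<forall>i\<in>Basis.
     smooth_fun B (U \<inter> \<iota> -` cdom d) (\<lambda>q. components A d (\<iota> q) (W q) \<bullet> i))"

lemma smooth_alongD:
  "smooth_along U W \<Longrightarrow> d \<in> A \<Longrightarrow> i \<in> Basis \<Longrightarrow>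
    smooth_fun B (U \<inter> \<iota> -` cdom d) (\<lambda>q. components A d (\<iota> q) (W q) \<bullet> i)"
  unfolding smooth_along_def by blast

lemma open_Int_preimage_cdom: "open U \<Longrightarrow> d \<in> A \<Longrightarrow> open (U \<inter> \<iota> -` cdom d)"
  by (intro open_Int open_preimage M.open_cdom)

lemma smooth_along_cong:
  assumes "open U" "\<And>q. q \<in> U \<Longrightarrow> W q = W' q" "smooth_along U W"
  shows "smooth_along U W'"
  unfolding smooth_along_def
proof (intro ballI)
  fix d and i :: 'e assume d: "d \<in> A" "i \<in> Basis"
  show "smooth_fun B (U \<inter> \<iota> -` cdom d) (\<lambda>q. components A d (\<iota> q) (W' q) \<bullet> i)"
    by (rule F.smooth_fun_cong[OF open_Int_preimage_cdom[OF assms(1) d(1)] _ smooth_alongD[OF assms(3) d]])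
      (use assms(2) in auto)
qed

lemma smooth_along_subset: "smooth_along U W \<Longrightarrow> V \<subseteq> U \<Longrightarrow> smooth_along V W"
  unfolding smooth_along_def by (auto elim!: ballE F.smooth_fun_subset)

lemma smooth_along_local:
  assumes "\<And>p. p \<in> U \<Longrightarrow> \<exists>V. open V \<and> p \<in> V \<and> smooth_along V W"
  shows "smooth_along U W"
  unfolding smooth_along_def
proof (intro ballI F.smooth_fun_local)
  fix d p and i :: 'e assume d: "d \<in> A" "i \<in> Basis" and p: "p \<in> U \<inter> \<iota> -` cdom d"
  then obtain V where V: "open V" "p \<in> V" "smooth_along V W" using assms by blast
  show "\<exists>V. open V \<and> p \<in> V \<and> smooth_fun B V (\<lambda>q. components A d (\<iota> q) (W q) \<bullet> i)"
    by (rule exI[of _ "V \<inter> \<iota> -` cdom d"])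
      (use open_Int_preimage_cdom[OF V(1) d(1)] smooth_alongD[OF V(3) d] V p in auto)
qed

lemma smooth_along_add:
  assumes "open U" "smooth_along U W" "smooth_along U W'"
  shows "smooth_along U (\<lambda>q. W q + W' q)"
  unfolding smooth_along_def
proof (intro ballI)
  fix d and i :: 'e assume d: "d \<in> A" "i \<in> Basis"
  note o = open_Int_preimage_cdom[OF assms(1) d(1)]
  show "smooth_fun B (U \<inter> \<iota> -` cdom d) (\<lambda>q. components A d (\<iota> q) (W q + W' q) \<bullet> i)"
    by (rule F.smooth_fun_cong[OF o _ F.smooth_fun_add[OF o smooth_alongD[OF assms(2) d] smooth_alongD[OF assms(3) d]]])
      (use d M.linear_components in \<open>auto simp: linear_add inner_add_left\<close>)
qed

lemma smooth_along_scaleR: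
  assumes "open U" "smooth_fun B U f" "smooth_along U W"
  shows "smooth_along U (\<lambda>q. f q *\<^sub>R W q)"
  unfolding smooth_along_def
proof (intro ballI)
  fix d and i :: 'e assume d: "d \<in> A" "i \<in> Basis"
  note o = open_Int_preimage_cdom[OF assms(1) d(1)]
  show "smooth_fun B (U \<inter> \<iota> -` cdom d) (\<lambda>q. components A d (\<iota> q) (f q *\<^sub>R W q) \<bullet> i)"
    by (rule F.smooth_fun_cong[OF o _ F.smooth_fun_mult[OF o F.smooth_fun_subset[OF assms(2)] smooth_alongD[OF assms(3) d]]])
      (use d M.linear_components in \<open>auto simp: linear_scale\<close>)
qed

lemma smooth_along_pullback:
  assumes V: "open V" and Y: "smooth_field A V Y"
  shows "smooth_along (\<iota> -` V) (\<lambda>q. Y (\<iota> q))"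
  unfolding smooth_along_def
proof (intro ballI)
  fix d and i :: 'e assume d: "d \<in> A" "i \<in> Basis"
  have "smooth_fun B (\<iota> -` (V \<inter> cdom d)) (\<lambda>q. components A d (\<iota> q) (Y (\<iota> q)) \<bullet> i)"
    by (rule smooth_fun_pullback[OF _ M.smooth_field_components[OF V Y d(1)]])
      (use V M.open_cdom d in blast)
  then show "smooth_fun B (\<iota> -` V \<inter> \<iota> -` cdom d) (\<lambda>q. components A d (\<iota> q) (Y (\<iota> q)) \<bullet> i)"
    by (simp add: vimage_Int)
qed

lemma smooth_along_sum:
  assumes U: "open U" and I: "finite I" "I \<noteq> {}" and W: "\<And>i. i \<in> I \<Longrightarrow> smooth_along U (W i)"
  shows "smooth_along U (\<lambda>q. \<Sum>i\<in>I. W i q)"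
  using I W by (induction I rule: finite_ne_induct) (auto intro: smooth_along_add[OF U])

lemma components_differential:
  assumes d: "d \<in> A" "\<iota> p \<in> cdom d"
  shows "components A d (\<iota> p) (T p v) \<bullet> i = dir_deriv B p v (\<lambda>q. coord d (\<iota> q) \<bullet> i)"
  using dir_deriv_pullback[OF M.open_cdom[OF d(1)] d(2) M.smooth_fun_coord[OF d(1)]]
    M.components_eq_dir_deriv[OF d] by simp

lemma smooth_along_differential:
  assumes U: "open U" and X: "smooth_field B U X"
  shows "smooth_along U (\<lambda>q. T q (X q))"
  unfolding smooth_along_def
proof (intro ballI)
  fix d and i :: 'e assume d: "d \<in> A" "i \<in> Basis"
  note o = open_Int_preimage_cdom[OF U d(1)]
  show "smooth_fun B (U \<inter> \<iota> -` cdom d) (\<lambda>q. components A d (\<iota> q) (T q (X q)) \<bullet> i)"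
  proof (rule F.smooth_fun_cong[OF o])
    show "smooth_fun B (U \<inter> \<iota> -` cdom d) (\<lambda>q. dir_deriv B q (X q) (\<lambda>q. coord d (\<iota> q) \<bullet> i))"
      by (rule F.smooth_dir_deriv[OF o F.smooth_field_subset[OF X] F.smooth_fun_subset
            [OF smooth_fun_pullback[OF M.open_cdom[OF d(1)] M.smooth_fun_coord[OF d(1)]]]]) auto
  qed (use components_differential d in auto)
qed

section \<open>Covariant differentiation along a map\<close>

text \<open>Splitting the vector-valued derivative into coordinates reduces the rules for
  \<open>D\<close> to those for \<open>dir_deriv\<close>. As \<open>d\<close> is the chart chosen at
  \<open>\<iota> p\<close>, the value \<open>W p\<close> needs no conversion.\<close>

lemma cov_along_eq:
  assumes U: "open U" "p \<in> U" and W: "smooth_along U W"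
  defines "d \<equiv> chart_at A (\<iota> p)"
  shows "D p v W = (\<Sum>i\<in>Basis. dir_deriv B p v (\<lambda>q. components A d (\<iota> q) (W q) \<bullet> i) *\<^sub>R i
      + (W p \<bullet> i) *\<^sub>R nab (\<iota> p) (T p v) (coord_field A d i))"
proof -
  let ?c = "chart_at B p"
  have d: "d \<in> A" "\<iota> p \<in> cdom d" unfolding d_def by (rule M.chart_at)+
  let ?f = "\<lambda>x. components A d (\<iota> (param ?c x)) (W (param ?c x))"
  have "((\<lambda>x. \<Sum>i\<in>Basis. (?f x \<bullet> i) *\<^sub>R i) has_derivative
      (\<lambda>v. \<Sum>i\<in>Basis. dir_deriv B p v (\<lambda>q. components A d (\<iota> q) (W q) \<bullet> i) *\<^sub>R i)) (at (coord ?c p))"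
    by (intro has_derivative_sum bounded_linear.has_derivative[OF bounded_linear_scaleR_left]
        F.dir_deriv_has_derivative[OF smooth_alongD[OF W d(1)]]) (use U d in auto)
  then have "(?f has_derivative
      (\<lambda>v. \<Sum>i\<in>Basis. dir_deriv B p v (\<lambda>q. components A d (\<iota> q) (W q) \<bullet> i) *\<^sub>R i)) (at (coord ?c p))"
    by (simp only: euclidean_representation)
  from fun_cong[OF frechet_derivative_at[OF this], of v] show ?thesis
    unfolding cov_along_def Let_def d_def[symmetric] by (simp add: sum.distrib)
qed

lemma cov_along_cong:
  assumes U: "open U" "p \<in> U" and eq: "\<And>q. q \<in> U \<Longrightarrow> W q = W' q" and W: "smooth_along U W"
  shows "D p v W = D p v W'"
proof -
  define d where "d = chart_at A (\<iota> p)"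
  have d: "d \<in> A" "\<iota> p \<in> cdom d" unfolding d_def by (rule M.chart_at)+
  have "dir_deriv B p v (\<lambda>q. components A d (\<iota> q) (W q) \<bullet> i)
      = dir_deriv B p v (\<lambda>q. components A d (\<iota> q) (W' q) \<bullet> i)" if "i \<in> Basis" for i
    by (rule F.dir_deriv_cong[OF open_Int_preimage_cdom[OF U(1) d(1)] _ _ smooth_alongD[OF W d(1) that]])
      (use U d eq in auto)
  then show ?thesis
    using cov_along_eq[OF U W, of v] cov_along_eq[OF U smooth_along_cong[OF U(1) eq W, simplified], of v]
      eq[OF U(2)] by (simp add: d_def)
qed

lemma linear_cov_along:
  assumes U: "open U" "p \<in> U" and W: "smooth_along U W"
  shows "linear (\<lambda>v. D p v W)"
proof -
  define d where "d = chart_at A (\<iota> p)"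
  have d: "d \<in> A" "\<iota> p \<in> cdom d" unfolding d_def by (rule M.chart_at)+
  have p: "p \<in> U \<inter> \<iota> -` cdom d" using U d by auto
  have "linear (\<lambda>v. dir_deriv B p v (\<lambda>q. components A d (\<iota> q) (W q) \<bullet> i) *\<^sub>R i
      + (W p \<bullet> i) *\<^sub>R nab (\<iota> p) (T p v) (coord_field A d i))" if i: "i \<in> Basis" for i
    using F.linear_dir_deriv[OF smooth_alongD[OF W d(1) i] p]
      linear_compose[OF linear_differential
        M.linear_nab[OF M.open_cdom[OF d(1)] M.smooth_coord_field[OF d(1), of i] d(2)]]
    by (simp add: linear_iff algebra_simps)
  then show ?thesis
    unfolding cov_along_eq[OF U W] d_def[symmetric] by (intro linear_compose_sum ballI)
qed

lemma cov_along_add: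
  assumes U: "open U" "p \<in> U" and W: "smooth_along U W" "smooth_along U W'"
  shows "D p v (\<lambda>q. W q + W' q) = D p v W + D p v W'"
proof -
  define d where "d = chart_at A (\<iota> p)"
  have d: "d \<in> A" "\<iota> p \<in> cdom d" unfolding d_def by (rule M.chart_at)+
  note o = open_Int_preimage_cdom[OF U(1) d(1)]
  have p: "p \<in> U \<inter> \<iota> -` cdom d" using U d by auto
  have "dir_deriv B p v (\<lambda>q. components A d (\<iota> q) (W q + W' q) \<bullet> i)
      = dir_deriv B p v (\<lambda>q. components A d (\<iota> q) (W q) \<bullet> i)
      + dir_deriv B p v (\<lambda>q. components A d (\<iota> q) (W' q) \<bullet> i)" if i: "i \<in> Basis" for i
    unfolding F.dir_deriv_add[OF p smooth_alongD[OF W(1) d(1) i] smooth_alongD[OF W(2) d(1) i], symmetric]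
    by (rule F.dir_deriv_cong[OF o p _ smooth_alongD[OF smooth_along_add[OF U(1) W] d(1) i]])
      (use d M.linear_components in \<open>auto simp: linear_add inner_add_left\<close>)
  then show ?thesis
    unfolding cov_along_eq[OF U W(1)] cov_along_eq[OF U W(2)]
      cov_along_eq[OF U smooth_along_add[OF U(1) W]] d_def[symmetric] sum.distrib[symmetric]
    by (intro sum.cong) (auto simp: algebra_simps inner_add_left)
qed

lemma cov_along_scaleR:
  assumes U: "open U" "p \<in> U" and f: "smooth_fun B U f" and W: "smooth_along U W"
  shows "D p v (\<lambda>q. f q *\<^sub>R W q) = dir_deriv B p v f *\<^sub>R W p + f p *\<^sub>R D p v W"
proof -
  define d where "d = chart_at A (\<iota> p)"
  have d: "d \<in> A" "\<iota> p \<in> cdom d" unfolding d_def by (rule M.chart_at)+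
  note o = open_Int_preimage_cdom[OF U(1) d(1)]
  have p: "p \<in> U \<inter> \<iota> -` cdom d" using U d by auto
  have e: "dir_deriv B p v (\<lambda>q. components A d (\<iota> q) (f q *\<^sub>R W q) \<bullet> i)
      = f p * dir_deriv B p v (\<lambda>q. components A d (\<iota> q) (W q) \<bullet> i)
      + dir_deriv B p v f * (W p \<bullet> i)" if i: "i \<in> Basis" for i
  proof -
    have "dir_deriv B p v (\<lambda>q. components A d (\<iota> q) (f q *\<^sub>R W q) \<bullet> i)
        = dir_deriv B p v (\<lambda>q. f q * (components A d (\<iota> q) (W q) \<bullet> i))"
      by (rule F.dir_deriv_cong[OF o p _ smooth_alongD[OF smooth_along_scaleR[OF U(1) f W] d(1) i]])
        (use d M.linear_components in \<open>auto simp: linear_scale\<close>)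
    also have "\<dots> = f p * dir_deriv B p v (\<lambda>q. components A d (\<iota> q) (W q) \<bullet> i)
      + dir_deriv B p v f * (components A d (\<iota> p) (W p) \<bullet> i)"
      by (rule F.dir_deriv_mult[OF p F.smooth_fun_subset[OF f] smooth_alongD[OF W d(1) i]]) auto
    finally show ?thesis by (simp add: d_def M.components_chart_at)
  qed
  have "D p v (\<lambda>q. f q *\<^sub>R W q) = (\<Sum>i\<in>Basis. dir_deriv B p v f *\<^sub>R (W p \<bullet> i) *\<^sub>R i
      + f p *\<^sub>R (dir_deriv B p v (\<lambda>q. components A d (\<iota> q) (W q) \<bullet> i) *\<^sub>R i
      + (W p \<bullet> i) *\<^sub>R nab (\<iota> p) (T p v) (coord_field A d i)))"
    unfolding cov_along_eq[OF U smooth_along_scaleR[OF U(1) f W]] d_def[symmetric]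
    by (intro sum.cong) (auto simp: e algebra_simps)
  also have "\<dots> = dir_deriv B p v f *\<^sub>R W p + f p *\<^sub>R D p v W"
    unfolding cov_along_eq[OF U W] d_def[symmetric] sum.distrib[of "\<lambda>i. dir_deriv B p v f *\<^sub>R (W p \<bullet> i) *\<^sub>R i"]
      scaleR_sum_right[symmetric] by (simp only: euclidean_representation)
  finally show ?thesis .
qed

lemma cov_along_sum:
  assumes U: "open U" "p \<in> U" and I: "finite I" "I \<noteq> {}" and W: "\<And>i. i \<in> I \<Longrightarrow> smooth_along U (W i)"
  shows "D p v (\<lambda>q. \<Sum>i\<in>I. W i q) = (\<Sum>i\<in>I. D p v (W i))"
  using I W
proof (induction I rule: finite_ne_induct)
  case (insert i I)
  then show ?case
    using cov_along_add[OF U _ smooth_along_sum[OF U(1)], of "W i" I W v] by simp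
qed simp

text \<open>Identifies \<open>D\<close> as the pullback of \<open>nab\<close>: expanding
  \<open>Y\<close> in the coordinate frame at \<open>\<iota> p\<close> and applying the Leibniz rule
  on the ambient manifold reproduces the formula that defines \<open>cov_along\<close>.\<close>

lemma cov_along_pullback:
  assumes V: "open V" "\<iota> p \<in> V" and Y: "smooth_field A V Y"
  shows "D p v (\<lambda>q. Y (\<iota> q)) = nab (\<iota> p) (T p v) Y"
proof -
  define d where "d = chart_at A (\<iota> p)"
  have d: "d \<in> A" "\<iota> p \<in> cdom d" unfolding d_def by (rule M.chart_at)+
  let ?N = "V \<inter> cdom d"
  have N: "open ?N" "\<iota> p \<in> ?N" using V d M.open_cdom by auto
  let ?Y = "\<lambda>i r. components A d r (Y r) \<bullet> i"
  note Yi = M.smooth_field_components[OF V(1) Y d(1)]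
  have E: "smooth_field A ?N (coord_field A d i)" for i
    by (rule M.smooth_field_subset[OF M.smooth_coord_field[OF d(1)]]) auto
  have YE: "smooth_field A ?N (\<lambda>r. ?Y i r *\<^sub>R coord_field A d i r)" for i
    by (rule M.smooth_field_scaleR[OF N(1) Yi E])
  have "nab (\<iota> p) (T p v) Y = nab (\<iota> p) (T p v) (\<lambda>r. \<Sum>i\<in>Basis. ?Y i r *\<^sub>R coord_field A d i r)"
    by (rule M.nab_cong[OF N M.smooth_field_subset[OF Y]]) (use M.frame_expansion d(1) in auto)
  also have "\<dots> = (\<Sum>i\<in>Basis. nab (\<iota> p) (T p v) (\<lambda>r. ?Y i r *\<^sub>R coord_field A d i r))"
    by (rule M.nab_sum[OF N]) (auto intro: YE)
  also have "\<dots> = (\<Sum>i\<in>Basis. dir_deriv B p v (\<lambda>q. ?Y i (\<iota> q)) *\<^sub>R i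
      + (Y (\<iota> p) \<bullet> i) *\<^sub>R nab (\<iota> p) (T p v) (coord_field A d i))"
    unfolding M.nab_scaleR[OF N(1) Yi E N(2)] dir_deriv_pullback[OF N Yi, symmetric]
    by (simp add: d_def M.components_chart_at M.coord_field_chart_at)
  also have "\<dots> = D p v (\<lambda>q. Y (\<iota> q))"
    using cov_along_eq[OF open_preimage[OF V(1)] vimageI2[of \<iota> p, OF V(2)]
        smooth_along_pullback[OF V(1) Y], of v] by (simp add: d_def)
  finally show ?thesis ..
qed

text \<open>Near each point a field along \<open>\<iota>\<close> is a combination of restrictions of coordinate fields.\<close>

lemma smooth_along_induct [consumes 4, case_names cong add generator]:
  assumes d: "d \<in> A" and N: "open N" "N \<subseteq> \<iota> -` cdom d" and W: "smooth_along N W"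
    and cong: "\<And>W W'. smooth_along N W \<Longrightarrow> (\<And>q. q \<in> N \<Longrightarrow> W q = W' q) \<Longrightarrow> P W \<Longrightarrow> P W'"
    and add: "\<And>W W'. smooth_along N W \<Longrightarrow> smooth_along N W' \<Longrightarrow> P W \<Longrightarrow> P W' \<Longrightarrow> P (\<lambda>q. W q + W' q)"
    and gen: "\<And>f Y. smooth_fun B N f \<Longrightarrow> smooth_field A (cdom d) Y \<Longrightarrow>
      smooth_along N (\<lambda>q. Y (\<iota> q)) \<Longrightarrow> P (\<lambda>q. f q *\<^sub>R Y (\<iota> q))"
  shows "P W"
proof -
  have [simp]: "N \<inter> \<iota> -` cdom d = N" using N by blast
  let ?W = "\<lambda>i q. (components A d (\<iota> q) (W q) \<bullet> i) *\<^sub>R coord_field A d i (\<iota> q)"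
  have E: "smooth_along N (\<lambda>q. coord_field A d i (\<iota> q))" for i
    by (rule smooth_along_subset[OF smooth_along_pullback[OF M.open_cdom[OF d] M.smooth_coord_field[OF d]] N(2)])
  have c: "smooth_fun B N (\<lambda>q. components A d (\<iota> q) (W q) \<bullet> i)" if "i \<in> Basis" for i
    using smooth_alongD[OF W d that] by simp
  have Wi: "smooth_along N (?W i) \<and> P (?W i)" if i: "i \<in> Basis" for i
    using smooth_along_scaleR[OF N(1) c[OF i] E] gen[OF c[OF i] M.smooth_coord_field[OF d] E] by blast
  have "I \<subseteq> Basis \<Longrightarrow> smooth_along N (\<lambda>q. \<Sum>i\<in>I. ?W i q) \<and> P (\<lambda>q. \<Sum>i\<in>I. ?W i q)"
    if "finite I" "I \<noteq> {}" for I :: "'e set"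
    using that
  proof (induction I rule: finite_ne_induct)
    case (insert i I)
    then have "smooth_along N (\<lambda>q. ?W i q + (\<Sum>i\<in>I. ?W i q)) \<and> P (\<lambda>q. ?W i q + (\<Sum>i\<in>I. ?W i q))"
      using Wi[of i] add[of "?W i" "\<lambda>q. \<Sum>i\<in>I. ?W i q"]
        smooth_along_add[OF N(1), of "?W i" "\<lambda>q. \<Sum>i\<in>I. ?W i q"] by blast
    with insert show ?case by simp
  qed (use Wi in simp)
  from this[of Basis] have sum: "smooth_along N (\<lambda>q. \<Sum>i\<in>Basis. ?W i q)" "P (\<lambda>q. \<Sum>i\<in>Basis. ?W i q)"
    by auto
  show ?thesis
    by (rule cong[OF sum(1) _ sum(2)]) (use M.frame_expansion[OF d, symmetric] N in auto)
qed

end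

section \<open>Smoothness and curvature of the pullback connection\<close>

context affine_map
begin

text \<open>For a smooth field \<open>v = X q\<close> the coefficients are smooth functions on the
  submanifold, and the other factors are restrictions of ambient fields. In this form the expression
  can be differentiated once more along \<open>\<iota>\<close>.\<close>

lemma nab_pullback_expansion:
  assumes "d \<in> A" "\<iota> q \<in> cdom d" "smooth_field A (cdom d) Y"
  shows "nab (\<iota> q) (T q v) Y =
    (\<Sum>j\<in>Basis. dir_deriv B q v (\<lambda>r. coord d (\<iota> r) \<bullet> j) *\<^sub>R cov nab (coord_field A d j) Y (\<iota> q))"
  using M.nab_expansion[OF assms(1,2) M.open_cdom[OF assms(1)] assms(2,3), of "T q v"]
  by (simp add: components_differential[OF assms(1,2)])

lemma smooth_coord_pullback:
  "d \<in> A \<Longrightarrow> smooth_fun B (\<iota> -` cdom d) (\<lambda>q. coord d (\<iota> q) \<bullet> i)"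
  by (rule smooth_fun_pullback[OF M.open_cdom M.smooth_fun_coord])

text \<open>On a generator, the Leibniz rule and the frame expansion of the direction leave a finite
  sum of smooth functions times restricted ambient fields.\<close>

lemma smooth_cov_along:
  assumes U: "open U" and X: "smooth_field B U X" and W: "smooth_along U W"
  shows "smooth_along U (\<lambda>q. D q (X q) W)"
proof (rule smooth_along_local)
  fix p assume p: "p \<in> U"
  define d where "d = chart_at A (\<iota> p)"
  have d: "d \<in> A" "\<iota> p \<in> cdom d" unfolding d_def by (rule M.chart_at)+
  define N where "N = U \<inter> \<iota> -` cdom d"
  have N: "open N" "p \<in> N" "N \<subseteq> \<iota> -` cdom d" "N \<subseteq> U"
    using open_Int_preimage_cdom[OF U d(1)] p d by (auto simp: N_def)
  have XN: "smooth_field B N X" by (rule F.smooth_field_subset[OF X N(4)])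
  have "smooth_along N (\<lambda>q. D q (X q) W)"
    using d(1) N(1,3) smooth_along_subset[OF W N(4)]
  proof (induction rule: smooth_along_induct)
    case (cong W W')
    show ?case
      by (rule smooth_along_cong[OF N(1) _ cong(3)]) (use cov_along_cong[OF N(1) _ cong(2,1)] in blast)
  next
    case (add W W')
    show ?case
      by (rule smooth_along_cong[OF N(1) _ smooth_along_add[OF N(1) add(3,4)]])
        (use cov_along_add[OF N(1) _ add(1,2)] in simp)
  next
    case (generator f Y)
    let ?S = "\<lambda>q. \<Sum>j\<in>Basis. dir_deriv B q (X q) (\<lambda>r. coord d (\<iota> r) \<bullet> j) *\<^sub>R
        cov nab (coord_field A d j) Y (\<iota> q)"
    have C: "smooth_along N (\<lambda>q. cov nab (coord_field A d j) Y (\<iota> q))" for j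
      by (rule smooth_along_subset[OF smooth_along_pullback[OF M.open_cdom[OF d(1)]
              M.smooth_cov[OF M.open_cdom[OF d(1)] M.smooth_coord_field[OF d(1)] generator(2)]] N(3)])
    have x: "smooth_fun B N (\<lambda>q. dir_deriv B q (X q) (\<lambda>r. coord d (\<iota> r) \<bullet> j))" for j
      by (rule F.smooth_dir_deriv[OF N(1) XN F.smooth_fun_subset[OF smooth_coord_pullback[OF d(1)] N(3)]])
    have S: "smooth_along N ?S"
      by (rule smooth_along_sum[OF N(1)]) (auto intro: smooth_along_scaleR[OF N(1) x C])
    have "smooth_along N (\<lambda>q. dir_deriv B q (X q) f *\<^sub>R Y (\<iota> q) + f q *\<^sub>R ?S q)"
      by (rule smooth_along_add[OF N(1) smooth_along_scaleR[OF N(1) F.smooth_dir_deriv[OF N(1) XN generator(1)]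
            generator(3)] smooth_along_scaleR[OF N(1) generator(1) S]])
    then show ?case
    proof (rule smooth_along_cong[OF N(1), rotated])
      fix q assume q: "q \<in> N"
      then have "\<iota> q \<in> cdom d" using N by auto
      then show "dir_deriv B q (X q) f *\<^sub>R Y (\<iota> q) + f q *\<^sub>R ?S q = D q (X q) (\<lambda>q. f q *\<^sub>R Y (\<iota> q))"
        using cov_along_scaleR[OF N(1) q generator(1,3), of "X q"]
          nab_pullback_expansion[OF d(1) _ generator(2), of q "X q"]
          cov_along_pullback[OF M.open_cdom[OF d(1)] _ generator(2), of q "X q"] by simp
    qed
  qed
  with N show "\<exists>V. open V \<and> p \<in> V \<and> smooth_along V (\<lambda>q. D q (X q) W)" by blast
qed

text \<open>Applied to the complex structure. Both conclusions are carried through one induction,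
  because passing to an equal field or to a sum under \<open>D\<close> already requires the image
  field to be smooth.\<close>

lemma cov_along_tensor:
  assumes J: "\<And>p. linear (J p)"
    and smooth: "\<And>V Y. open V \<Longrightarrow> smooth_field A V Y \<Longrightarrow> smooth_field A V (\<lambda>r. J r (Y r))"
    and par: "\<And>V Y r w. open V \<Longrightarrow> smooth_field A V Y \<Longrightarrow> r \<in> V \<Longrightarrow> nab r w (\<lambda>r. J r (Y r)) = J r (nab r w Y)"
    and U: "open U" and W: "smooth_along U W"
  shows "smooth_along U (\<lambda>q. J (\<iota> q) (W q))"
    and "p \<in> U \<Longrightarrow> D p v (\<lambda>q. J (\<iota> q) (W q)) = J (\<iota> p) (D p v W)"
proof -
  have "\<exists>N. open N \<and> p \<in> N \<and> smooth_along N (\<lambda>q. J (\<iota> q) (W q)) \<and>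
    (\<forall>q\<in>N. \<forall>v. D q v (\<lambda>q. J (\<iota> q) (W q)) = J (\<iota> q) (D q v W))" if p: "p \<in> U" for p
  proof -
    define d where "d = chart_at A (\<iota> p)"
    have d: "d \<in> A" "\<iota> p \<in> cdom d" unfolding d_def by (rule M.chart_at)+
    define N where "N = U \<inter> \<iota> -` cdom d"
    have N: "open N" "p \<in> N" "N \<subseteq> \<iota> -` cdom d" "N \<subseteq> U"
      using open_Int_preimage_cdom[OF U d(1)] p d by (auto simp: N_def)
    have "smooth_along N (\<lambda>q. J (\<iota> q) (W q)) \<and>
      (\<forall>q\<in>N. \<forall>v. D q v (\<lambda>q. J (\<iota> q) (W q)) = J (\<iota> q) (D q v W))"
      using d(1) N(1,3) smooth_along_subset[OF W N(4)]
    proof (induction rule: smooth_along_induct)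
      case (cong W W')
      have JW: "J (\<iota> q) (W q) = J (\<iota> q) (W' q)" if "q \<in> N" for q using cong(2)[OF that] by simp
      have s: "smooth_along N (\<lambda>q. J (\<iota> q) (W q))" using cong(3) by blast
      have "smooth_along N (\<lambda>q. J (\<iota> q) (W' q))" by (rule smooth_along_cong[OF N(1) JW s])
      moreover have "D q v (\<lambda>q. J (\<iota> q) (W' q)) = J (\<iota> q) (D q v W')" if "q \<in> N" for q v
        using cov_along_cong[OF N(1) that JW s, of v] cov_along_cong[OF N(1) that cong(2,1), of v]
          cong(3) that by simp
      ultimately show ?case by blast
    next
      case (add W W')
      have s: "smooth_along N (\<lambda>q. J (\<iota> q) (W q))" "smooth_along N (\<lambda>q. J (\<iota> q) (W' q))" using add by auto
      show ?case
        using smooth_along_add[OF N(1) s] add(3,4) cov_along_add[OF N(1) _ s]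
          cov_along_add[OF N(1) _ add(1,2)] by (simp add: linear_add[OF J])
    next
      case (generator f Y)
      note JY = smooth[OF M.open_cdom[OF d(1)] generator(2)]
      have s: "smooth_along N (\<lambda>q. J (\<iota> q) (Y (\<iota> q)))"
        by (rule smooth_along_subset[OF smooth_along_pullback[OF M.open_cdom[OF d(1)] JY] N(3)])
      have "D q v (\<lambda>q. J (\<iota> q) (Y (\<iota> q))) = J (\<iota> q) (D q v (\<lambda>q. Y (\<iota> q)))" if "q \<in> N" for q v
        using that N(3) cov_along_pullback[OF M.open_cdom[OF d(1)] _ JY, of q v]
          cov_along_pullback[OF M.open_cdom[OF d(1)] _ generator(2), of q v]
          par[OF M.open_cdom[OF d(1)] generator(2), of "\<iota> q"] by auto
      then show ?case
        using smooth_along_scaleR[OF N(1) generator(1) s] cov_along_scaleR[OF N(1) _ generator(1) s]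
          cov_along_scaleR[OF N(1) _ generator(1,3)] by (simp add: linear_scale[OF J] linear_add[OF J])
    qed
    with N show ?thesis by blast
  qed
  note * = this
  show "smooth_along U (\<lambda>q. J (\<iota> q) (W q))"
    by (rule smooth_along_local) (use * in blast)
  show "p \<in> U \<Longrightarrow> D p v (\<lambda>q. J (\<iota> q) (W q)) = J (\<iota> p) (D p v W)"
    using * by blast
qed

text \<open>The curvature of the pulled-back connection. Evaluating it once by the ambient curvature
  tensor and once by the splitting into tangent and normal parts yields the equations of Gauss and
  Codazzi.\<close>

definition along_curvature :: "('q \<Rightarrow> 'f) \<Rightarrow> ('q \<Rightarrow> 'f) \<Rightarrow> ('q \<Rightarrow> 'e) \<Rightarrow> 'q \<Rightarrow> 'e" where
  "along_curvature X Y W p = D p (X p) (\<lambda>q. D q (Y q) W) - D p (Y p) (\<lambda>q. D q (X q) W)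
     - D p (lie_bracket B X Y p) W"

context
  fixes N X Y assumes N: "open N" and X: "smooth_field B N X" and Y: "smooth_field B N Y"
begin

lemma along_curvature_cong:
  assumes "p \<in> N" "smooth_along N W" "\<And>q. q \<in> N \<Longrightarrow> W q = W' q"
  shows "along_curvature X Y W p = along_curvature X Y W' p"
proof -
  have "D p v (\<lambda>q. D q (Z q) W) = D p v (\<lambda>q. D q (Z q) W')" if "smooth_field B N Z" for v Z
    by (rule cov_along_cong[OF N assms(1) _ smooth_cov_along[OF N that assms(2)]])
      (rule cov_along_cong[OF N _ assms(3,2)])
  then show ?thesis
    unfolding along_curvature_def using X Y cov_along_cong[OF N assms(1,3,2)] by simp
qed

lemma along_curvature_add:
  assumes p: "p \<in> N" and W: "smooth_along N W" "smooth_along N W'"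
  shows "along_curvature X Y (\<lambda>q. W q + W' q) p = along_curvature X Y W p + along_curvature X Y W' p"
proof -
  have "D p v (\<lambda>q. D q (Z q) (\<lambda>q. W q + W' q)) = D p v (\<lambda>q. D q (Z q) W) + D p v (\<lambda>q. D q (Z q) W')"
    if Z: "smooth_field B N Z" for v Z
  proof -
    have "D p v (\<lambda>q. D q (Z q) (\<lambda>q. W q + W' q)) = D p v (\<lambda>q. D q (Z q) W + D q (Z q) W')"
      by (rule cov_along_cong[OF N p _ smooth_cov_along[OF N Z smooth_along_add[OF N W]]])
        (rule cov_along_add[OF N _ W])
    then show ?thesis
      using cov_along_add[OF N p smooth_cov_along[OF N Z W(1)] smooth_cov_along[OF N Z W(2)]] by simp
  qed
  then show ?thesis
    unfolding along_curvature_def using X Y cov_along_add[OF N p W] by simp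
qed

text \<open>Tensoriality in the differentiated field: the mixed first-order terms are symmetric in
  \<open>X\<close> and \<open>Y\<close> and cancel, and the commutator of second derivatives of
  \<open>f\<close> is the derivative along the bracket. This permits evaluation on
  generators.\<close>

lemma along_curvature_scaleR:
  assumes p: "p \<in> N" and f: "smooth_fun B N f" and W: "smooth_along N W"
  shows "along_curvature X Y (\<lambda>q. f q *\<^sub>R W q) p = f p *\<^sub>R along_curvature X Y W p"
proof -
  have "D p v (\<lambda>q. D q (Z q) (\<lambda>q. f q *\<^sub>R W q)) =
      dir_deriv B p v (\<lambda>q. dir_deriv B q (Z q) f) *\<^sub>R W p + dir_deriv B p (Z p) f *\<^sub>R D p v W
      + (dir_deriv B p v f *\<^sub>R D p (Z p) W + f p *\<^sub>R D p v (\<lambda>q. D q (Z q) W))"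
    if Z: "smooth_field B N Z" for v Z
  proof -
    note Zf = F.smooth_dir_deriv[OF N Z f] and ZW = smooth_cov_along[OF N Z W]
    have "D p v (\<lambda>q. D q (Z q) (\<lambda>q. f q *\<^sub>R W q)) =
        D p v (\<lambda>q. dir_deriv B q (Z q) f *\<^sub>R W q + f q *\<^sub>R D q (Z q) W)"
      by (rule cov_along_cong[OF N p _ smooth_cov_along[OF N Z smooth_along_scaleR[OF N f W]]])
        (rule cov_along_scaleR[OF N _ f W])
    then show ?thesis
      by (simp add: cov_along_add[OF N p smooth_along_scaleR[OF N Zf W] smooth_along_scaleR[OF N f ZW]]
          cov_along_scaleR[OF N p Zf W] cov_along_scaleR[OF N p f ZW])
  qed
  from this[OF X] this[OF Y] show ?thesis
    unfolding along_curvature_def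
    by (simp add: cov_along_scaleR[OF N p f W] F.dir_deriv_lie_bracket[OF N p X Y f] algebra_simps)
qed

end

text \<open>With the chart that is chosen at \<open>\<iota> p\<close>, the brackets of the coordinate fields vanish at \<open>\<iota> p\<close> by definition of
  \<open>lie_bracket\<close>, which avoids its invariance under changes of charts.\<close>

lemma along_curvature_pullback:
  fixes p defines "d \<equiv> chart_at A (\<iota> p)"
  assumes N: "open N" "p \<in> N" "N \<subseteq> \<iota> -` cdom d" and X: "smooth_field B N X" and Y: "smooth_field B N Y"
    and Z: "smooth_field A (cdom d) Z"
  shows "along_curvature X Y (\<lambda>q. Z (\<iota> q)) p = (\<Sum>i\<in>Basis. \<Sum>j\<in>Basis.
    ((T p (X p) \<bullet> i) * (T p (Y p) \<bullet> j)) *\<^sub>R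
      curvature A nab (coord_field A d i) (coord_field A d j) Z (\<iota> p))"
proof -
  have d: "d \<in> A" "\<iota> p \<in> cdom d" unfolding d_def by (rule M.chart_at)+
  note od = M.open_cdom[OF d(1)] and E = M.smooth_coord_field[OF d(1)]
  let ?C = "\<lambda>j. cov nab (coord_field A d j) Z"
  let ?x = "\<lambda>j q. coord d (\<iota> q) \<bullet> j"
  note C = M.smooth_cov[OF od E Z]
  have CN: "smooth_along N (\<lambda>q. ?C j (\<iota> q))" for j
    by (rule smooth_along_subset[OF smooth_along_pullback[OF od C] N(3)])
  have x: "smooth_fun B N (?x j)" for j by (rule F.smooth_fun_subset[OF smooth_coord_pullback[OF d(1)] N(3)])
  have Tx: "dir_deriv B p v (?x j) = T p v \<bullet> j" for v j
    using components_differential[OF d, of v j] by (simp add: d_def M.components_chart_at)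
  have nabd: "nab (\<iota> p) (T p v) Y = (\<Sum>i\<in>Basis. (T p v \<bullet> i) *\<^sub>R cov nab (coord_field A d i) Y (\<iota> p))"
    if "smooth_field A (cdom d) Y" for v Y
    using nab_pullback_expansion[OF d that, of v] Tx by simp
  have DD: "D p v (\<lambda>q. D q (S q) (\<lambda>q. Z (\<iota> q))) = (\<Sum>j\<in>Basis.
      dir_deriv B p v (\<lambda>q. dir_deriv B q (S q) (?x j)) *\<^sub>R ?C j (\<iota> p)
      + (T p (S p) \<bullet> j) *\<^sub>R (\<Sum>i\<in>Basis. (T p v \<bullet> i) *\<^sub>R cov nab (coord_field A d i) (?C j) (\<iota> p)))"
    if S: "smooth_field B N S" for v S
  proof -
    note Sx = F.smooth_dir_deriv[OF N(1) S x]
    have ZN: "smooth_along N (\<lambda>q. Z (\<iota> q))"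
      by (rule smooth_along_subset[OF smooth_along_pullback[OF od Z] N(3)])
    have "D p v (\<lambda>q. D q (S q) (\<lambda>q. Z (\<iota> q))) =
        D p v (\<lambda>q. \<Sum>j\<in>Basis. dir_deriv B q (S q) (?x j) *\<^sub>R ?C j (\<iota> q))"
    proof (rule cov_along_cong[OF N(1,2) _ smooth_cov_along[OF N(1) S ZN]])
      fix q assume "q \<in> N"
      then have q: "\<iota> q \<in> cdom d" using N by auto
      show "D q (S q) (\<lambda>q. Z (\<iota> q)) = (\<Sum>j\<in>Basis. dir_deriv B q (S q) (?x j) *\<^sub>R ?C j (\<iota> q))"
        using cov_along_pullback[OF od q Z] nab_pullback_expansion[OF d(1) q Z] by simp
    qed
    also have "\<dots> = (\<Sum>j\<in>Basis. D p v (\<lambda>q. dir_deriv B q (S q) (?x j) *\<^sub>R ?C j (\<iota> q)))"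
      by (rule cov_along_sum[OF N(1,2)]) (auto intro: smooth_along_scaleR[OF N(1) Sx CN])
    finally show ?thesis
      by (simp add: cov_along_scaleR[OF N(1,2) Sx CN] cov_along_pullback[OF od d(2) C] nabd[OF C] Tx)
  qed
  \<comment> \<open>These terms cancel the second derivatives of the coordinate functions that
    \<open>DD\<close> leaves behind.\<close>
  have br: "D p (lie_bracket B X Y p) (\<lambda>q. Z (\<iota> q)) = (\<Sum>j\<in>Basis.
      (dir_deriv B p (X p) (\<lambda>q. dir_deriv B q (Y q) (?x j))
       - dir_deriv B p (Y p) (\<lambda>q. dir_deriv B q (X q) (?x j))) *\<^sub>R ?C j (\<iota> p))"
    using cov_along_pullback[OF od d(2) Z] nab_pullback_expansion[OF d Z]
    by (simp add: F.dir_deriv_lie_bracket[OF N(1,2) X Y x])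
  have curv: "curvature A nab (coord_field A d i) (coord_field A d j) Z (\<iota> p) =
      cov nab (coord_field A d i) (?C j) (\<iota> p) - cov nab (coord_field A d j) (?C i) (\<iota> p)" for i j
    unfolding curvature_def d_def M.lie_bracket_coord_fields[of "\<iota> p"] cov_def
    using linear_0[OF M.linear_nab[OF od Z d(2)]] M.lie_bracket_coord_fields[of "\<iota> p"] by (simp add: d_def)
  have "along_curvature X Y (\<lambda>q. Z (\<iota> q)) p =
      (\<Sum>j\<in>Basis. \<Sum>i\<in>Basis. ((T p (X p) \<bullet> i) * (T p (Y p) \<bullet> j)) *\<^sub>R cov nab (coord_field A d i) (?C j) (\<iota> p))
      - (\<Sum>j\<in>Basis. \<Sum>i\<in>Basis. ((T p (X p) \<bullet> j) * (T p (Y p) \<bullet> i)) *\<^sub>R cov nab (coord_field A d i) (?C j) (\<iota> p))"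
    unfolding along_curvature_def DD[OF X] DD[OF Y] br
    by (simp add: sum.distrib scaleR_left_diff_distrib sum_subtractf scaleR_sum_right mult.commute)
  also have "(\<Sum>j\<in>Basis. \<Sum>i\<in>Basis. ((T p (X p) \<bullet> i) * (T p (Y p) \<bullet> j)) *\<^sub>R cov nab (coord_field A d i) (?C j) (\<iota> p))
     = (\<Sum>i\<in>Basis. \<Sum>j\<in>Basis. ((T p (X p) \<bullet> i) * (T p (Y p) \<bullet> j)) *\<^sub>R cov nab (coord_field A d i) (?C j) (\<iota> p))"
    by (rule sum.swap)
  finally show ?thesis
    unfolding curv by (simp add: scaleR_right_diff_distrib sum_subtractf)
qed

text \<open>The curvature formula is available for ambient fields only, whereas the arguments here
  live along \<open>\<iota>\<close>. On a generator, the curvature is a combination of ambient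
  curvatures of coordinate fields, which the trilinearity of \<open>K\<close> reassembles.\<close>

lemma along_curvature_eq:
  assumes U: "open U" "p \<in> U" and X: "smooth_field B U X" and Y: "smooth_field B U Y" and W: "smooth_along U W"
    and K: "\<And>x y. linear (K x y)" "\<And>x z. linear (\<lambda>y. K x y z)" "\<And>y z. linear (\<lambda>x. K x y z)"
    and curv: "\<And>V X Y Z. open V \<Longrightarrow> smooth_field A V X \<Longrightarrow> smooth_field A V Y \<Longrightarrow> smooth_field A V Z \<Longrightarrow>
      \<iota> p \<in> V \<Longrightarrow> curvature A nab X Y Z (\<iota> p) = K (X (\<iota> p)) (Y (\<iota> p)) (Z (\<iota> p))"
  shows "along_curvature X Y W p = K (T p (X p)) (T p (Y p)) (W p)"
proof -
  define d where "d = chart_at A (\<iota> p)"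
  have d: "d \<in> A" "\<iota> p \<in> cdom d" unfolding d_def by (rule M.chart_at)+
  define N where "N = U \<inter> \<iota> -` cdom d"
  have N: "open N" "p \<in> N" "N \<subseteq> \<iota> -` cdom d" "N \<subseteq> U"
    using open_Int_preimage_cdom[OF U(1) d(1)] U d by (auto simp: N_def)
  note XN = F.smooth_field_subset[OF X N(4)] and YN = F.smooth_field_subset[OF Y N(4)]
  show ?thesis
    using d(1) N(1,3) smooth_along_subset[OF W N(4)]
  proof (induction rule: smooth_along_induct)
    case (cong W W')
    then show ?case using along_curvature_cong[OF N(1) XN YN N(2) cong(1,2)] N(2) by simp
  next
    case (add W W')
    then show ?case using along_curvature_add[OF N(1) XN YN N(2) add(1,2)] by (simp add: linear_add[OF K(1)])
  next
    case (generator f Z)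
    have "along_curvature X Y (\<lambda>q. Z (\<iota> q)) p = (\<Sum>i\<in>Basis. \<Sum>j\<in>Basis.
      ((T p (X p) \<bullet> i) * (T p (Y p) \<bullet> j)) *\<^sub>R K i j (Z (\<iota> p)))"
      using along_curvature_pullback[OF N(1,2) N(3)[unfolded d_def] XN YN generator(2)[unfolded d_def]]
        curv[OF M.open_cdom[OF d(1)] M.smooth_coord_field[OF d(1)] M.smooth_coord_field[OF d(1)] generator(2) d(2)]
      by (simp add: d_def M.coord_field_chart_at)
    also have "\<dots> = K (T p (X p)) (T p (Y p)) (Z (\<iota> p))"
      by (subst (2) linear_expansion_Basis[OF K(3)], subst linear_expansion_Basis[OF K(2)])
         (simp add: scaleR_sum_right)
    finally show ?case
      using along_curvature_scaleR[OF N(1) XN YN N(2) generator(1,3)] by (simp add: linear_scale[OF K(1)])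
  qed
qed

end

section \<open>Torsion and metric\<close>

locale riemannian_map = affine_map A nab B \<iota>
  for A :: "('p::topological_space, 'e::euclidean_space) chart set"
    and nab :: "'p \<Rightarrow> 'e \<Rightarrow> ('p \<Rightarrow> 'e) \<Rightarrow> 'e"
    and B :: "('q::topological_space, 'f::euclidean_space) chart set"
    and \<iota> :: "'q \<Rightarrow> 'p" +
  fixes g :: "'p \<Rightarrow> 'e \<Rightarrow> 'e \<Rightarrow> real"
  assumes metric: "riemannian_metric A g" and levi_civita: "levi_civita A g nab"
begin

lemma bilinear_metric: "bilinear (g r)"
  and metric_sym: "g r v w = g r w v"
  and metric_pos: "v \<noteq> 0 \<Longrightarrow> g r v v > 0"
  using metric unfolding riemannian_metric_def by blast+

lemmas metric_simps = bilinear_ladd[OF bilinear_metric] bilinear_radd[OF bilinear_metric]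
  bilinear_lsub[OF bilinear_metric] bilinear_rsub[OF bilinear_metric]
  bilinear_lmul[OF bilinear_metric] bilinear_rmul[OF bilinear_metric]
  bilinear_lneg[OF bilinear_metric] bilinear_rneg[OF bilinear_metric]
  bilinear_lzero[OF bilinear_metric] bilinear_rzero[OF bilinear_metric]

lemma smooth_metric:
  "open V \<Longrightarrow> smooth_field A V Y \<Longrightarrow> smooth_field A V Z \<Longrightarrow> smooth_fun A V (\<lambda>r. g r (Y r) (Z r))"
  using metric unfolding riemannian_metric_def by blast

lemma torsion_free:
  "open V \<Longrightarrow> smooth_field A V Y \<Longrightarrow> smooth_field A V Z \<Longrightarrow> r \<in> V \<Longrightarrow>
    cov nab Y Z r - cov nab Z Y r = lie_bracket A Y Z r"
  using levi_civita[unfolded levi_civita_def, THEN conjunct2, THEN conjunct1, rule_format, of V Y Z] by simp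

lemma metric_parallel:
  "open V \<Longrightarrow> smooth_field A V Y \<Longrightarrow> smooth_field A V Z \<Longrightarrow> r \<in> V \<Longrightarrow>
    dir_deriv A r v (\<lambda>q. g q (Y q) (Z q)) = g r (nab r v Y) (Z r) + g r (Y r) (nab r v Z)"
  using levi_civita[unfolded levi_civita_def, THEN conjunct2, THEN conjunct2, rule_format, of V Y Z] by simp

text \<open>In coordinates, \<open>D\<close> applied to a tangent field is a second derivative of
  the coordinate functions plus a Christoffel term. The latter is symmetric since coordinate fields
  commute at \<open>\<iota> p\<close>; the commutator of the former is the bracket.\<close>

lemma cov_along_torsion_free:
  assumes U: "open U" "p \<in> U" and X: "smooth_field B U X" and Y: "smooth_field B U Y"
  shows "D p (X p) (\<lambda>q. T q (Y q)) - D p (Y p) (\<lambda>q. T q (X q)) = T p (lie_bracket B X Y p)"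
proof -
  define d where "d = chart_at A (\<iota> p)"
  have d: "d \<in> A" "\<iota> p \<in> cdom d" unfolding d_def by (rule M.chart_at)+
  define N where "N = U \<inter> \<iota> -` cdom d"
  have N: "open N" "p \<in> N" "N \<subseteq> \<iota> -` cdom d" "N \<subseteq> U"
    using open_Int_preimage_cdom[OF U(1) d(1)] U d by (auto simp: N_def)
  note od = M.open_cdom[OF d(1)] and E = M.smooth_coord_field[OF d(1)]
  let ?x = "\<lambda>j q. coord d (\<iota> q) \<bullet> j"
  have x: "smooth_fun B N (?x j)" for j by (rule F.smooth_fun_subset[OF smooth_coord_pullback[OF d(1)] N(3)])
  have Tx: "dir_deriv B p v (?x j) = T p v \<bullet> j" for v j
    using components_differential[OF d, of v j] by (simp add: d_def M.components_chart_at)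
  have "cov nab (coord_field A d i) (coord_field A d j) (\<iota> p) = cov nab (coord_field A d j) (coord_field A d i) (\<iota> p)" for i j
    using torsion_free[OF od E[of i] E[of j] d(2)] M.lie_bracket_coord_fields[of "\<iota> p" i j] by (simp add: d_def)
  then have sym: "nab (\<iota> p) i (coord_field A d j) = nab (\<iota> p) j (coord_field A d i)" for i j
    by (simp add: cov_def d_def M.coord_field_chart_at)
  have nabd: "nab (\<iota> p) w (coord_field A d i) = (\<Sum>j\<in>Basis. (w \<bullet> j) *\<^sub>R nab (\<iota> p) j (coord_field A d i))" for w i
    by (rule linear_expansion_Basis[OF M.linear_nab[OF od E d(2)]])
  have "D p v (\<lambda>q. T q (Z q)) = (\<Sum>i\<in>Basis. dir_deriv B p v (\<lambda>q. dir_deriv B q (Z q) (?x i)) *\<^sub>R i)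
      + (\<Sum>i\<in>Basis. \<Sum>j\<in>Basis. ((T p (Z p) \<bullet> i) * (T p v \<bullet> j)) *\<^sub>R nab (\<iota> p) j (coord_field A d i))"
    if Z: "smooth_field B U Z" for v Z
  proof -
    have "dir_deriv B p v (\<lambda>q. components A d (\<iota> q) (T q (Z q)) \<bullet> i) =
        dir_deriv B p v (\<lambda>q. dir_deriv B q (Z q) (?x i))" for i
      by (rule F.dir_deriv_cong[OF N(1,2), symmetric])
        (use components_differential d(1) N F.smooth_dir_deriv[OF N(1) F.smooth_field_subset[OF Z N(4)] x] in auto)
    then show ?thesis
      using cov_along_eq[OF U smooth_along_differential[OF U(1) Z], of v]
      by (simp add: d_def[symmetric] sum.distrib nabd[of "T p v"] scaleR_sum_right)
  qed
  moreover have "(\<Sum>i\<in>Basis. \<Sum>j\<in>Basis. ((T p (Y p) \<bullet> i) * (T p (X p) \<bullet> j)) *\<^sub>R nab (\<iota> p) j (coord_field A d i))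
      = (\<Sum>i\<in>Basis. \<Sum>j\<in>Basis. ((T p (X p) \<bullet> i) * (T p (Y p) \<bullet> j)) *\<^sub>R nab (\<iota> p) j (coord_field A d i))"
    by (subst sum.swap, intro sum.cong refl) (simp add: sym mult.commute)
  ultimately have "D p (X p) (\<lambda>q. T q (Y q)) - D p (Y p) (\<lambda>q. T q (X q)) =
     (\<Sum>i\<in>Basis. (dir_deriv B p (X p) (\<lambda>q. dir_deriv B q (Y q) (?x i))
        - dir_deriv B p (Y p) (\<lambda>q. dir_deriv B q (X q) (?x i))) *\<^sub>R i)"
    using X Y by (simp add: scaleR_left_diff_distrib sum_subtractf)
  also have "\<dots> = (\<Sum>i\<in>Basis. (T p (lie_bracket B X Y p) \<bullet> i) *\<^sub>R i)"
    using F.dir_deriv_lie_bracket[OF N(1,2) F.smooth_field_subset[OF X N(4)] F.smooth_field_subset[OF Y N(4)] x] Tx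
    by simp
  finally show ?thesis by (simp only: euclidean_representation)
qed

section \<open>Metric compatibility along a map\<close>

text \<open>The product rule is bundled with smoothness because its transfer to equal fields and to
  sums compares directional derivatives, which needs the pairing to be smooth.\<close>

definition compatible_on :: "'q set \<Rightarrow> ('q \<Rightarrow> 'e) \<Rightarrow> ('q \<Rightarrow> 'e) \<Rightarrow> bool" where
  "compatible_on N W V \<longleftrightarrow> smooth_fun B N (\<lambda>q. g (\<iota> q) (W q) (V q)) \<and>
    (\<forall>q\<in>N. \<forall>v. dir_deriv B q v (\<lambda>q. g (\<iota> q) (W q) (V q)) =
      g (\<iota> q) (D q v W) (V q) + g (\<iota> q) (W q) (D q v V))"

lemma compatible_on_sym: "compatible_on N W V \<Longrightarrow> compatible_on N V W"
  unfolding compatible_on_def by (simp add: metric_sym[of "\<iota> _" "V _"] metric_sym[of "\<iota> _" "D _ _ V"] add.commute)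

lemma compatible_on_cong:
  assumes N: "open N" and W: "smooth_along N W" and eq: "\<And>q. q \<in> N \<Longrightarrow> W q = W' q" and c: "compatible_on N W V"
  shows "compatible_on N W' V"
proof -
  have e: "g (\<iota> q) (W q) (V q) = g (\<iota> q) (W' q) (V q)" if "q \<in> N" for q using eq[OF that] by simp
  have s: "smooth_fun B N (\<lambda>q. g (\<iota> q) (W q) (V q))" using c unfolding compatible_on_def by blast
  have "smooth_fun B N (\<lambda>q. g (\<iota> q) (W' q) (V q))" by (rule F.smooth_fun_cong[OF N e s])
  moreover have "dir_deriv B q v (\<lambda>q. g (\<iota> q) (W' q) (V q)) =
      g (\<iota> q) (D q v W') (V q) + g (\<iota> q) (W' q) (D q v V)" if "q \<in> N" for q v
    using F.dir_deriv_cong[OF N that e s, of v] c that eq[OF that] cov_along_cong[OF N that eq W, of v]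
    unfolding compatible_on_def by simp
  ultimately show ?thesis unfolding compatible_on_def by blast
qed

lemma compatible_on_add:
  assumes N: "open N" and W: "smooth_along N W" "smooth_along N W'" and c: "compatible_on N W V" "compatible_on N W' V"
  shows "compatible_on N (\<lambda>q. W q + W' q) V"
  using c F.smooth_fun_add[OF N, of "\<lambda>q. g (\<iota> q) (W q) (V q)" "\<lambda>q. g (\<iota> q) (W' q) (V q)"]
    F.dir_deriv_add[of _ N "\<lambda>q. g (\<iota> q) (W q) (V q)" "\<lambda>q. g (\<iota> q) (W' q) (V q)"]
    cov_along_add[OF N _ W]
  unfolding compatible_on_def by (simp add: metric_simps)

lemma compatible_on_generators:
  assumes d: "d \<in> A" and N: "open N" "N \<subseteq> \<iota> -` cdom d"
    and f: "smooth_fun B N f" "smooth_fun B N h" and Y: "smooth_field A (cdom d) Y" "smooth_field A (cdom d) Z"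
    and s: "smooth_along N (\<lambda>q. Y (\<iota> q))" "smooth_along N (\<lambda>q. Z (\<iota> q))"
  shows "compatible_on N (\<lambda>q. f q *\<^sub>R Y (\<iota> q)) (\<lambda>q. h q *\<^sub>R Z (\<iota> q))"
proof -
  note od = M.open_cdom[OF d]
  let ?G = "\<lambda>q. g (\<iota> q) (Y (\<iota> q)) (Z (\<iota> q))"
  note m = smooth_metric[OF od Y]
  have G: "smooth_fun B N ?G" by (rule F.smooth_fun_subset[OF smooth_fun_pullback[OF od m] N(2)])
  have dG: "dir_deriv B q v ?G = g (\<iota> q) (D q v (\<lambda>q. Y (\<iota> q))) (Z (\<iota> q)) + g (\<iota> q) (Y (\<iota> q)) (D q v (\<lambda>q. Z (\<iota> q)))"
    if "q \<in> N" for q v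
  proof -
    have q: "\<iota> q \<in> cdom d" using that N by auto
    show ?thesis
      using dir_deriv_pullback[OF od q m] metric_parallel[OF od Y q] cov_along_pullback[OF od q Y(1)]
        cov_along_pullback[OF od q Y(2)] by simp
  qed
  note fh = F.smooth_fun_mult[OF N(1) f]
  have e: "g (\<iota> q) (f q *\<^sub>R Y (\<iota> q)) (h q *\<^sub>R Z (\<iota> q)) = (f q * h q) * ?G q" for q
    by (simp add: metric_simps)
  have "dir_deriv B q v (\<lambda>q. (f q * h q) * ?G q) =
      g (\<iota> q) (D q v (\<lambda>q. f q *\<^sub>R Y (\<iota> q))) (h q *\<^sub>R Z (\<iota> q)) + g (\<iota> q) (f q *\<^sub>R Y (\<iota> q)) (D q v (\<lambda>q. h q *\<^sub>R Z (\<iota> q)))"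
    if q: "q \<in> N" for q v
    using F.dir_deriv_mult[OF q fh G, of v] F.dir_deriv_mult[OF q f, of v] dG[OF q, of v]
      cov_along_scaleR[OF N(1) q f(1) s(1), of v] cov_along_scaleR[OF N(1) q f(2) s(2), of v]
    by (simp add: metric_simps algebra_simps)
  then show ?thesis
    unfolding compatible_on_def e using F.smooth_fun_mult[OF N(1) fh G] by blast
qed

lemma compatible:
  assumes U: "open U" and W: "smooth_along U W" and V: "smooth_along U V"
  shows "smooth_fun B U (\<lambda>q. g (\<iota> q) (W q) (V q))"
    and "p \<in> U \<Longrightarrow> dir_deriv B p v (\<lambda>q. g (\<iota> q) (W q) (V q)) = g (\<iota> p) (D p v W) (V p) + g (\<iota> p) (W p) (D p v V)"
proof -
  have "\<exists>N. open N \<and> p \<in> N \<and> compatible_on N W V" if p: "p \<in> U" for p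
  proof -
    define d where "d = chart_at A (\<iota> p)"
    have d: "d \<in> A" "\<iota> p \<in> cdom d" unfolding d_def by (rule M.chart_at)+
    define N where "N = U \<inter> \<iota> -` cdom d"
    have N: "open N" "p \<in> N" "N \<subseteq> \<iota> -` cdom d" "N \<subseteq> U"
      using open_Int_preimage_cdom[OF U d(1)] p d by (auto simp: N_def)
    \<comment> \<open>The induction treats one slot at a time: here it runs over \<open>V\<close>
      against a fixed generator, and the next one runs over \<open>W\<close> with \<open>V\<close>
      arbitrary.\<close>
    have gen: "compatible_on N (\<lambda>q. f q *\<^sub>R Y (\<iota> q)) V" if f: "smooth_fun B N f" and Y: "smooth_field A (cdom d) Y"
      and s: "smooth_along N (\<lambda>q. Y (\<iota> q))" for f Y
    proof (rule compatible_on_sym)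
      show "compatible_on N V (\<lambda>q. f q *\<^sub>R Y (\<iota> q))"
        using d(1) N(1,3) smooth_along_subset[OF V N(4)]
      proof (induction rule: smooth_along_induct)
        case (cong V V')
        show ?case by (rule compatible_on_cong[OF N(1) cong])
      next
        case (add V V')
        show ?case by (rule compatible_on_add[OF N(1) add])
      next
        case (generator h Z)
        show ?case by (rule compatible_on_generators[OF d(1) N(1,3) generator(1) f generator(2) Y generator(3) s])
      qed
    qed
    have "compatible_on N W V"
      using d(1) N(1,3) smooth_along_subset[OF W N(4)]
    proof (induction rule: smooth_along_induct)
      case (cong W W')
      show ?case by (rule compatible_on_cong[OF N(1) cong])
    next
      case (add W W')
      show ?case by (rule compatible_on_add[OF N(1) add])
    next
      case (generator f Y)
      show ?case by (rule gen[OF generator])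
    qed
    with N show ?thesis by blast
  qed
  note * = this
  show "smooth_fun B U (\<lambda>q. g (\<iota> q) (W q) (V q))"
    by (rule F.smooth_fun_local) (use *[unfolded compatible_on_def] in blast)
  show "p \<in> U \<Longrightarrow> dir_deriv B p v (\<lambda>q. g (\<iota> q) (W q) (V q)) = g (\<iota> p) (D p v W) (V p) + g (\<iota> p) (W p) (D p v V)"
    using * unfolding compatible_on_def by blast
qed

end

section \<open>The equations of Gauss and Codazzi\<close>

text \<open>The sum is the Riesz representative of \<open>f\<close>; it is used to construct the
  orthogonal projection.\<close>

lemma inner_sum_Basis:
  fixes f :: "'a::euclidean_space \<Rightarrow> real"
  assumes "linear f" shows "(\<Sum>i\<in>Basis. f i *\<^sub>R i) \<bullet> b = f b"
  using linear_expansion_Basis[OF assms, of b]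
  by (simp add: inner_sum_left inner_commute[of b] mult.commute)

section \<open>Isometric immersions and the Gauss formula\<close>

locale isometric_immersion = riemannian_map A nab B \<iota> g
  for A :: "('p::topological_space, 'e::euclidean_space) chart set"
    and nab :: "'p \<Rightarrow> 'e \<Rightarrow> ('p \<Rightarrow> 'e) \<Rightarrow> 'e"
    and B :: "('q::topological_space, 'f::euclidean_space) chart set"
    and \<iota> :: "'q \<Rightarrow> 'p" and g +
  fixes nabF :: "'q \<Rightarrow> 'f \<Rightarrow> ('q \<Rightarrow> 'f) \<Rightarrow> 'f"
  assumes inj_differential: "inj (T p)"
    and levi_civita_F: "levi_civita B (induced_metric B A g \<iota>) nabF"
begin

sublocale F: affine_manifold B nabF
  by unfold_locales (use levi_civita_F in \<open>simp add: levi_civita_def\<close>)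

lemmas T_simps = linear_add[OF linear_differential] linear_diff[OF linear_differential]
  linear_scale[OF linear_differential] linear_0[OF linear_differential] linear_neg[OF linear_differential]

lemma torsion_free_F:
  "open U \<Longrightarrow> smooth_field B U Y \<Longrightarrow> smooth_field B U Z \<Longrightarrow> q \<in> U \<Longrightarrow>
    lie_bracket B Y Z q = cov nabF Y Z q - cov nabF Z Y q"
  using levi_civita_F[unfolded levi_civita_def, THEN conjunct2, THEN conjunct1, rule_format, of U Y Z] by simp

lemma metric_parallel_F:
  "open U \<Longrightarrow> smooth_field B U Y \<Longrightarrow> smooth_field B U Z \<Longrightarrow> q \<in> U \<Longrightarrow>
    dir_deriv B q v (\<lambda>r. g (\<iota> r) (T r (Y r)) (T r (Z r))) =
      g (\<iota> q) (T q (nabF q v Y)) (T q (Z q)) + g (\<iota> q) (T q (Y q)) (T q (nabF q v Z))"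
  using levi_civita_F[unfolded levi_civita_def induced_metric_def, THEN conjunct2, THEN conjunct2,
      rule_format, of U Y Z] by simp

text \<open>The second fundamental form by the Gauss formula, with a vector instead of a field as first argument.\<close>

definition second_form :: "'q \<Rightarrow> 'f \<Rightarrow> ('q \<Rightarrow> 'f) \<Rightarrow> 'e" where
  "second_form p v Y = D p v (\<lambda>q. T q (Y q)) - T p (nabF p v Y)"

lemma linear_second_form:
  assumes "open U" "smooth_field B U Y" "p \<in> U" shows "linear (\<lambda>v. second_form p v Y)"
  unfolding second_form_def
  by (intro linear_compose_sub linear_cov_along[OF assms(1,3) smooth_along_differential[OF assms(1,2)]]
      linear_compose[OF F.linear_nab[OF assms] linear_differential, unfolded o_def])

lemma smooth_along_diff:
  assumes "open U" "smooth_along U W" "smooth_along U W'"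
  shows "smooth_along U (\<lambda>q. W q - W' q)"
  using smooth_along_add[OF assms(1,2) smooth_along_scaleR[OF assms(1) F.smooth_fun_const[of _ "-1"] assms(3)]]
  by simp

lemma smooth_second_form:
  assumes U: "open U" and X: "smooth_field B U X" and Y: "smooth_field B U Y"
  shows "smooth_along U (\<lambda>q. second_form q (X q) Y)"
  unfolding second_form_def
  using smooth_along_diff[OF U smooth_cov_along[OF U X smooth_along_differential[OF U Y]]
    smooth_along_differential[OF U F.smooth_cov[OF U X Y]]] unfolding cov_def .

lemma second_form_sym:
  assumes "open U" "p \<in> U" "smooth_field B U X" "smooth_field B U Y"
  shows "second_form p (X p) Y = second_form p (Y p) X"
  using cov_along_torsion_free[OF assms] torsion_free_F[OF assms(1,3,4,2)]
  unfolding second_form_def cov_def by (simp add: T_simps algebra_simps)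

text \<open>Both connections satisfy a product rule for the same function, the induced inner product
  of \<open>Y\<close> and \<open>Z\<close>; subtracting them leaves the terms with
  \<open>second_form\<close>.\<close>

lemma second_form_antisym:
  assumes U: "open U" "p \<in> U" and Y: "smooth_field B U Y" and Z: "smooth_field B U Z"
  shows "g (\<iota> p) (second_form p v Y) (T p (Z p)) = - g (\<iota> p) (T p (Y p)) (second_form p v Z)"
  using compatible(2)[OF U(1) smooth_along_differential[OF U(1) Y] smooth_along_differential[OF U(1) Z] U(2), of v]
    metric_parallel_F[OF U(1) Y Z U(2), of v]
  unfolding second_form_def by (simp add: metric_simps)

text \<open>All notions quantify over fields on open sets, so a local coordinate field with constant
  components is a sufficient extension.\<close>

lemma extend_vector:
  assumes "open U" "p \<in> U"
  obtains N X where "open N" "p \<in> N" "N \<subseteq> U" "smooth_field B N X" "X p = v"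
proof
  let ?c = "chart_at B p"
  show "open (U \<inter> cdom ?c)" "p \<in> U \<inter> cdom ?c" "U \<inter> cdom ?c \<subseteq> U"
    using assms F.open_cdom F.chart_at by auto
  show "smooth_field B (U \<inter> cdom ?c) (coord_field B ?c v)"
    by (rule F.smooth_field_subset[OF F.smooth_coord_field[OF F.chart_at(1)]]) auto
  show "coord_field B ?c v p = v" by (rule F.coord_field_chart_at)
qed

text \<open>A trilinear form that is symmetric in its first two and antisymmetric in its last two
  arguments vanishes; this is the uniqueness of the Levi-Civita connection.\<close>

lemma metric_second_form_tangent:
  assumes U: "open U" "p \<in> U" and Y: "smooth_field B U Y"
  shows "g (\<iota> p) (second_form p v Y) (T p w) = 0"
proof -
  obtain N X where N: "open N" "p \<in> N" "N \<subseteq> U" and X: "smooth_field B N X" "X p = v"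
    using extend_vector[OF U] by blast
  obtain N' Z where N': "open N'" "p \<in> N'" "N' \<subseteq> N" and Z: "smooth_field B N' Z" "Z p = w"
    using extend_vector[OF N(1,2)] by blast
  note X' = F.smooth_field_subset[OF X(1) N'(3)]
  have Y': "smooth_field B N' Y" by (rule F.smooth_field_subset[OF Y]) (use N N' in auto)
  let ?t = "\<lambda>X Y Z. g (\<iota> p) (second_form p (X p) Y) (T p (Z p))"
  have s: "?t X Y Z = ?t Y X Z" if "smooth_field B N' X" "smooth_field B N' Y" for X Y Z
    using second_form_sym[OF N'(1,2) that] by simp
  have a: "?t X Y Z = - ?t X Z Y" if "smooth_field B N' Y" "smooth_field B N' Z" for X Y Z
    using second_form_antisym[OF N'(1,2) that] by (simp add: metric_sym)
  \<comment> \<open>Swapping the last two and the first two arguments alternately, six times in all,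
    returns to the initial order; the three swaps of the last two each contribute a sign.\<close>
  have "?t X Y Z = - ?t X Y Z"
    using a[OF Y' Z(1), of X] s[OF X' Z(1), of Y] a[OF X' Y', of Z] s[OF Z(1) Y', of X]
      a[OF Z(1) X', of Y] s[OF Y' X', of Z] by simp
  then show ?thesis using X Z by simp
qed

section \<open>Normal vectors and the orthogonal decomposition\<close>

definition normal :: "'q \<Rightarrow> 'e \<Rightarrow> bool" where
  "normal p \<xi> \<longleftrightarrow> (\<forall>v. g (\<iota> p) \<xi> (T p v) = 0)"

lemma normal_second_form: "open U \<Longrightarrow> p \<in> U \<Longrightarrow> smooth_field B U Y \<Longrightarrow> normal p (second_form p v Y)"
  unfolding normal_def using metric_second_form_tangent by blast

lemma normal_simps:
  "normal p \<xi> \<Longrightarrow> g (\<iota> p) \<xi> (T p v) = 0" "normal p \<xi> \<Longrightarrow> g (\<iota> p) (T p v) \<xi> = 0"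
  unfolding normal_def by (auto simp: metric_sym[of _ "T p v"])

lemma normal_diff: "normal p \<xi> \<Longrightarrow> normal p \<eta> \<Longrightarrow> normal p (\<xi> - \<eta>)"
  and normal_scaleR: "normal p \<xi> \<Longrightarrow> normal p (a *\<^sub>R \<xi>)"
  unfolding normal_def by (auto simp: metric_simps)

lemma metric_eq_0: "g r v v = 0 \<Longrightarrow> v = 0"
  using metric_pos[of v r] by force

text \<open>Two candidates differ by a vector that is both tangent and normal, hence zero by
  positivity. This discharges the definite description.\<close>

lemma normal_part_eqI:
  assumes "normal p \<xi>" "w = T p a + \<xi>" shows "normal_part B A g \<iota> p w = \<xi>"
  unfolding normal_part_def
proof (rule the_equality)
  show "\<xi> \<in> normal_space B A g \<iota> p \<and> w - \<xi> \<in> range (T p)"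
    using assms by (auto simp: normal_def normal_space_def)
  fix \<eta> assume \<eta>: "\<eta> \<in> normal_space B A g \<iota> p \<and> w - \<eta> \<in> range (T p)"
  then obtain b where b: "w - \<eta> = T p b" by auto
  have n: "normal p (\<xi> - \<eta>)" using \<eta> assms by (intro normal_diff) (auto simp: normal_def normal_space_def)
  have "\<xi> - \<eta> = T p (b - a)" using b assms by (simp add: T_simps algebra_simps)
  then show "\<eta> = \<xi>" using metric_eq_0[of "\<iota> p" "\<xi> - \<eta>"] normal_simps(1)[OF n, of "b - a"] by simp
qed

text \<open>\<open>L\<close> is the Gram operator of the induced inner product. It is injective by
  positivity and injectivity of the differential, hence surjective in finite dimension, so the
  normal equations for the tangent part have a solution.\<close>

lemma normal_decomposition:
  obtains a \<xi> where "w = T p a + \<xi>" "normal p \<xi>"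
proof -
  define L where "L a = (\<Sum>i\<in>Basis. g (\<iota> p) (T p a) (T p i) *\<^sub>R i)" for a
  have L_inner: "L a \<bullet> b = g (\<iota> p) (T p a) (T p b)" for a b
  proof -
    have l: "linear (\<lambda>b. g (\<iota> p) (T p a) (T p b))"
      by (rule linearI) (simp_all add: T_simps metric_simps)
    show ?thesis unfolding L_def by (rule inner_sum_Basis[OF l])
  qed
  have lin: "linear L"
    unfolding L_def by (rule linearI) (simp_all add: T_simps metric_simps scaleR_add_left sum.distrib scaleR_sum_right)
  have "inj L"
  proof (rule linear_injective_0[OF lin, THEN iffD2], intro allI impI)
    fix a assume "L a = 0"
    then have "g (\<iota> p) (T p a) (T p a) = 0" using L_inner[of a a] by simp
    then have "T p a = T p 0" using metric_eq_0 by (simp add: T_simps)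
    then show "a = 0" using inj_differential injD by metis
  qed
  then have "surj L" by (rule linear_inj_imp_surj[OF lin])
  then obtain a where a: "L a = (\<Sum>i\<in>Basis. g (\<iota> p) w (T p i) *\<^sub>R i)" by (metis surjD)
  have "normal p (w - T p a)"
    unfolding normal_def
  proof
    fix b
    have l: "linear (\<lambda>b. g (\<iota> p) w (T p b))" by (rule linearI) (simp_all add: T_simps metric_simps)
    have "g (\<iota> p) w (T p b) = L a \<bullet> b"
      unfolding a by (rule inner_sum_Basis[OF l, symmetric])
    then show "g (\<iota> p) (w - T p a) (T p b) = 0" by (simp add: L_inner metric_simps)
  qed
  then show ?thesis by (intro that[of a "w - T p a"]) auto
qed

text \<open>Tangent parts are invisible to normal test vectors; this removes the projection wherever
  the metric is applied.\<close>

lemma metric_normal_part: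
  assumes "normal p \<xi>" shows "g (\<iota> p) (normal_part B A g \<iota> p w) \<xi> = g (\<iota> p) w \<xi>"
proof -
  obtain a \<eta> where "w = T p a + \<eta>" "normal p \<eta>" by (rule normal_decomposition)
  then show ?thesis using normal_part_eqI normal_simps(2)[OF assms] by (simp add: metric_simps)
qed

lemma second_fundamental_form_eq:
  assumes "open U" "p \<in> U" "smooth_field B U Y"
  shows "second_fundamental_form B A g nab \<iota> X Y p = second_form p (X p) Y"
  unfolding second_fundamental_form_def
  by (rule normal_part_eqI[OF normal_second_form[OF assms]]) (simp add: second_form_def)

section \<open>The Weingarten formula and the structure equations\<close>

text \<open>Differentiate the vanishing pairing of \<xi> with a tangent field. The tangent part of
  the derivative of \<xi> is thus expressed by \<open>b\<close> itself, without a shape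
  operator.\<close>

lemma weingarten:
  assumes U: "open U" "p \<in> U" and \<xi>: "smooth_along U \<xi>" "\<And>q. q \<in> U \<Longrightarrow> normal q (\<xi> q)"
    and Z: "smooth_field B U Z"
  shows "g (\<iota> p) (D p v \<xi>) (T p (Z p)) = - g (\<iota> p) (\<xi> p) (second_form p v Z)"
proof -
  have "dir_deriv B p v (\<lambda>q. g (\<iota> q) (\<xi> q) (T q (Z q))) = dir_deriv B p v (\<lambda>q. 0)"
    by (rule F.dir_deriv_cong[OF U]) (use normal_simps(1)[OF \<xi>(2)] compatible(1)[OF U(1) \<xi>(1) smooth_along_differential[OF U(1) Z]] in auto)
  then have "g (\<iota> p) (D p v \<xi>) (T p (Z p)) + g (\<iota> p) (\<xi> p) (D p v (\<lambda>q. T q (Z q))) = 0"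
    using compatible(2)[OF U(1) \<xi>(1) smooth_along_differential[OF U(1) Z] U(2), of v] F.dir_deriv_const by simp
  then show ?thesis
    using normal_simps(1)[OF \<xi>(2)[OF U(2)]] by (simp add: second_form_def metric_simps)
qed

text \<open>The van der Waerden-Bortolotti derivative of \<open>b\<close> before the projection to the normal space.\<close>

definition cov_second_form :: "('q \<Rightarrow> 'f) \<Rightarrow> ('q \<Rightarrow> 'f) \<Rightarrow> ('q \<Rightarrow> 'f) \<Rightarrow> 'q \<Rightarrow> 'e" where
  "cov_second_form X Y Z p = D p (X p) (\<lambda>q. second_form q (Y q) Z) - second_form p (cov nabF X Y p) Z - second_form p (Y p) (cov nabF X Z)"

lemma metric_vdWB:
  assumes U: "open U" "p \<in> U" and X: "smooth_field B U X" and Y: "smooth_field B U Y" and Z: "smooth_field B U Z"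
    and \<xi>: "normal p \<xi>"
  shows "g (\<iota> p) (vdWB_derivative B A g nab nabF \<iota> X Y Z p) \<xi> = g (\<iota> p) (cov_second_form X Y Z p) \<xi>"
proof -
  have "D p (X p) (\<lambda>q. second_form q (Y q) Z) = D p (X p) (second_fundamental_form B A g nab \<iota> Y Z)"
    by (rule cov_along_cong[OF U _ smooth_second_form[OF U(1) Y Z]]) (simp add: second_fundamental_form_eq[OF U(1) _ Z])
  then show ?thesis
    unfolding vdWB_derivative_def Let_def normal_connection_def cov_second_form_def
    by (simp add: metric_simps metric_normal_part[OF \<xi>] second_fundamental_form_eq[OF U Z]
        second_fundamental_form_eq[OF U F.smooth_cov[OF U(1) X Z]])
qed

text \<open>Differentiating the Gauss formula once more gives the terms on the right, up to the
  bracket, which torsion-freeness rewrites by covariant derivatives. Both equations are contained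
  here, before any projection: pairing with tangent vectors gives Gauss, with normal vectors
  Codazzi.\<close>

lemma gauss_codazzi:
  assumes U: "open U" "p \<in> U" and X: "smooth_field B U X" and Y: "smooth_field B U Y" and Z: "smooth_field B U Z"
  shows "along_curvature X Y (\<lambda>q. T q (Z q)) p =
    T p (curvature B nabF X Y Z p) + (cov_second_form X Y Z p - cov_second_form Y X Z p)"
proof -
  have DD: "D p v (\<lambda>q. D q (S q) (\<lambda>q. T q (Z q))) =
      T p (nabF p v (cov nabF S Z)) + second_form p v (cov nabF S Z) + D p v (\<lambda>q. second_form q (S q) Z)"
    if S: "smooth_field B U S" for S v
  proof -
    have "D p v (\<lambda>q. D q (S q) (\<lambda>q. T q (Z q))) = D p v (\<lambda>q. T q (cov nabF S Z q) + second_form q (S q) Z)"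
      by (rule cov_along_cong[OF U _ smooth_cov_along[OF U(1) S smooth_along_differential[OF U(1) Z]]])
        (simp add: second_form_def cov_def)
    also have "\<dots> = D p v (\<lambda>q. T q (cov nabF S Z q)) + D p v (\<lambda>q. second_form q (S q) Z)"
      by (rule cov_along_add[OF U smooth_along_differential[OF U(1) F.smooth_cov[OF U(1) S Z]] smooth_second_form[OF U(1) S Z]])
    finally show ?thesis by (simp add: second_form_def[of p v "cov nabF S Z"])
  qed
  have L: "D p (lie_bracket B X Y p) (\<lambda>q. T q (Z q)) =
      T p (nabF p (lie_bracket B X Y p) Z) + second_form p (cov nabF X Y p) Z - second_form p (cov nabF Y X p) Z"
    unfolding torsion_free_F[OF U(1) X Y U(2)]
    using linear_diff[OF linear_second_form[OF U(1) Z U(2)], of "cov nabF X Y p" "cov nabF Y X p"] by (simp add: second_form_def algebra_simps)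
  show ?thesis
    unfolding along_curvature_def DD[OF X] DD[OF Y] L cov_second_form_def curvature_def
    by (simp add: T_simps cov_def algebra_simps)
qed

text \<open>The two correction terms of \<open>cov_second_form\<close> are normal and drop out
  against a tangent vector; the Weingarten formula turns what remains into products of values of
  \<open>b\<close>.\<close>

lemma gauss_equation:
  assumes U: "open U" "p \<in> U" and X: "smooth_field B U X" and Y: "smooth_field B U Y" and Z: "smooth_field B U Z"
    and W: "smooth_field B U W"
  shows "g (\<iota> p) (T p (curvature B nabF X Y Z p)) (T p (W p)) =
    g (\<iota> p) (along_curvature X Y (\<lambda>q. T q (Z q)) p) (T p (W p))
    + g (\<iota> p) (second_form p (Y p) Z) (second_form p (X p) W) - g (\<iota> p) (second_form p (X p) Z) (second_form p (Y p) W)"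
proof -
  have "g (\<iota> p) (cov_second_form R S Z p) (T p (W p)) = - g (\<iota> p) (second_form p (S p) Z) (second_form p (R p) W)"
    if R: "smooth_field B U R" and S: "smooth_field B U S" for R S
    unfolding cov_second_form_def
    using weingarten[OF U smooth_second_form[OF U(1) S Z] normal_second_form[OF U(1) _ Z] W, of "R p"]
    by (simp add: metric_simps metric_second_form_tangent[OF U Z] metric_second_form_tangent[OF U F.smooth_cov[OF U(1) R Z]])
  then show ?thesis
    unfolding gauss_codazzi[OF U X Y Z] using X Y by (simp add: metric_simps)
qed

end

section \<open>Kaehler submanifolds of complex space forms\<close>

locale kaehler_immersion = isometric_immersion A nab B \<iota> g nabF
  for A :: "('p::topological_space, 'e::euclidean_space) chart set"
    and nab :: "'p \<Rightarrow> 'e \<Rightarrow> ('p \<Rightarrow> 'e) \<Rightarrow> 'e"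
    and B :: "('q::topological_space, 'f::euclidean_space) chart set"
    and \<iota> :: "'q \<Rightarrow> 'p" and g and nabF +
  fixes J :: "'p \<Rightarrow> 'e \<Rightarrow> 'e" and c :: real
  assumes kaehler: "kaehler_manifold A g J nab"
    and hol: "constant_holomorphic_curvature A g J nab c"
    and J_tangent: "J (\<iota> p) (T p v) \<in> range (T p)"
begin

section \<open>The complex structure along the immersion\<close>

lemma linear_J: "linear (J r)" and J_J: "J r (J r v) = - v"
  and smooth_J: "open V \<Longrightarrow> smooth_field A V Y \<Longrightarrow> smooth_field A V (\<lambda>r. J r (Y r))"
  using kaehler unfolding kaehler_manifold_def almost_complex_structure_def by blast+

lemma metric_J: "g r (J r v) (J r w) = g r v w"
  using kaehler unfolding kaehler_manifold_def by blast

lemma J_parallel: "open V \<Longrightarrow> smooth_field A V Y \<Longrightarrow> r \<in> V \<Longrightarrow> nab r w (\<lambda>r. J r (Y r)) = J r (nab r w Y)"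
  using kaehler[unfolded kaehler_manifold_def] right_minus_eq by metis

lemmas J_simps = linear_add[OF linear_J] linear_scale[OF linear_J] linear_diff[OF linear_J]
  linear_neg[OF linear_J]

lemma metric_J_left: "g r (J r v) w = - g r v (J r w)"
  using metric_J[of r "J r v" w] by (simp add: J_J metric_simps)

lemma metric_J_self: "g r v (J r v) = 0"
  using metric_J_left[of r v v] metric_sym[of r v "J r v"] by simp

lemma smooth_along_J: "open U \<Longrightarrow> smooth_along U W \<Longrightarrow> smooth_along U (\<lambda>q. J (\<iota> q) (W q))"
  by (rule cov_along_tensor(1)[where J = J, OF linear_J], erule (1) smooth_J, erule (2) J_parallel)

lemma cov_along_J:
  "open U \<Longrightarrow> smooth_along U W \<Longrightarrow> p \<in> U \<Longrightarrow> D p v (\<lambda>q. J (\<iota> q) (W q)) = J (\<iota> p) (D p v W)"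
  by (rule cov_along_tensor(2)[where J = J, OF linear_J], erule (1) smooth_J, erule (2) J_parallel)

text \<open>\<open>J\<close> is skew for the metric and preserves the tangent spaces, hence also
  their orthogonal complements.\<close>

lemma normal_J: "normal p \<xi> \<Longrightarrow> normal p (J (\<iota> p) \<xi>)"
  unfolding normal_def metric_J_left using J_tangent by (metis neg_equal_0_iff_equal rangeE)

text \<open>Depends on vectors at one point instead of fields, so that it can serve as the trilinear
  map \<open>K\<close> in \<open>along_curvature_eq\<close>.\<close>

definition space_form_tensor :: "'p \<Rightarrow> 'e \<Rightarrow> 'e \<Rightarrow> 'e \<Rightarrow> 'e" where
  "space_form_tensor r x y z = (c / 4) *\<^sub>R (g r y z *\<^sub>R x - g r x z *\<^sub>R y + g r (J r y) z *\<^sub>R J r x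
     - g r (J r x) z *\<^sub>R J r y + (2 * g r x (J r y)) *\<^sub>R J r z)"

lemma along_curvature_differential:
  assumes U: "open U" "p \<in> U" and X: "smooth_field B U X" and Y: "smooth_field B U Y" and Z: "smooth_field B U Z"
  shows "along_curvature X Y (\<lambda>q. T q (Z q)) p = space_form_tensor (\<iota> p) (T p (X p)) (T p (Y p)) (T p (Z p))"
proof (rule along_curvature_eq[OF U X Y smooth_along_differential[OF U(1) Z]])
  show "curvature A nab X Y Z (\<iota> p) = space_form_tensor (\<iota> p) (X (\<iota> p)) (Y (\<iota> p)) (Z (\<iota> p))"
    if "open V" "smooth_field A V X" "smooth_field A V Y" "smooth_field A V Z" "\<iota> p \<in> V" for V X Y Z
    using hol[unfolded constant_holomorphic_curvature_def, rule_format, of V X Y Z "\<iota> p"] that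
    unfolding space_form_tensor_def by simp
qed (unfold space_form_tensor_def, (rule linearI; simp add: metric_simps J_simps algebra_simps)+)

lemma metric_cov_second_form_sym:
  assumes U: "open U" "p \<in> U" and X: "smooth_field B U X" and Y: "smooth_field B U Y" and Z: "smooth_field B U Z"
    and \<xi>: "normal p \<xi>"
  shows "g (\<iota> p) (cov_second_form X Y Z p) \<xi> = g (\<iota> p) (cov_second_form Y X Z p) \<xi>"
proof -
  have J: "g (\<iota> p) (J (\<iota> p) (T p v)) \<xi> = 0" for v
    using J_tangent[of p v] normal_simps(2)[OF \<xi>] by auto
  have "g (\<iota> p) (along_curvature X Y (\<lambda>q. T q (Z q)) p) \<xi> = 0"
    unfolding along_curvature_differential[OF U X Y Z] space_form_tensor_def
    by (simp add: metric_simps J normal_simps(2)[OF \<xi>])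
  then show ?thesis
    unfolding gauss_codazzi[OF U X Y Z] by (simp add: metric_simps normal_simps(2)[OF \<xi>])
qed

text \<open>Tested against a normal field \<open>\<xi>\<close>, the equation \<open>b(V, JX) = J b(V, X)\<close> only involves derivatives
  of \<open>\<xi>\<close>, so \<open>X'\<close> has to extend \<open>JX\<close> at one point only, and the smoothness of \<open>J\<close> on the
  submanifold is not an issue. The fields \<open>b(V, X')\<close> and \<open>J b(V, X)\<close> suffice as test fields.\<close>

lemma second_form_J:
  assumes U: "open U" "p \<in> U" and V: "smooth_field B U V" and X: "smooth_field B U X" and X': "smooth_field B U X'"
    and eq: "T p (X' p) = J (\<iota> p) (T p (X p))"
  shows "second_form p (V p) X' = J (\<iota> p) (second_form p (V p) X)"
proof -
  have *: "g (\<iota> p) (\<xi> p) (second_form p (V p) X') = g (\<iota> p) (\<xi> p) (J (\<iota> p) (second_form p (V p) X))"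
    if \<xi>: "smooth_along U \<xi>" "\<And>q. q \<in> U \<Longrightarrow> normal q (\<xi> q)" for \<xi>
  proof -
    have "- g (\<iota> p) (\<xi> p) (second_form p (V p) X') = g (\<iota> p) (D p (V p) \<xi>) (J (\<iota> p) (T p (X p)))"
      using weingarten[OF U \<xi> X', of "V p"] eq by simp
    also have "\<dots> = - g (\<iota> p) (D p (V p) (\<lambda>q. J (\<iota> q) (\<xi> q))) (T p (X p))"
      using cov_along_J[OF U(1) \<xi>(1) U(2), of "V p"] by (simp add: metric_J_left)
    also have "\<dots> = g (\<iota> p) (J (\<iota> p) (\<xi> p)) (second_form p (V p) X)"
      using weingarten[OF U smooth_along_J[OF U(1) \<xi>(1)] normal_J[OF \<xi>(2)] X, of "V p"] by simp
    finally show ?thesis by (simp add: metric_J_left)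
  qed
  let ?u = "second_form p (V p) X' - J (\<iota> p) (second_form p (V p) X)"
  have "g (\<iota> p) (second_form p (V p) X') ?u = 0"
    using *[OF smooth_second_form[OF U(1) V X'] normal_second_form[OF U(1) _ X']] by (simp add: metric_simps)
  moreover have "g (\<iota> p) (J (\<iota> p) (second_form p (V p) X)) ?u = 0"
    using *[OF smooth_along_J[OF U(1) smooth_second_form[OF U(1) V X]] normal_J[OF normal_second_form[OF U(1) _ X]]]
    by (simp add: metric_simps)
  ultimately have "g (\<iota> p) ?u ?u = 0" by (simp add: metric_simps)
  then have "?u = 0" by (rule metric_eq_0)
  then show ?thesis by simp
qed

section \<open>From recurrence to parallelism\<close>

lemma recurrent_imp_parallel:
  assumes rec: "\<And>U X Y Z p. open U \<Longrightarrow> smooth_field B U X \<Longrightarrow> smooth_field B U Y \<Longrightarrow> smooth_field B U Z \<Longrightarrow> p \<in> U \<Longrightarrow>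
      vdWB_derivative B A g nab nabF \<iota> X Y Z p = \<mu> p (X p) *\<^sub>R second_fundamental_form B A g nab \<iota> Y Z p"
    and U: "open U" "p \<in> U" and X: "smooth_field B U X" and Y: "smooth_field B U Y" and Z: "smooth_field B U Z"
    and \<xi>: "normal p \<xi>"
  shows "g (\<iota> p) (cov_second_form X Y Z p) \<xi> = 0"
proof -
  have D: "g (\<iota> p) (cov_second_form X Y Z p) \<xi> = g (\<iota> p) (\<mu> p (X p) *\<^sub>R second_form p (Y p) Z) \<xi>"
    if "open U" "p \<in> U" "smooth_field B U X" "smooth_field B U Y" "smooth_field B U Z" "normal p \<xi>" for U X Y Z \<xi>
    using metric_vdWB[OF that] rec[OF that(1,3,4,5,2)] second_fundamental_form_eq[OF that(1,2,5), of Y] by simp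
  have sym: "\<mu> p (X p) *\<^sub>R second_form p (Y p) Z = \<mu> p (Y p) *\<^sub>R second_form p (X p) Z"
    if h: "open U" "p \<in> U" "smooth_field B U X" "smooth_field B U Y" "smooth_field B U Z" for U X Y Z
  proof -
    \<comment> \<open>The difference is itself normal, so it can be its own test vector, and
      positivity turns the tested equation into an equation of vectors.\<close>
    let ?u = "\<mu> p (X p) *\<^sub>R second_form p (Y p) Z - \<mu> p (Y p) *\<^sub>R second_form p (X p) Z"
    have n: "normal p ?u" by (intro normal_diff normal_scaleR normal_second_form[OF h(1,2,5)])
    have "g (\<iota> p) ?u ?u = 0"
      using metric_cov_second_form_sym[OF h n] D[OF h n] D[OF h(1,2,4,3,5) n]
      by (subst bilinear_lsub[OF bilinear_metric]) simp
    then show ?thesis using metric_eq_0 by force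
  qed
  \<comment> \<open>\<open>u\<close> represents \<open>J X\<close> in the tangent space of the
    submanifold. The identities below are evaluated at \<open>p\<close> alone, so any local field
    with this value will do.\<close>
  obtain u where u: "T p u = J (\<iota> p) (T p (X p))" using J_tangent[of p "X p"] by (metis rangeE)
  obtain N X' where N: "open N" "p \<in> N" "N \<subseteq> U" and X': "smooth_field B N X'" "X' p = u"
    using extend_vector[OF U] by blast
  note s = X[THEN F.smooth_field_subset, OF N(3)] Y[THEN F.smooth_field_subset, OF N(3)]
    Z[THEN F.smooth_field_subset, OF N(3)]
  let ?b = "second_form p (Y p) Z"
  have "\<mu> p (X' p) *\<^sub>R ?b = \<mu> p (Y p) *\<^sub>R second_form p (X' p) Z"
    by (rule sym[OF N(1,2) X'(1) s(2,3)])
  also have "second_form p (X' p) Z = J (\<iota> p) (second_form p (X p) Z)"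
    \<comment> \<open>\<open>second_form_J\<close> has \<open>J\<close> in the differentiated slot,
      so symmetry of \<open>b\<close> exchanges the arguments on both sides.\<close>
    unfolding second_form_sym[OF N(1,2) X'(1) s(3)] second_form_sym[OF N(1,2) s(1,3)]
    by (rule second_form_J[OF N(1,2) s(3,1) X'(1)]) (simp add: X' u)
  also have "\<mu> p (Y p) *\<^sub>R J (\<iota> p) (second_form p (X p) Z) = J (\<iota> p) (\<mu> p (X p) *\<^sub>R ?b)"
    unfolding sym[OF U X Y Z] by (simp add: J_simps)
  finally have "\<mu> p (X' p) *\<^sub>R ?b = \<mu> p (X p) *\<^sub>R J (\<iota> p) ?b" by (simp add: J_simps)
  then have "g (\<iota> p) (\<mu> p (X' p) *\<^sub>R ?b) (J (\<iota> p) ?b) = g (\<iota> p) (\<mu> p (X p) *\<^sub>R J (\<iota> p) ?b) (J (\<iota> p) ?b)"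
    by simp
  then have "\<mu> p (X p) * g (\<iota> p) ?b ?b = 0"
    by (simp add: bilinear_lmul[OF bilinear_metric] metric_J metric_J_self)
  \<comment> \<open>Either factor may be the one that vanishes; only the product matters for the
    claim.\<close>
  then have 0: "\<mu> p (X p) *\<^sub>R ?b = 0" using metric_eq_0 by auto
  show ?thesis unfolding D[OF U X Y Z \<xi>] 0 by (rule bilinear_lzero[OF bilinear_metric])
qed

section \<open>Curvature as a polynomial in parallel tensors\<close>

text \<open>The fully covariant curvature as given by the Gauss equation, with metric
  \<open>m\<close>, Kaehler form \<open>w\<close> and pairings \<open>b\<close> of values of the
  second fundamental form. Factors \<open>- 1\<close> stand in place of subtraction so that its
  derivative can be assembled from the sum and product rules alone.\<close>

definition curvature_form :: "('q \<Rightarrow> 'f) \<Rightarrow> ('q \<Rightarrow> 'f) \<Rightarrow> ('q \<Rightarrow> 'f) \<Rightarrow> ('q \<Rightarrow> 'f) \<Rightarrow> 'q \<Rightarrow> real" where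
  "curvature_form X Y Z W q = (let m = (\<lambda>X Y. g (\<iota> q) (T q (X q)) (T q (Y q)));
       w = (\<lambda>X Y. g (\<iota> q) (J (\<iota> q) (T q (X q))) (T q (Y q)));
       b = (\<lambda>X Y Z W. g (\<iota> q) (second_form q (X q) Y) (second_form q (Z q) W)) in
     (c / 4) * (m Y Z * m X W + (- 1) * (m X Z * m Y W) + w Y Z * w X W + (- 1) * (w X Z * w Y W) + 2 * (w Y X * w Z W))
     + (b Y Z X W + (- 1) * b X Z Y W))"

lemma metric_curvature:
  assumes U: "open U" "p \<in> U" and X: "smooth_field B U X" and Y: "smooth_field B U Y" and Z: "smooth_field B U Z"
    and W: "smooth_field B U W"
  shows "g (\<iota> p) (T p (curvature B nabF X Y Z p)) (T p (W p)) = curvature_form X Y Z W p"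
  unfolding gauss_equation[OF assms] along_curvature_differential[OF U X Y Z] space_form_tensor_def curvature_form_def Let_def
  by (simp add: metric_simps metric_sym[of "\<iota> p" "T p (X p)" "J (\<iota> p) _"] algebra_simps)

lemma smooth_curvature_F:
  assumes U: "open U" and X: "smooth_field B U X" and Y: "smooth_field B U Y" and Z: "smooth_field B U Z"
  shows "smooth_field B U (curvature B nabF X Y Z)"
proof -
  have neg: "smooth_field B U (\<lambda>q. X q - Y q)" if "smooth_field B U X" "smooth_field B U Y" for X Y
    using F.smooth_field_add[OF U that(1) F.smooth_field_scaleR[OF U F.smooth_fun_const[of _ "-1"] that(2)]] by simp
  \<comment> \<open>By torsion-freeness the bracket is a difference of covariant derivatives, whose
    smoothness is part of the definition of a connection.\<close>
  have L: "smooth_field B U (lie_bracket B X Y)"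
    by (rule F.smooth_field_cong[OF U torsion_free_F[OF U X Y, symmetric] neg[OF F.smooth_cov[OF U X Y] F.smooth_cov[OF U Y X]]])
  show ?thesis
    unfolding curvature_def[abs_def] by (intro neg F.smooth_cov U X Y Z L)
qed

text \<open>The formula for \<open>\<nabla>R\<close> is the Leibniz rule for \<open>curvature_form\<close>, whose ingredients, the metric, the Kaehler form
  and the pairing of two values of \<open>b\<close>, are all parallel.\<close>

lemma dir_deriv_curvature_form:
  assumes par: "\<And>U X Y Z p \<xi>. open U \<Longrightarrow> p \<in> U \<Longrightarrow> smooth_field B U X \<Longrightarrow> smooth_field B U Y \<Longrightarrow> smooth_field B U Z \<Longrightarrow>
      normal p \<xi> \<Longrightarrow> g (\<iota> p) (cov_second_form X Y Z p) \<xi> = 0"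
    and U: "open U" "p \<in> U" and V: "smooth_field B U V" and X: "smooth_field B U X" and Y: "smooth_field B U Y"
    and Z: "smooth_field B U Z" and W: "smooth_field B U W"
  shows "dir_deriv B p (V p) (curvature_form X Y Z W) = curvature_form (cov nabF V X) Y Z W p + curvature_form X (cov nabF V Y) Z W p
    + curvature_form X Y (cov nabF V Z) W p + curvature_form X Y Z (cov nabF V W) p"
proof -
  \<comment> \<open>Smoothness and the value of the derivative travel together, so that the rules
    compose without separate side conditions.\<close>
  define der where "der f a \<longleftrightarrow> smooth_fun B U f \<and> dir_deriv B p (V p) f = a" for f a
  have const: "der (\<lambda>q. a) 0" for a unfolding der_def by (simp add: F.smooth_fun_const F.dir_deriv_const)
  have add: "der (\<lambda>q. f q + h q) (a + b)" if "der f a" "der h b" for f h a b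
    using that U F.smooth_fun_add F.dir_deriv_add unfolding der_def by simp
  have mult: "der (\<lambda>q. f q * h q) (f p * b + a * h p)" if "der f a" "der h b" for f h a b
    using that U F.smooth_fun_mult F.dir_deriv_mult unfolding der_def by simp
  let ?n = "cov nabF V"
  have DT: "D p (V p) (\<lambda>q. T q (X q)) = T p (?n X p) + second_form p (V p) X" for X
    by (simp add: second_form_def cov_def)
  have m: "der (\<lambda>q. g (\<iota> q) (T q (X q)) (T q (Y q)))
      (g (\<iota> p) (T p (?n X p)) (T p (Y p)) + g (\<iota> p) (T p (X p)) (T p (?n Y p)))"
    if X: "smooth_field B U X" and Y: "smooth_field B U Y" for X Y
    using compatible[OF U(1) smooth_along_differential[OF U(1) X] smooth_along_differential[OF U(1) Y]] U(2)
    unfolding der_def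
    by (simp add: DT metric_simps normal_simps[OF normal_second_form[OF U X]] normal_simps[OF normal_second_form[OF U Y]])
  have w: "der (\<lambda>q. g (\<iota> q) (J (\<iota> q) (T q (X q))) (T q (Y q)))
      (g (\<iota> p) (J (\<iota> p) (T p (?n X p))) (T p (Y p)) + g (\<iota> p) (J (\<iota> p) (T p (X p))) (T p (?n Y p)))"
    if X: "smooth_field B U X" and Y: "smooth_field B U Y" for X Y
  proof -
    note sX = smooth_along_differential[OF U(1) X]
    have "g (\<iota> p) (J (\<iota> p) (second_form p (V p) X)) (T p (Y p)) = 0"
      by (rule normal_simps(1)[OF normal_J[OF normal_second_form[OF U X]]])
    moreover have "g (\<iota> p) (J (\<iota> p) (T p (X p))) (second_form p (V p) Y) = 0"
      using J_tangent[of p "X p"] normal_simps(2)[OF normal_second_form[OF U Y]] by auto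
    ultimately show ?thesis
      using compatible[OF U(1) smooth_along_J[OF U(1) sX] smooth_along_differential[OF U(1) Y]] U(2)
        cov_along_J[OF U(1) sX U(2)]
      unfolding der_def by (simp add: DT metric_simps J_simps)
  qed
  have b: "der (\<lambda>q. g (\<iota> q) (second_form q (X q) Y) (second_form q (Z q) W))
      (g (\<iota> p) (second_form p (?n X p) Y) (second_form p (Z p) W) + g (\<iota> p) (second_form p (X p) (?n Y)) (second_form p (Z p) W)
      + (g (\<iota> p) (second_form p (X p) Y) (second_form p (?n Z p) W) + g (\<iota> p) (second_form p (X p) Y) (second_form p (Z p) (?n W))))"
    if X: "smooth_field B U X" and Y: "smooth_field B U Y" and Z: "smooth_field B U Z" and W: "smooth_field B U W"
    for X Y Z W
  proof -
    \<comment> \<open>\<open>par\<close> concerns normal components only; this suffices because the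
      other factor in each pairing is a value of \<open>b\<close> and hence normal.\<close>
    have D: "g (\<iota> p) (D p (V p) (\<lambda>q. second_form q (X q) Y)) \<xi> =
        g (\<iota> p) (second_form p (?n X p) Y) \<xi> + g (\<iota> p) (second_form p (X p) (?n Y)) \<xi>"
      if "smooth_field B U X" "smooth_field B U Y" "normal p \<xi>" for X Y \<xi>
      using par[OF U V that] unfolding cov_second_form_def by (simp add: metric_simps)
    show ?thesis
      using compatible[OF U(1) smooth_second_form[OF U(1) X Y] smooth_second_form[OF U(1) Z W]] U(2)
        D[OF X Y normal_second_form[OF U W, of "Z p"]] D[OF Z W normal_second_form[OF U Y, of "X p"]]
      unfolding der_def by (simp add: metric_sym[of "\<iota> p" "second_form p (X p) Y"])
  qed
  \<comment> \<open>The nesting mirrors the term structure of \<open>curvature_form\<close>, one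
    rule per operation.\<close>
  note rule = add[OF mult[OF const[of "c / 4"] add[OF add[OF add[OF add[OF mult[OF m[OF Y Z] m[OF X W]]
      mult[OF const[of "-1"] mult[OF m[OF X Z] m[OF Y W]]]] mult[OF w[OF Y Z] w[OF X W]]]
      mult[OF const[of "-1"] mult[OF w[OF X Z] w[OF Y W]]]] mult[OF const[of 2] mult[OF w[OF Y X] w[OF Z W]]]]]
      add[OF b[OF Y Z X W] mult[OF const[of "-1"] b[OF X Z Y W]]]]
  show ?thesis
    using rule[unfolded der_def, THEN conjunct2] unfolding curvature_form_def[abs_def] Let_def
    by (simp only:) (simp add: algebra_simps)
qed

text \<open>The function g(R(X,Y)Z, W) is differentiated in two ways: by metric compatibility of
  \<open>nabF\<close>, and by the Leibniz rule for its Gauss expression. Comparing the results shows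
  that \<nabla>R pairs to zero with every tangent vector.\<close>

lemma parallel_imp_locally_symmetric:
  assumes par: "\<And>U X Y Z p \<xi>. open U \<Longrightarrow> p \<in> U \<Longrightarrow> smooth_field B U X \<Longrightarrow> smooth_field B U Y \<Longrightarrow> smooth_field B U Z \<Longrightarrow>
      normal p \<xi> \<Longrightarrow> g (\<iota> p) (cov_second_form X Y Z p) \<xi> = 0"
  shows "locally_symmetric B nabF"
  unfolding locally_symmetric_def
proof (intro allI impI ballI, elim conjE)
  fix U V X Y Z p
  assume U: "open U" "p \<in> U" and sU: "smooth_field B U V" "smooth_field B U X" "smooth_field B U Y" "smooth_field B U Z"
  let ?u = "cov_curvature B nabF V X Y Z p"
  have "g (\<iota> p) (T p ?u) (T p w) = 0" for w
  proof -
    obtain N W where N: "open N" "p \<in> N" "N \<subseteq> U" and W: "smooth_field B N W" "W p = w"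
      using extend_vector[OF U] by blast
    note V = F.smooth_field_subset[OF sU(1) N(3)] and X = F.smooth_field_subset[OF sU(2) N(3)]
      and Y = F.smooth_field_subset[OF sU(3) N(3)] and Z = F.smooth_field_subset[OF sU(4) N(3)]
    let ?n = "cov nabF V"
    note n = F.smooth_cov[OF N(1) V]
    let ?R = "curvature B nabF X Y Z"
    note R = smooth_curvature_F[OF N(1) X Y Z]
    have e: "g (\<iota> q) (T q (?R q)) (T q (W q)) = curvature_form X Y Z W q" if "q \<in> N" for q
      by (rule metric_curvature[OF N(1) that X Y Z W(1)])
    have s: "smooth_fun B N (\<lambda>q. g (\<iota> q) (T q (?R q)) (T q (W q)))"
      by (rule compatible(1)[OF N(1) smooth_along_differential[OF N(1) R] smooth_along_differential[OF N(1) W(1)]])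
    have "g (\<iota> p) (T p (?n ?R p)) (T p (W p)) + g (\<iota> p) (T p (?R p)) (T p (?n W p))
        = dir_deriv B p (V p) (curvature_form X Y Z W)"
      using metric_parallel_F[OF N(1) R W(1) N(2), of "V p"] F.dir_deriv_cong[OF N(1,2) e s]
      by (simp add: cov_def[of nabF V W] cov_def[of nabF V ?R])
    also have "\<dots> = curvature_form (?n X) Y Z W p + curvature_form X (?n Y) Z W p + curvature_form X Y (?n Z) W p + curvature_form X Y Z (?n W) p"
      by (rule dir_deriv_curvature_form[OF par N(1,2) V X Y Z W(1)])
    finally show ?thesis
      unfolding cov_curvature_def W(2)[symmetric]
      by (simp add: T_simps metric_simps metric_curvature[OF N(1,2) n[OF X] Y Z W(1)]
          metric_curvature[OF N(1,2) X n[OF Y] Z W(1)] metric_curvature[OF N(1,2) X Y n[OF Z] W(1)]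
          metric_curvature[OF N(1,2) X Y Z n[OF W(1)]])
  qed
  then have "T p ?u = T p 0" using metric_eq_0[of "\<iota> p" "T p ?u"] by (simp add: T_simps)
  then show "?u = 0" using inj_differential injD by metis
qed

end

theorem theorem0p2:
  fixes A :: "('p::{t2_space, second_countable_topology}, 'e::euclidean_space) chart set"
    and B :: "('q::{t2_space, second_countable_topology}, 'f::euclidean_space) chart set"
    and g :: "'p \<Rightarrow> 'e \<Rightarrow> 'e \<Rightarrow> real"
    and J :: "'p \<Rightarrow> 'e \<Rightarrow> 'e"
    and nabM :: "'p \<Rightarrow> 'e \<Rightarrow> ('p \<Rightarrow> 'e) \<Rightarrow> 'e"
    and nabF :: "'q \<Rightarrow> 'f \<Rightarrow> ('q \<Rightarrow> 'f) \<Rightarrow> 'f"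
    and \<iota> :: "'q \<Rightarrow> 'p"
    and c :: real and m l :: nat
  assumes "m \<ge> 1" and "l \<ge> 1"
    and "DIM('e) = 2 * m + 2 * l" and "DIM('f) = 2 * m"
    and "kaehler_manifold A g J nabM"
    and "constant_holomorphic_curvature A g J nabM c"
    and "kaehler_submanifold B A J \<iota>"
    and "levi_civita B (induced_metric B A g \<iota>) nabF"
    and "recurrent_second_fundamental_form B A g nabM nabF \<iota>"
  shows "locally_symmetric B nabF"
proof -
  note A = assms(5)[unfolded kaehler_manifold_def] and B = assms(7)[unfolded kaehler_submanifold_def immersion_def]
  interpret kaehler_immersion A nabM B \<iota> g nabF J c
  proof unfold_locales
    show "affine_connection A nabM" using A by (simp add: levi_civita_def)
    show "J (\<iota> p) (differential B A \<iota> p v) \<in> range (differential B A \<iota> p)" for p v using B by blast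
  qed (use A B assms in blast)+
  obtain \<mu> where rec: "\<And>U X Y Z p. open U \<Longrightarrow> smooth_field B U X \<Longrightarrow> smooth_field B U Y \<Longrightarrow> smooth_field B U Z \<Longrightarrow> p \<in> U \<Longrightarrow>
      vdWB_derivative B A g nabM nabF \<iota> X Y Z p = \<mu> p (X p) *\<^sub>R second_fundamental_form B A g nabM \<iota> Y Z p"
    using assms(9)[unfolded recurrent_second_fundamental_form_def] by metis
  show ?thesis
    by (rule parallel_imp_locally_symmetric, rule recurrent_imp_parallel[OF rec])
qed

end
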